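(* For any $s\in(0,1]$ and $t\in(s/2,s)$ there exists a compact set $X\subseteq\mathbb{R}^2$ with $\dim_{\mathrm H}X=s$ and $\dim_{\mathrm F}X=t$ such that for all $u<t$, $$\dim_{\mathrm H}\{V\in G(2,1):\dim_{\mathrm H}P_V(X)\le u\}=0,$$ and for all $u\ge t$, $$\dim_{\mathrm H}\{V\in G(2,1):\dim_{\mathrm H}P_V(X)\le u\}\ge 2t-s.$$
   Context: $G(2,1)$ is the Grassmannian of lines through the origin in $\mathbb{R}^2$, with its usual metric (e.g. $\|P_V-P_W\|$), with respect to which Hausdorff dimensions of subsets of $G(2,1)$ are taken. $P_V:\mathbb{R}^2\to V$ is orthogonal projection onto $V$, and $V$ is identified with $\mathbb{R}$. $\dim_{\mathrm H}$ denotes Hausdorff dimension, with $\dim_{\mathrm H}\varnothing=0$. For a set $X\subseteq\mathbb{R}^d$, $\mathcal M(X)$ is the set of Borel measures $\mu$ compactly supported on $X$ with $0<\mu(X)<\infty$. The Fourier transform of a finite Borel measure $\mu$ on $\mathbb{R}^d$ is $\widehat\mu(z)=\int e^{-2\pi i z\cdot x}\,d\mu(x)$. The Fourier dimension of $\mu$ is $\dim_{\mathrm F}\mu=\sup\{s\ge0:\ \exists C>0\ \forall z\neq 0,\ |\widehat\mu(z)|\le C|z|^{-s/2}\}$, and that of a Borel set $X\subseteq\mathbb{R}^d$ is $\dim_{\mathrm F}X=\sup\{\min\{\dim_{\mathrm F}\mu,d\}:\mu\in\mathcal M(X)\}$. *)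

theory Defs
  imports "HOL-Analysis.Analysis"
begin

section \<open>Hausdorff dimension\<close>

text \<open>
  The summand \<open>(diam U)\<^sup>s\<close> with the usual conventions: the empty set contributes \<open>0\<close>, and
  \<open>0\<^sup>0 = 1\<close> for nonempty \<open>U\<close> (whereas \<open>0 powr 0 = 0\<close> in the library).
\<close>

definition diam_power :: "real \<Rightarrow> 'a::metric_space set \<Rightarrow> real" where
  "diam_power s U = (if U = {} then 0 else if s = 0 then 1 else diameter U powr s)"

text \<open>Boundedness is required of the covering sets because \<open>diameter\<close> is meaningless without it.\<close>

definition hausdorff_content :: "real \<Rightarrow> real \<Rightarrow> 'a::metric_space set \<Rightarrow> ennreal" where
  "hausdorff_content \<delta> s A =
     Inf {(\<Sum>n. ennreal (diam_power s (U n))) | U :: nat \<Rightarrow> 'a set.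
            A \<subseteq> (\<Union>n. U n) \<and> (\<forall>n. bounded (U n) \<and> diameter (U n) \<le> \<delta>)}"

definition hausdorff_measure :: "real \<Rightarrow> 'a::metric_space set \<Rightarrow> ennreal" where
  "hausdorff_measure s A = (SUP \<delta>\<in>{0<..}. hausdorff_content \<delta> s A)"

definition hausdorff_dim :: "'a::metric_space set \<Rightarrow> ereal" where
  "hausdorff_dim A = Inf (ereal ` {s. 0 \<le> s \<and> hausdorff_measure s A = 0})"


section \<open>Fourier dimension\<close>

definition fourier_transform :: "'a::euclidean_space measure \<Rightarrow> 'a \<Rightarrow> complex" where
  "fourier_transform \<mu> z = (LINT x|\<mu>. exp (- 2 * of_real pi * \<i> * of_real (z \<bullet> x)))"

definition topological_support :: "'a::topological_space measure \<Rightarrow> 'a set" where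
  "topological_support \<mu> = {x. \<forall>U. open U \<longrightarrow> x \<in> U \<longrightarrow> 0 < emeasure \<mu> U}"

text \<open>
  The class \<open>\<M>(X)\<close>, for Borel \<open>X\<close>. Finiteness of \<open>\<mu>\<close> follows, as \<open>\<mu>\<close> vanishes off its support.
\<close>

definition compactly_supported_measures :: "'a::euclidean_space set \<Rightarrow> 'a measure set" where
  "compactly_supported_measures X =
     {\<mu>. sets \<mu> = sets borel \<and>
         compact (topological_support \<mu>) \<and> topological_support \<mu> \<subseteq> X \<and>
         0 < emeasure \<mu> X \<and> emeasure \<mu> X < \<infinity>}"

definition fourier_dim_measure :: "'a::euclidean_space measure \<Rightarrow> ereal" where
  "fourier_dim_measure \<mu> =
     Sup (ereal ` {s. 0 \<le> s \<and>
       (\<exists>C>0. \<forall>z. z \<noteq> 0 \<longrightarrow> cmod (fourier_transform \<mu> z) \<le> C * norm z powr (- s / 2))})"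

text \<open>
  The inserted \<open>0\<close> only implements the convention that the supremum over an empty class of
  measures is \<open>0\<close>.
\<close>

definition fourier_dim :: "'a::euclidean_space set \<Rightarrow> ereal" where
  "fourier_dim X =
     Sup (insert 0 ((\<lambda>\<mu>. min (fourier_dim_measure \<mu>) (ereal (real DIM('a))))
                      ` compactly_supported_measures X))"


section \<open>Orthogonal projections and the Grassmannian of lines in the plane\<close>

definition orth_proj :: "'a::euclidean_space set \<Rightarrow> 'a \<Rightarrow> 'a" where
  "orth_proj V x = (THE y. y \<in> V \<and> (\<forall>v\<in>V. orthogonal (x - y) v))"

lemma orth_proj_unique:
  fixes V :: "'a::euclidean_space set"
  assumes V: "subspace V" and y: "y \<in> V" "\<And>v. v \<in> V \<Longrightarrow> orthogonal (x - y) v"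
  shows "orth_proj V x = y"
  unfolding orth_proj_def
proof (rule the_equality)
  show "y \<in> V \<and> (\<forall>v\<in>V. orthogonal (x - y) v)" using y by blast
next
  fix z assume z: "z \<in> V \<and> (\<forall>v\<in>V. orthogonal (x - z) v)"
  have d: "z - y \<in> V" using z y V by (simp add: subspace_diff)
  have "(x - y) \<bullet> (z - y) = 0" "(x - z) \<bullet> (z - y) = 0"
    using d y z by (auto simp: orthogonal_def)
  then have "(z - y) \<bullet> (z - y) = 0" by (simp add: inner_diff_left)
  then show "z = y" by simp
qed

lemma orth_proj:
  fixes V :: "'a::euclidean_space set"
  assumes V: "subspace V"
  shows orth_proj_in: "orth_proj V x \<in> V"
    and orth_proj_orthogonal: "v \<in> V \<Longrightarrow> orthogonal (x - orth_proj V x) v"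
proof -
  obtain y z where yz: "y \<in> span V" "\<And>w. w \<in> span V \<Longrightarrow> orthogonal z w" "x = y + z"
    using orthogonal_subspace_decomp_exists[of V x] by blast
  have sp: "span V = V" using V by (simp add: span_eq_iff)
  have "orth_proj V x = y"
    by (rule orth_proj_unique[OF V]) (use yz sp in auto)
  with yz sp show "orth_proj V x \<in> V" "v \<in> V \<Longrightarrow> orthogonal (x - orth_proj V x) v"
    by auto
qed

lemma bounded_linear_orth_proj:
  fixes V :: "'a::euclidean_space set"
  assumes V: "subspace V"
  shows "bounded_linear (orth_proj V)"
proof (rule linear_conv_bounded_linear[THEN iffD1], rule linearI)
  fix x y
  have *: "(x + y) - (orth_proj V x + orth_proj V y) = (x - orth_proj V x) + (y - orth_proj V y)"
    by simp
  show "orth_proj V (x + y) = orth_proj V x + orth_proj V y"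
    by (rule orth_proj_unique[OF V], simp add: V orth_proj_in subspace_add)
       (unfold *, intro orthogonal_clauses orth_proj_orthogonal[OF V])
next
  fix c x
  have *: "c *\<^sub>R x - c *\<^sub>R orth_proj V x = c *\<^sub>R (x - orth_proj V x)"
    by (simp add: scaleR_diff_right)
  show "orth_proj V (c *\<^sub>R x) = c *\<^sub>R orth_proj V x"
    by (rule orth_proj_unique[OF V], simp add: V orth_proj_in subspace_scale)
       (unfold *, intro orthogonal_clauses orth_proj_orthogonal[OF V])
qed

lemma range_orth_proj:
  fixes V :: "'a::euclidean_space set"
  assumes V: "subspace V"
  shows "range (orth_proj V) = V"
proof
  show "range (orth_proj V) \<subseteq> V" using V by (auto intro: orth_proj_in)
  show "V \<subseteq> range (orth_proj V)"
  proof
    fix x assume "x \<in> V"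
    then have "orth_proj V x = x" by (intro orth_proj_unique[OF V]) (auto simp: orthogonal_def)
    then show "x \<in> range (orth_proj V)" by (metis rangeI)
  qed
qed

typedef grassmannian_2_1 = "{V :: (real^2) set. subspace V \<and> dim V = 1}"
  morphisms subspace_of Abs_grassmannian_2_1
proof -
  have "subspace (span {axis 1 1 :: real^2})" "dim (span {axis 1 1 :: real^2}) = 1"
    by (auto simp: dim_span axis_eq_0_iff dim_singleton)
  then show ?thesis by blast
qed

abbreviation proj :: "grassmannian_2_1 \<Rightarrow> real^2 \<Rightarrow> real^2" where
  "proj V \<equiv> orth_proj (subspace_of V)"

lemma subspace_subspace_of: "subspace (subspace_of V)"
  using subspace_of[of V] by simp

instantiation grassmannian_2_1 :: metric_space
begin

definition dist_grassmannian_2_1 :: "grassmannian_2_1 \<Rightarrow> grassmannian_2_1 \<Rightarrow> real" where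
  "dist V W = onorm (\<lambda>x. proj V x - proj W x)"

definition uniformity_grassmannian_2_1 :: "(grassmannian_2_1 \<times> grassmannian_2_1) filter" where
  "uniformity_grassmannian_2_1 = (INF e\<in>{0<..}. principal {(V, W). dist V W < e})"

definition open_grassmannian_2_1 :: "grassmannian_2_1 set \<Rightarrow> bool" where
  "open_grassmannian_2_1 S \<longleftrightarrow>
     (\<forall>V\<in>S. \<forall>\<^sub>F (V', W) in uniformity. V' = V \<longrightarrow> W \<in> S)"

instance
proof
  fix U V W :: grassmannian_2_1
  note bl = bounded_linear_orth_proj[OF subspace_subspace_of]
  show "dist V W = 0 \<longleftrightarrow> V = W"
  proof
    assume "dist V W = 0"
    then have "proj V x - proj W x = 0" for x
      using onorm_eq_0[OF bounded_linear_sub[OF bl[of V] bl[of W]]]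
      unfolding dist_grassmannian_2_1_def by auto
    then have "proj V = proj W" by (auto simp: fun_eq_iff)
    then have "subspace_of V = subspace_of W"
      by (metis range_orth_proj subspace_subspace_of)
    then show "V = W" by (simp add: subspace_of_inject)
  qed (simp add: dist_grassmannian_2_1_def onorm_zero)
  have "(\<lambda>x. proj V x - proj W x) = (\<lambda>x. (proj V x - proj U x) + (proj U x - proj W x))"
    by simp
  moreover have "(\<lambda>x. proj U x - proj W x) = (\<lambda>x. - (proj W x - proj U x))"
    by simp
  ultimately show "dist V W \<le> dist V U + dist W U"
    unfolding dist_grassmannian_2_1_def
    using onorm_triangle[OF bounded_linear_sub[OF bl[of V] bl[of U]]
        bounded_linear_sub[OF bl[of U] bl[of W]]]
      onorm_neg[of "\<lambda>x. proj W x - proj U x"] by simp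
qed (simp_all add: uniformity_grassmannian_2_1_def open_grassmannian_2_1_def)

end

end

theory Submission
  imports Defs "HOL-Probability.Probability"
begin

text \<open>
  The set \<open>X\<close> is the union of a Salem set \<open>A\<close> of dimension \<open>t\<close> and a set \<open>Y\<close> of dimension \<open>s\<close> that
  realises the Kaufman--Mattila example. Every line sees \<open>A\<close> in dimension at most \<open>t\<close>, while the
  decaying measure on \<open>A\<close> forces all projections of \<open>X\<close> to have dimension at least \<open>t\<close>: averaging
  a Gaussian kernel against the projected measure bounds its energy. Conversely a single line
  with \<open>dim P\<^sub>V X \<le> t\<close> bounds the Fourier dimension of \<open>X\<close> by \<open>t\<close>.

  \<open>A\<close> is the limit of a dyadic tree with \<open>2 ^ \<lfloor>k * t\<rfloor>\<close> nodes at level \<open>k\<close>, whose positions are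
  chosen greedily so that the exponential sums obey a Hoeffding-type bound at every level. \<open>Y\<close> is a
  product of two digit sets. At the scales \<open>e = 2 ^ - fact k\<close> it lies near the grid with meshes
  \<open>e ^ t\<close> and \<open>e ^ (s - t)\<close>; along slopes near the multiples of \<open>e ^ (2 * t - s)\<close>, which themselves
  form a digit set of dimension \<open>2 * t - s\<close>, the grid projects into a grid of mesh \<open>e ^ t\<close>.
\<close>

section \<open>Hausdorff measure and dimension\<close>

text \<open>The obstacle is that \<open>Y\<close> must be large at every scale, to have dimension
  \<open>s\<close>, and yet resemble a coarse grid at infinitely many scales, so that many
  projections are small. Covers may use convenient scales, but a lower bound must hold at all of
  them. Factorial scales reconcile the two: what precedes a block is negligible against it, so the
  digits of both coordinates keep their full lower density. The exponents are forced by a lattice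
  identity: slopes on mesh e^(2t-s) times ordinates on mesh e^(s-t) land on mesh e^t, that of the
  abscissae, and the grid has about e^(-s) points. As s/2 < t, the exceptional family has positive
  dimension, hence contains a line that caps the Fourier dimension. For \<open>A\<close>, random
  digits would give square-root cancellation; a potential argument replaces probability. Each level
  needs control at finitely many frequencies only: the sums are Lipschitz in the frequency, and
  beyond 8^k the smoothing by squares decays enough by itself. The net has exp(O(k)) points, so the
  logarithm costs a factor k, which 2^(-k(t-a)/2) absorbs.\<close>

lemma diameter_le_dist:
  fixes S :: "'a::metric_space set"
  assumes "0 \<le> d" "\<And>x y. x \<in> S \<Longrightarrow> y \<in> S \<Longrightarrow> dist x y \<le> d"
  shows "diameter S \<le> d"
  using assms by (auto simp: diameter_def intro!: cSUP_least)

lemma half_power_powr: "((1/2) ^ n) powr b = 2 powr (- (real n * b))"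
proof -
  have "(1/2::real) ^ n = 2 powr (- real n)"
    by (simp add: powr_minus_divide powr_realpow power_one_over)
  then show ?thesis by (simp add: powr_powr)
qed

lemma diam_power_nonneg: "0 \<le> diam_power s U"
  by (simp add: diam_power_def)

lemma diam_power_le:
  assumes "bounded U" "diameter U \<le> d" "0 \<le> s" "0 < d"
  shows "diam_power s U \<le> d powr s"
  using assms diameter_ge_0[OF assms(1)]
  by (auto simp: diam_power_def intro: powr_mono2)

lemma diam_power_less_imp_diameter_less:
  assumes "bounded U" "diam_power s U < d powr s" "0 < s" "0 < d"
  shows "diameter U < d"
proof (rule ccontr)
  assume "\<not> diameter U < d"
  then have "d \<le> diameter U" by simp
  moreover from this have "U \<noteq> {}" using assms by auto
  moreover have "d powr s \<le> diameter U powr s"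
    using \<open>d \<le> diameter U\<close> assms by (intro powr_mono2) auto
  ultimately have "d powr s \<le> diam_power s U"
    using assms by (simp add: diam_power_def)
  with assms show False by simp
qed

lemma hausdorff_measure_eq_0_iff:
  fixes A :: "'a::metric_space set"
  assumes s: "0 \<le> s"
  shows "hausdorff_measure s A = 0 \<longleftrightarrow>
    (\<forall>e>0. \<exists>U :: nat \<Rightarrow> 'a set. A \<subseteq> (\<Union>n. U n) \<and> (\<forall>n. bounded (U n)) \<and>
        (\<Sum>n. ennreal (diam_power s (U n))) < ennreal e)" (is "?L \<longleftrightarrow> ?R")
proof
  assume ?L
  show ?R
  proof (intro allI impI)
    fix e :: real assume "e > 0"
    have "hausdorff_content 1 s A \<le> hausdorff_measure s A"
      unfolding hausdorff_measure_def by (rule SUP_upper) auto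
    also have "\<dots> < ennreal e" using \<open>?L\<close> \<open>e > 0\<close> by simp
    finally show "\<exists>U :: nat \<Rightarrow> 'a set. A \<subseteq> (\<Union>n. U n) \<and> (\<forall>n. bounded (U n)) \<and>
        (\<Sum>n. ennreal (diam_power s (U n))) < ennreal e"
      unfolding hausdorff_content_def Inf_less_iff by blast
  qed
next
  assume R: ?R
  have "hausdorff_content \<delta> s A \<le> 0" if \<delta>: "\<delta> > 0" for \<delta>
  proof (rule ennreal_le_epsilon)
    fix e :: real assume e: "e > 0"
    define e' where "e' = min e (if s = 0 then 1 else \<delta> powr s)"
    have "e' > 0" using e \<delta> by (auto simp: e'_def)
    with R obtain U :: "nat \<Rightarrow> 'a set" where U: "A \<subseteq> (\<Union>n. U n)" "\<And>n. bounded (U n)"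
      "(\<Sum>n. ennreal (diam_power s (U n))) < ennreal e'" by blast
    have "diameter (U n) \<le> \<delta>" for n
    proof -
      have "ennreal (diam_power s (U n)) \<le> (\<Sum>n. ennreal (diam_power s (U n)))"
        using sum_le_suminf[of "\<lambda>n. ennreal (diam_power s (U n))" "{n}"] by simp
      also note U(3)
      finally have less: "diam_power s (U n) < e'"
        using \<open>e' > 0\<close> by (simp add: ennreal_less_iff diam_power_nonneg)
      show ?thesis
      proof (cases "s = 0")
        case True
        with less have "U n = {}" by (auto simp: diam_power_def e'_def split: if_splits)
        with \<delta> show ?thesis by simp
      next
        case False
        with less s U(2) \<delta> show ?thesis
          by (intro less_imp_le diam_power_less_imp_diameter_less[of _ s]) (auto simp: e'_def)
      qed
    qed
    then have "hausdorff_content \<delta> s A \<le> (\<Sum>n. ennreal (diam_power s (U n)))"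
      unfolding hausdorff_content_def using U by (intro Inf_lower) blast
    also have "\<dots> \<le> ennreal e" 
      using less_imp_le[OF U(3)] ennreal_leI[of e' e] unfolding e'_def by (meson min.cobounded1 order_trans)
    finally show "hausdorff_content \<delta> s A \<le> 0 + ennreal e" by simp
  qed
  then show ?L unfolding hausdorff_measure_def by (auto intro!: antisym SUP_least)
qed

text \<open>A total below \<open>1\<close> forces every nonempty member of the cover to have
  diameter below \<open>1\<close>, where raising the exponent lowers the summand.\<close>

lemma hausdorff_measure_eq_0_mono_dim:
  fixes A :: "'a::metric_space set"
  assumes z: "hausdorff_measure s A = 0" and s: "0 \<le> s" "s \<le> b"
  shows "hausdorff_measure b A = 0"
proof -
  have b: "0 \<le> b" using s by simp
  show ?thesis unfolding hausdorff_measure_eq_0_iff[OF b]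
  proof (intro allI impI)
    fix e :: real assume e: "e > 0"
    with z obtain U :: "nat \<Rightarrow> 'a set" where U: "A \<subseteq> (\<Union>n. U n)" "\<And>n. bounded (U n)"
      "(\<Sum>n. ennreal (diam_power s (U n))) < ennreal (min e 1)"
      unfolding hausdorff_measure_eq_0_iff[OF s(1)] by (metis min_less_iff_conj zero_less_one)
    have "diam_power b (U n) \<le> diam_power s (U n)" for n
    proof (cases "U n = {}")
      case False
      have "ennreal (diam_power s (U n)) \<le> (\<Sum>n. ennreal (diam_power s (U n)))"
        using sum_le_suminf[of "\<lambda>n. ennreal (diam_power s (U n))" "{n}"] by simp
      also note U(3)
      finally have less: "diam_power s (U n) < 1"
        using e by (simp add: ennreal_less_iff diam_power_nonneg)
      then have "s \<noteq> 0" using False by (auto simp: diam_power_def)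
      then have "s > 0" using s by simp
      with less U(2)[of n] have "diameter (U n) < 1"
        by (intro diam_power_less_imp_diameter_less[of _ s]) auto
      with \<open>s > 0\<close> s False show ?thesis
        using diameter_ge_0[OF U(2)[of n]]
        by (auto simp: diam_power_def intro: powr_mono')
    qed (simp add: diam_power_def)
    then have "(\<Sum>n. ennreal (diam_power b (U n))) \<le> (\<Sum>n. ennreal (diam_power s (U n)))"
      by (intro suminf_le) (auto intro: ennreal_leI)
    also have "\<dots> < ennreal e"
      using U(3) by (metis less_le_trans ennreal_leI min.cobounded1)
    finally show "\<exists>U :: nat \<Rightarrow> 'a set. A \<subseteq> (\<Union>n. U n) \<and> (\<forall>n. bounded (U n)) \<and>
        (\<Sum>n. ennreal (diam_power b (U n))) < ennreal e" using U by blast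
  qed
qed

lemma hausdorff_measure_Lipschitz_image:
  fixes f :: "'a::metric_space \<Rightarrow> 'b::metric_space"
  assumes z: "hausdorff_measure s A = 0" and s: "0 \<le> s"
    and lip: "\<And>x y. x \<in> A \<Longrightarrow> y \<in> A \<Longrightarrow> dist (f x) (f y) \<le> C * dist x y"
  shows "hausdorff_measure s (f ` A) = 0"
  unfolding hausdorff_measure_eq_0_iff[OF s]
proof (intro allI impI)
  fix e :: real assume e: "e > 0"
  \<comment> \<open>\<open>C\<close> may be zero or negative; \<open>D\<close> keeps the divisor
    \<open>D powr s\<close> positive.\<close>
  define D where "D = max C 1"
  have D: "D \<ge> 1" "C \<le> D" by (auto simp: D_def)
  then have Dp: "D powr s > 0" by simp
  have lipD: "dist (f x) (f y) \<le> D * dist x y" if "x \<in> A" "y \<in> A" for x y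
    using lip[OF that] mult_right_mono[OF D(2), of "dist x y"] by simp
  from z e Dp obtain U :: "nat \<Rightarrow> 'a set" where U: "A \<subseteq> (\<Union>n. U n)" "\<And>n. bounded (U n)"
    "(\<Sum>n. ennreal (diam_power s (U n))) < ennreal (e / D powr s)"
    unfolding hausdorff_measure_eq_0_iff[OF s] by (metis divide_pos_pos)
  define V where "V n = f ` (A \<inter> U n)" for n
  have dist_V: "dist p q \<le> D * diameter (U n)" if pq: "p \<in> V n" "q \<in> V n" for p q n
  proof -
    from pq obtain x y where xy: "x \<in> A" "y \<in> A" "x \<in> U n" "y \<in> U n" "p = f x" "q = f y"
      by (auto simp: V_def)
    have "dist x y \<le> diameter (U n)" using U(2) xy by (intro diameter_bounded_bound)
    then have "D * dist x y \<le> D * diameter (U n)" using D by simp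
    with lipD xy show ?thesis by force
  qed
  have bV: "bounded (V n)" for n
    unfolding bounded_two_points using dist_V by blast
  have "diam_power s (V n) \<le> D powr s * diam_power s (U n)" for n
  proof (cases "V n = {}")
    case False
    then have Un: "U n \<noteq> {}" by (auto simp: V_def)
    have "diameter (V n) \<le> D * diameter (U n)"
      using dist_V D diameter_ge_0[OF U(2)[of n]] by (intro diameter_le_dist) auto
    then have "diameter (V n) powr s \<le> (D * diameter (U n)) powr s"
      using s diameter_ge_0[OF bV[of n]] by (intro powr_mono2) auto
    also have "\<dots> = D powr s * diameter (U n) powr s"
      using D diameter_ge_0[OF U(2)[of n]] by (simp add: powr_mult)
    finally show ?thesis using False Un D by (auto simp: diam_power_def)
  qed (use D diam_power_nonneg[of s "U n"] in \<open>simp add: diam_power_def\<close>)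
  then have "(\<Sum>n. ennreal (diam_power s (V n)))
      \<le> (\<Sum>n. ennreal (D powr s) * ennreal (diam_power s (U n)))"
    by (intro suminf_le) (auto simp: ennreal_mult[symmetric] diam_power_nonneg intro: ennreal_leI)
  also have "\<dots> = ennreal (D powr s) * (\<Sum>n. ennreal (diam_power s (U n)))" by simp
  also have "\<dots> < ennreal (D powr s) * ennreal (e / D powr s)"
    using U(3) Dp by (intro ennreal_mult_strict_left_mono) auto
  also have "\<dots> = ennreal e" using Dp e by (subst ennreal_mult[symmetric]) auto
  finally have "(\<Sum>n. ennreal (diam_power s (V n))) < ennreal e" .
  moreover have "f ` A \<subseteq> (\<Union>n. V n)" using U(1) by (auto simp: V_def image_iff; blast)
  ultimately show "\<exists>U :: nat \<Rightarrow> 'b set. f ` A \<subseteq> (\<Union>n. U n) \<and> (\<forall>n. bounded (U n)) \<and>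
        (\<Sum>n. ennreal (diam_power s (U n))) < ennreal e" using bV by blast
qed

lemma hausdorff_measure_mono:
  assumes "A \<subseteq> B"
  shows "hausdorff_measure s A \<le> hausdorff_measure s B"
  unfolding hausdorff_measure_def hausdorff_content_def
  using assms by (intro SUP_mono' Inf_superset_mono) blast

lemma hausdorff_measure_Un_eq_0:
  fixes A B :: "'a::metric_space set"
  assumes s: "0 \<le> s" and "hausdorff_measure s A = 0" "hausdorff_measure s B = 0"
  shows "hausdorff_measure s (A \<union> B) = 0"
  unfolding hausdorff_measure_eq_0_iff[OF s]
proof (intro allI impI)
  fix e :: real assume "e > 0"
  then have e: "e / 2 > 0" by simp
  with assms obtain U :: "nat \<Rightarrow> 'a set" where U: "A \<subseteq> (\<Union>n. U n)" "\<And>n. bounded (U n)"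
    "(\<Sum>n. ennreal (diam_power s (U n))) < ennreal (e / 2)"
    unfolding hausdorff_measure_eq_0_iff[OF s] by metis
  from e assms obtain V :: "nat \<Rightarrow> 'a set" where V: "B \<subseteq> (\<Union>n. V n)" "\<And>n. bounded (V n)"
    "(\<Sum>n. ennreal (diam_power s (V n))) < ennreal (e / 2)"
    unfolding hausdorff_measure_eq_0_iff[OF s] by metis
  \<comment> \<open>Interleaving gives a single sequence, whose sum is then regrouped in consecutive
    pairs.\<close>
  define W where "W n = (if even n then U (n div 2) else V (n div 2))" for n
  define f where "f n = ennreal (diam_power s (W n))" for n
  have "(\<lambda>n. f (2 * n)) sums (\<Sum>n. f (2 * n))" "(\<lambda>n. f (2 * n + 1)) sums (\<Sum>n. f (2 * n + 1))"
    by (intro summable_sums; simp)+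
  have "suminf f = (\<Sum>n. sum f {n * 2..<n * 2 + 2})"
    using sums_group[of f "suminf f" 2] by (intro sums_unique) (auto intro: summable_sums)
  also have "\<dots> = (\<Sum>n. ennreal (diam_power s (U n)) + ennreal (diam_power s (V n)))"
  proof (intro arg_cong[of _ _ suminf] ext)
    fix n :: nat
    have "{n * 2..<n * 2 + 2} = {2 * n, 2 * n + 1}" by auto
    then show "sum f {n * 2..<n * 2 + 2} = ennreal (diam_power s (U n)) + ennreal (diam_power s (V n))"
      by (simp add: f_def W_def)
  qed
  also have "\<dots> = (\<Sum>n. ennreal (diam_power s (U n))) + (\<Sum>n. ennreal (diam_power s (V n)))"
    by (simp add: suminf_add)
  also have "\<dots> < ennreal (e / 2) + ennreal (e / 2)" using U(3) V(3) by (rule add_strict_mono)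
  also have "\<dots> = ennreal e" using e by (simp add: ennreal_plus[symmetric] del: ennreal_plus)
  finally have "(\<Sum>n. ennreal (diam_power s (W n))) < ennreal e" by (simp add: f_def[abs_def])
  moreover have "A \<union> B \<subseteq> (\<Union>n. W n)"
  proof
    fix x assume "x \<in> A \<union> B"
    then obtain n where "x \<in> U n \<or> x \<in> V n" using U(1) V(1) by blast
    then have "x \<in> W (2 * n) \<or> x \<in> W (2 * n + 1)" by (auto simp: W_def)
    then show "x \<in> (\<Union>n. W n)" by blast
  qed
  moreover have "\<forall>n. bounded (W n)" using U V by (auto simp: W_def)
  ultimately show "\<exists>U :: nat \<Rightarrow> 'a set. A \<union> B \<subseteq> (\<Union>n. U n) \<and> (\<forall>n. bounded (U n)) \<and>
        (\<Sum>n. ennreal (diam_power s (U n))) < ennreal e" by blast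
qed

lemma hausdorff_dim_leI:
  assumes "\<And>b. s < b \<Longrightarrow> hausdorff_measure b A = 0" and s: "0 \<le> s"
  shows "hausdorff_dim A \<le> ereal s"
proof (rule ereal_le_epsilon2)
  fix e :: real assume "e > 0"
  then have "hausdorff_measure (s + e) A = 0" using assms by simp
  then have "hausdorff_dim A \<le> ereal (s + e)"
    unfolding hausdorff_dim_def using s \<open>e > 0\<close> by (intro Inf_lower) auto
  then show "hausdorff_dim A \<le> ereal s + ereal e" by simp
qed

lemma hausdorff_dim_geI:
  assumes "\<And>b. 0 < b \<Longrightarrow> b < a \<Longrightarrow> hausdorff_measure b A \<noteq> 0"
  shows "ereal a \<le> hausdorff_dim A"
  unfolding hausdorff_dim_def
proof (intro Inf_greatest)
  fix y assume "y \<in> ereal ` {s. 0 \<le> s \<and> hausdorff_measure s A = 0}"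
  then obtain s where s: "y = ereal s" "0 \<le> s" "hausdorff_measure s A = 0" by auto
  have "a \<le> s"
  proof (rule ccontr)
    assume "\<not> a \<le> s"
    then obtain b where "s < b" "b < a" using dense[of s a] by auto
    with s assms[of b] hausdorff_measure_eq_0_mono_dim[of s A b] show False by auto
  qed
  with s show "ereal a \<le> y" by simp
qed

lemma hausdorff_measure_eq_0_of_dim_less:
  assumes "hausdorff_dim A < ereal b"
  shows "hausdorff_measure b A = 0"
proof -
  from assms obtain s where "0 \<le> s" "hausdorff_measure s A = 0" "s < b"
    unfolding hausdorff_dim_def Inf_less_iff by auto
  then show ?thesis using hausdorff_measure_eq_0_mono_dim[of s A b] by simp
qed

lemma hausdorff_dim_nonneg: "0 \<le> hausdorff_dim A"
  unfolding hausdorff_dim_def by (intro Inf_greatest) auto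

lemma hausdorff_dim_empty: "hausdorff_dim {} = 0"
proof -
  have "hausdorff_dim ({} :: 'a set) \<le> ereal 0"
  proof (rule hausdorff_dim_leI)
    fix b :: real assume "0 < b"
    then have b: "0 \<le> b" by simp
    show "hausdorff_measure b ({} :: 'a set) = 0"
      unfolding hausdorff_measure_eq_0_iff[OF b]
      by (auto intro!: exI[of _ "\<lambda>_. {}"] simp: diam_power_def)
  qed simp
  then show ?thesis using hausdorff_dim_nonneg[of "{} :: 'a set"] by (simp add: zero_ereal_def)
qed

lemma hausdorff_dim_mono: "A \<subseteq> B \<Longrightarrow> hausdorff_dim A \<le> hausdorff_dim B"
  unfolding hausdorff_dim_def
  by (intro Inf_superset_mono image_mono) (use hausdorff_measure_mono[of A B] in \<open>auto simp flip: le_zero_eq intro: order_trans\<close>)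

lemma hausdorff_dim_Lipschitz_image:
  fixes f :: "'a::metric_space \<Rightarrow> 'b::metric_space"
  assumes "\<And>x y. x \<in> A \<Longrightarrow> y \<in> A \<Longrightarrow> dist (f x) (f y) \<le> C * dist x y"
  shows "hausdorff_dim (f ` A) \<le> hausdorff_dim A"
  unfolding hausdorff_dim_def
  by (intro Inf_superset_mono image_mono Collect_mono)
     (use hausdorff_measure_Lipschitz_image[OF _ _ assms] in blast)

lemma hausdorff_dim_Un_leI:
  assumes "hausdorff_dim A \<le> ereal s" "hausdorff_dim B \<le> ereal s"
  shows "hausdorff_dim (A \<union> B) \<le> ereal s"
proof (rule hausdorff_dim_leI)
  show s: "0 \<le> s" using assms(1) hausdorff_dim_nonneg[of A] by (metis ereal_less_eq(5) order_trans)
  fix b assume b: "s < b"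
  then have "hausdorff_dim A < ereal b" "hausdorff_dim B < ereal b"
    using assms by (auto intro: le_less_trans)
  with b s show "hausdorff_measure b (A \<union> B) = 0"
    by (intro hausdorff_measure_Un_eq_0 hausdorff_measure_eq_0_of_dim_less) auto
qed

text \<open>
  Only infinitely many scales need to be controlled, which is what makes the dimension of a
  product of sparse digit sets additive.
\<close>

lemma hausdorff_dim_le_of_covers:
  fixes A :: "'a::metric_space set"
  assumes s: "0 \<le> s"
    and cov: "\<And>m::nat. \<exists>L\<ge>m. \<exists>J :: nat \<Rightarrow> 'a set. \<exists>N. A \<subseteq> (\<Union>i<N. J i) \<and>
      real N \<le> C * 2 powr (L * s) \<and> (\<forall>i<N. bounded (J i) \<and> diameter (J i) \<le> R * (1/2) ^ L)"
  shows "hausdorff_dim A \<le> ereal s"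
proof (rule hausdorff_dim_leI[OF _ s])
  fix b assume b: "s < b"
  then have b0: "0 \<le> b" "0 < b" using s by auto
  define R' where "R' = max R 1"
  have R': "R' > 0" "R \<le> R'" by (auto simp: R'_def)
  show "hausdorff_measure b A = 0"
    unfolding hausdorff_measure_eq_0_iff[OF b0(1)]
  proof (intro allI impI)
    fix e :: real assume e: "e > 0"
    \<comment> \<open>A cover at level \<open>L\<close> costs at most
      \<open>C * R' powr b * 2 powr (L * (s - b))\<close>, which tends to \<open>0\<close>, so one
      sufficiently high level is enough.\<close>
    have "(\<lambda>L::nat. C * R' powr b * (2 powr (s - b)) ^ L) \<longlonglongrightarrow> C * R' powr b * 0"
      using b by (intro tendsto_intros LIMSEQ_realpow_zero) (auto simp: powr_less_one)
    then have "\<forall>\<^sub>F L::nat in sequentially. C * R' powr b * (2 powr (s - b)) ^ L < e"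
      using e by (intro order_tendstoD) auto
    then obtain m where m: "\<And>L::nat. L \<ge> m \<Longrightarrow> C * R' powr b * (2 powr (s - b)) ^ L < e"
      by (auto simp: eventually_sequentially)
    obtain L J N where L: "L \<ge> m" "A \<subseteq> (\<Union>i<N. J i)" "real N \<le> C * 2 powr (L * s)"
      "\<And>i. i < N \<Longrightarrow> bounded (J i)" "\<And>i. i < N \<Longrightarrow> diameter (J i) \<le> R * (1/2) ^ L"
      using cov[of m] by metis
    define U where "U i = (if i < N then J i else {})" for i
    have d: "diam_power b (J i) \<le> (R' * (1/2) ^ L) powr b" if "i < N" for i
    proof -
      have "R * (1/2) ^ L \<le> R' * (1/2) ^ L" using R' by simp
      with L(5)[OF that] have "diameter (J i) \<le> R' * (1/2) ^ L" by linarith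
      then show ?thesis using L(4)[OF that] R' b0 by (intro diam_power_le) auto
    qed
    have "(\<Sum>n. ennreal (diam_power b (U n))) = (\<Sum>n<N. ennreal (diam_power b (U n)))"
      by (intro suminf_finite) (auto simp: U_def diam_power_def)
    also have "\<dots> = ennreal (\<Sum>n<N. diam_power b (U n))"
      by (simp add: diam_power_nonneg sum_ennreal)
    also have "\<dots> \<le> ennreal (\<Sum>n<N. (R' * (1/2) ^ L) powr b)"
      by (intro ennreal_leI sum_mono) (auto simp: U_def d)
    also have "(\<Sum>n<N. (R' * (1/2) ^ L) powr b) = N * (R' powr b * 2 powr (- L * b))"
      using R' by (simp add: powr_mult powr_realpow[symmetric] powr_powr powr_divide powr_minus divide_simps)
    also have "ennreal \<dots> \<le> ennreal (C * 2 powr (L * s) * (R' powr b * 2 powr (- L * b)))"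
      using L(3) by (intro ennreal_leI mult_right_mono) auto
    also have "C * 2 powr (L * s) * (R' powr b * 2 powr (- L * b)) = C * R' powr b * (2 powr (s - b)) ^ L"
      by (simp add: powr_realpow[symmetric] powr_powr powr_add[symmetric] algebra_simps)
    also have "ennreal \<dots> < ennreal e" using m[OF L(1)] e by (intro ennreal_lessI) auto
    finally have "(\<Sum>n. ennreal (diam_power b (U n))) < ennreal e" .
    moreover have "A \<subseteq> (\<Union>n. U n)" using L(2) by (force simp: U_def)
    ultimately show "\<exists>U :: nat \<Rightarrow> 'a set. A \<subseteq> (\<Union>n. U n) \<and> (\<forall>n. bounded (U n)) \<and>
        (\<Sum>n. ennreal (diam_power b (U n))) < ennreal e"
      using L(4) by (intro exI[of _ U]) (auto simp: U_def)
  qed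
qed

text \<open>The easy direction of Frostman's lemma. The mass lives on a parameter space and is
  carried over by \<open>g\<close>, so that Lebesgue measure on an interval can serve. The superset
  \<open>W\<close> stands in for the preimage of \<open>U\<close>, which may fail to be
  measurable.\<close>

lemma mass_distribution:
  fixes g :: "'b \<Rightarrow> 'a::metric_space"
  assumes G: "G \<in> sets M" "emeasure M G \<noteq> 0" and b: "0 < b"
    and cov: "\<And>n U. bounded U \<Longrightarrow> diameter U \<le> (1/2) ^ n \<Longrightarrow>
      \<exists>W\<in>sets M. G \<inter> g -` U \<subseteq> W \<and> emeasure M W \<le> ennreal (C * 2 powr (- (n * b)))"
  shows "hausdorff_measure b (g ` G) \<noteq> 0"
proof
  assume z: "hausdorff_measure b (g ` G) = 0"
  define D where "D = max C 1"
  have D: "D \<ge> 1" "C \<le> D" by (auto simp: D_def)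
  have b0: "0 \<le> b" using b by simp
  have "emeasure M G \<le> 0 + ennreal e" if e: "e > 0" for e
  proof -
    define e1 where "e1 = min 1 (e / (D * 2 * 2 powr b))"
    have e1: "e1 > 0" "e1 \<le> 1" using e D by (auto simp: e1_def)
    then obtain U where U: "g ` G \<subseteq> (\<Union>n. U n)" "\<And>n. bounded (U n)"
      "(\<Sum>n. ennreal (diam_power b (U n))) < ennreal e1"
      using z unfolding hausdorff_measure_eq_0_iff[OF b0] by metis
    define e2 where "e2 = e / (2 * D)"
    have e2: "e2 > 0" using e D by (auto simp: e2_def)
    \<comment> \<open>A positive diameter is rounded up to a power of \<open>1/2\<close>, at the
      price of the factor \<open>2 powr b\<close>. A set of diameter zero admits every scale, so its
      mass is charged to the summable reserve \<open>e2 * (1/2) ^ Suc i\<close>.\<close>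
    have "\<exists>n::nat. diameter (U i) \<le> (1/2) ^ n \<and>
      2 powr (- (n * b)) \<le> 2 powr b * diam_power b (U i) + e2 * (1/2) ^ Suc i" for i
    proof (cases "diameter (U i) = 0")
      case True
      have "(\<lambda>n::nat. (2 powr (- b)) ^ n) \<longlonglongrightarrow> 0"
        using b by (intro LIMSEQ_realpow_zero) (auto simp: powr_less_one)
      then have "\<forall>\<^sub>F n::nat in sequentially. (2 powr (- b)) ^ n < e2 * (1/2) ^ Suc i"
        using e2 by (intro order_tendstoD) auto
      then obtain n where "(2 powr (- b)) ^ n < e2 * (1/2) ^ Suc i"
        by (auto simp: eventually_sequentially)
      then have "2 powr (- (n * b)) \<le> e2 * (1/2) ^ Suc i"
        by (simp add: powr_realpow[symmetric] powr_powr mult.commute)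
      moreover have "0 \<le> 2 powr b * diam_power b (U i)" by (simp add: diam_power_nonneg)
      ultimately show ?thesis using True by (intro exI[of _ n]) auto
    next
      case False
      have d0: "diameter (U i) > 0" using False diameter_ge_0[OF U(2)[of i]] by simp
      have "ennreal (diam_power b (U i)) \<le> (\<Sum>n. ennreal (diam_power b (U n)))"
        using sum_le_suminf[of "\<lambda>n. ennreal (diam_power b (U n))" "{i}"] by simp
      also note U(3)
      finally have "diam_power b (U i) < 1"
        using e1 by (simp add: ennreal_less_iff diam_power_nonneg)
      then have d1: "diameter (U i) < 1"
        using b U(2) by (intro diam_power_less_imp_diameter_less[of _ b]) auto
      define n where "n = (LEAST n. (1/2) ^ n < diameter (U i))"
      obtain k where k: "(1/2) ^ k < diameter (U i)"
        using real_arch_pow_inv[OF d0, of "1/2"] by auto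
      have n: "(1/2) ^ n < diameter (U i)" "\<And>m. m < n \<Longrightarrow> \<not> (1/2) ^ m < diameter (U i)"
        unfolding n_def by (rule LeastI[of _ k], rule k) (rule not_less_Least)
      have "n \<noteq> 0" using n(1) d1 by (cases n) auto
      then obtain m where m: "n = Suc m" using not0_implies_Suc by blast
      have "2 powr (- (m * b)) = 2 powr b * ((1/2) ^ n) powr b"
        unfolding m half_power_powr powr_add[symmetric] by (simp add: algebra_simps)
      also have "\<dots> \<le> 2 powr b * diameter (U i) powr b"
        using n(1) b by (intro mult_left_mono powr_mono2) auto
      also have "\<dots> = 2 powr b * diam_power b (U i)" using d0 b by (auto simp: diam_power_def)
      finally have "2 powr (- (m * b)) \<le> 2 powr b * diam_power b (U i) + e2 * (1/2) ^ Suc i"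
        using e2 by (smt (verit) mult_nonneg_nonneg zero_le_power zero_le_divide_1_iff)
      moreover have "diameter (U i) \<le> (1/2) ^ m" using n(2)[of m] m by simp
      ultimately show ?thesis by blast
    qed
    then obtain n :: "nat \<Rightarrow> nat" where n: "\<And>i. diameter (U i) \<le> (1/2) ^ n i"
      "\<And>i. 2 powr (- (n i * b)) \<le> 2 powr b * diam_power b (U i) + e2 * (1/2) ^ Suc i"
      by metis
    have "\<exists>W\<in>sets M. G \<inter> g -` U i \<subseteq> W \<and> emeasure M W \<le> ennreal (C * 2 powr (- (n i * b)))" for i
      by (rule cov[OF U(2) n(1)])
    then obtain W where W: "\<And>i. W i \<in> sets M" "\<And>i. G \<inter> g -` U i \<subseteq> W i"
      "\<And>i. emeasure M (W i) \<le> ennreal (C * 2 powr (- (n i * b)))" by metis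
    have Wb: "emeasure M (W i) \<le> ennreal (D * 2 powr b) * ennreal (diam_power b (U i)) +
        ennreal (D * e2 * (1/2) ^ Suc i)" for i
    proof -
      have "C * 2 powr (- (n i * b)) \<le> D * (2 powr b * diam_power b (U i) + e2 * (1/2) ^ Suc i)"
        using n(2)[of i] D by (intro mult_mono) auto
      also have "\<dots> = (D * 2 powr b) * diam_power b (U i) + D * e2 * (1/2) ^ Suc i"
        by (simp add: algebra_simps)
      finally have "ennreal (C * 2 powr (- (n i * b)))
          \<le> ennreal ((D * 2 powr b) * diam_power b (U i) + D * e2 * (1/2) ^ Suc i)"
        by (rule ennreal_leI)
      also have "\<dots> = ennreal (D * 2 powr b) * ennreal (diam_power b (U i)) +
        ennreal (D * e2 * (1/2) ^ Suc i)"
        using D e2 by (subst ennreal_plus) (auto simp: ennreal_mult diam_power_nonneg)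
      finally show ?thesis using W(3)[of i] by (rule order_trans[rotated])
    qed
    have "G \<subseteq> (\<Union>i. W i)" using U(1) W(2) by blast
    then have "emeasure M G \<le> emeasure M (\<Union>i. W i)" using W(1) by (intro emeasure_mono) auto
    also have "\<dots> \<le> (\<Sum>i. emeasure M (W i))" using W(1) by (intro emeasure_subadditive_countably) auto
    also have "\<dots> \<le> (\<Sum>i. ennreal (D * 2 powr b) * ennreal (diam_power b (U i)) +
        ennreal (D * e2 * (1/2) ^ Suc i))" by (intro suminf_le Wb) auto
    also have "\<dots> = ennreal (D * 2 powr b) * (\<Sum>i. ennreal (diam_power b (U i))) +
        (\<Sum>i. ennreal (D * e2 * (1/2) ^ Suc i))" by (subst suminf_add[symmetric]) auto
    also have "(\<Sum>i. ennreal (D * e2 * (1/2) ^ Suc i)) = ennreal (D * e2)"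
    proof -
      have "(\<lambda>i. D * e2 * (1/2) ^ Suc i) sums (D * e2 * 1)"
        by (intro sums_mult power_half_series)
      then show ?thesis using D e2 by (subst suminf_ennreal_eq) auto
    qed
    also have "ennreal (D * 2 powr b) * (\<Sum>i. ennreal (diam_power b (U i)))
        \<le> ennreal (D * 2 powr b) * ennreal e1"
      using U(3) by (intro mult_left_mono) auto
    also have "\<dots> = ennreal (D * 2 powr b * e1)" using D e1 by (subst ennreal_mult) auto
    also have "\<dots> + ennreal (D * e2) = ennreal (D * 2 powr b * e1 + D * e2)"
      using D e1 e2 by (subst ennreal_plus) auto
    also have "\<dots> \<le> ennreal e"
    proof (rule ennreal_leI)
      have "D * 2 powr b * e1 \<le> D * 2 powr b * (e / (D * 2 * 2 powr b))"
        using D by (intro mult_left_mono) (auto simp: e1_def)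
      also have "\<dots> = e / 2" using D by simp
      finally show "D * 2 powr b * e1 + D * e2 \<le> e" using D by (simp add: e2_def)
    qed
    finally show ?thesis by (simp add: add_right_mono)
  qed
  then have "emeasure M G \<le> 0" by (rule ennreal_le_epsilon)
  with G show False by simp
qed

section \<open>Dyadic trees\<close>

text \<open>
  A tree with \<open>2 ^ c k\<close> nodes at level \<open>k\<close>; node \<open>j\<close> of level \<open>k\<close> carries the point \<open>x k j\<close>, and the
  parent of a node is found by deleting the last \<open>c (Suc k) - c k\<close> binary digits of its index. The
  binary expansion of a number in \<open>[0,1)\<close> describes a branch, so that Lebesgue measure pushes
  forward to the uniform measure on the set of limit points.
\<close>

lemma closed_topological_support: "closed (topological_support \<mu>)"
proof -
  have "- topological_support \<mu> = \<Union>{U. open U \<and> emeasure \<mu> U = 0}"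
    by (auto simp: topological_support_def)
  then show ?thesis unfolding closed_def by (simp only:) (intro open_Union, blast)
qed

locale dyadic_tree =
  fixes c :: "nat \<Rightarrow> nat" and x :: "nat \<Rightarrow> nat \<Rightarrow> real^2"
  assumes c_Suc: "c k \<le> c (Suc k)"
    and step: "norm (x (Suc k) j - x k (j div 2 ^ (c (Suc k) - c k))) \<le> (1/2) ^ k"
begin

definition idx :: "nat \<Rightarrow> real \<Rightarrow> nat" where
  "idx k w = nat \<lfloor>2 ^ c k * w\<rfloor>"

definition branch :: "real \<Rightarrow> real^2" where
  "branch w = lim (\<lambda>k. x k (idx k w))"

text \<open>Numbers in \<open>[0,1)\<close> do not encode the branches whose digits are eventually
  all \<open>1\<close>; the closure adds their limit points.\<close>

definition limit_set :: "(real^2) set" where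
  "limit_set = closure (branch ` {0..<1})"

lemma idx_Suc: "idx k w = idx (Suc k) w div 2 ^ (c (Suc k) - c k)" if "0 \<le> w"
proof -
  define d where "d = c (Suc k) - c k"
  have cS: "c (Suc k) = c k + d" using c_Suc[of k] by (simp add: d_def)
  have "\<lfloor>2 ^ c k * w\<rfloor> = \<lfloor>2 ^ c (Suc k) * w / real (2 ^ d)\<rfloor>"
    by (simp add: cS power_add)
  also have "\<dots> = \<lfloor>2 ^ c (Suc k) * w\<rfloor> div int (2 ^ d)"
    by (simp only: of_int_of_nat_eq[symmetric, where 'a = real] floor_divide_real_eq_div[OF of_nat_0_le_iff])
  finally have "\<lfloor>2 ^ c k * w\<rfloor> = \<lfloor>2 ^ c (Suc k) * w\<rfloor> div int (2 ^ d)" .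
  moreover have "0 \<le> \<lfloor>2 ^ c (Suc k) * w\<rfloor>" using that by simp
  ultimately show ?thesis
    unfolding idx_def d_def[symmetric] by (simp only: nat_div_distrib nat_int)
qed

lemma idx_less: "0 \<le> w \<Longrightarrow> w < 1 \<Longrightarrow> idx k w < 2 ^ c k"
  unfolding idx_def by (subst nat_less_iff) (simp_all add: floor_less_iff)

lemma idx_eq_iff: "0 \<le> w \<Longrightarrow> idx k w = j \<longleftrightarrow> real j / 2 ^ c k \<le> w \<and> w < (real j + 1) / 2 ^ c k"
proof -
  assume "0 \<le> w"
  then have "0 \<le> \<lfloor>2 ^ c k * w\<rfloor>" by simp
  then have "idx k w = j \<longleftrightarrow> \<lfloor>2 ^ c k * w\<rfloor> = int j" unfolding idx_def by linarith
  also have "\<dots> \<longleftrightarrow> real j \<le> 2 ^ c k * w \<and> 2 ^ c k * w < real j + 1"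
    by (simp only: floor_eq_iff of_int_of_nat_eq)
  also have "\<dots> \<longleftrightarrow> real j / 2 ^ c k \<le> w \<and> w < (real j + 1) / 2 ^ c k"
    by (simp add: pos_divide_le_eq pos_less_divide_eq mult.commute)
  finally show ?thesis .
qed

lemma step_idx: "0 \<le> w \<Longrightarrow> norm (x (Suc k) (idx (Suc k) w) - x k (idx k w)) \<le> (1/2) ^ k"
  using step[of k "idx (Suc k) w"] idx_Suc[of w k] by simp

text \<open>The steps form a geometric series. Keeping the factor \<open>1 - (1/2) ^ m\<close> lets
  the induction close.\<close>

lemma step_idx_add:
  assumes "0 \<le> w"
  shows "norm (x (k + m) (idx (k + m) w) - x k (idx k w)) \<le> 2 * (1/2) ^ k * (1 - (1/2) ^ m)"
proof (induction m)
  case (Suc m)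
  have "norm (x (k + Suc m) (idx (k + Suc m) w) - x k (idx k w))
    \<le> norm (x (Suc (k + m)) (idx (Suc (k + m)) w) - x (k + m) (idx (k + m) w))
      + norm (x (k + m) (idx (k + m) w) - x k (idx k w))"
    using dist_triangle[of "x (Suc (k + m)) (idx (Suc (k + m)) w)" "x k (idx k w)"
        "x (k + m) (idx (k + m) w)"] unfolding dist_norm add_Suc_right .
  also have "\<dots> \<le> (1/2) ^ (k + m) + 2 * (1/2) ^ k * (1 - (1/2) ^ m)"
    by (intro add_mono Suc step_idx[OF assms])
  also have "\<dots> = 2 * (1/2) ^ k * (1 - (1/2) ^ Suc m)" by (simp add: power_add right_diff_distrib)
  finally show ?case .
qed simp

lemma LIMSEQ_branch:
  assumes "0 \<le> w"
  shows "(\<lambda>k. x k (idx k w)) \<longlonglongrightarrow> branch w"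
proof -
  have "Cauchy (\<lambda>k. x k (idx k w))"
  proof (rule metric_CauchyI)
    fix e :: real assume "e > 0"
    then obtain K where K: "(1/2) ^ K < e / 4" using real_arch_pow_inv[of "e/4" "1/2"] by auto
    have b: "dist (x m (idx m w)) (x K (idx K w)) \<le> 2 * (1/2) ^ K" if "m \<ge> K" for m
    proof -
      have "dist (x m (idx m w)) (x K (idx K w)) \<le> 2 * (1/2) ^ K * (1 - (1/2) ^ (m - K))"
        using step_idx_add[OF assms, of K "m - K"] that by (simp add: dist_norm)
      also have "\<dots> \<le> 2 * (1/2) ^ K * 1" by (intro mult_left_mono) auto
      finally show ?thesis by simp
    qed
    show "\<exists>M. \<forall>m\<ge>M. \<forall>n\<ge>M. dist (x m (idx m w)) (x n (idx n w)) < e"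
    proof (intro exI[of _ K] allI impI)
      fix m n assume mn: "m \<ge> K" "n \<ge> K"
      have "dist (x m (idx m w)) (x n (idx n w)) \<le> 2 * (1/2) ^ K + 2 * (1/2) ^ K"
        by (rule order_trans[OF dist_triangle2 add_mono[OF b[OF mn(1)] b[OF mn(2)]]])
      then show "dist (x m (idx m w)) (x n (idx n w)) < e" using K by simp
    qed
  qed
  then show ?thesis unfolding branch_def by (simp only: Cauchy_convergent_iff convergent_LIMSEQ_iff)
qed

lemma dist_branch:
  assumes "0 \<le> w"
  shows "dist (x k (idx k w)) (branch w) \<le> 2 * (1/2) ^ k"
proof -
  have "(\<lambda>m. norm (x (m + k) (idx (m + k) w) - x k (idx k w))) \<longlonglongrightarrow> norm (branch w - x k (idx k w))"
    by (intro tendsto_intros LIMSEQ_ignore_initial_segment LIMSEQ_branch assms)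
  moreover have "norm (x (m + k) (idx (m + k) w) - x k (idx k w)) \<le> 2 * (1/2) ^ k" for m
  proof -
    have "norm (x (m + k) (idx (m + k) w) - x k (idx k w)) \<le> 2 * (1/2) ^ k * (1 - (1/2) ^ m)"
      using step_idx_add[OF assms, of k m] by (simp add: add.commute)
    also have "\<dots> \<le> 2 * (1/2) ^ k * 1" by (intro mult_left_mono) auto
    finally show ?thesis by simp
  qed
  ultimately have "norm (branch w - x k (idx k w)) \<le> 2 * (1/2) ^ k"
    by (blast intro: LIMSEQ_le_const2)
  then show ?thesis by (simp add: dist_norm norm_minus_commute)
qed

lemma branch_subset_cballs: "branch ` {0..<1} \<subseteq> (\<Union>j<2 ^ c k. cball (x k j) (2 * (1/2) ^ k))"
proof
  fix p assume "p \<in> branch ` {0..<1}"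
  then obtain w where w: "0 \<le> w" "w < 1" "p = branch w" by auto
  then show "p \<in> (\<Union>j<2 ^ c k. cball (x k j) (2 * (1/2) ^ k))"
    using dist_branch[of w k] idx_less[of w k] by auto
qed

lemma limit_set_subset_cballs: "limit_set \<subseteq> (\<Union>j<2 ^ c k. cball (x k j) (2 * (1/2) ^ k))"
  unfolding limit_set_def by (intro closure_minimal branch_subset_cballs closed_UN) auto

lemma compact_limit_set: "compact limit_set"
proof -
  have "bounded (\<Union>j<2 ^ c 0. cball (x 0 j) (2 * (1/2) ^ 0))" by (intro bounded_UN) auto
  then have "bounded (branch ` {0..<1})" using branch_subset_cballs[of 0] by (rule bounded_subset)
  then show ?thesis unfolding limit_set_def by simp
qed

lemma branch_in_limit_set: "0 \<le> w \<Longrightarrow> w < 1 \<Longrightarrow> branch w \<in> limit_set"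
  unfolding limit_set_def by (intro subsetD[OF closure_subset]) auto

lemma measurable_idx: "idx k \<in> measurable borel (count_space UNIV)"
  unfolding idx_def[abs_def] by measurable

lemma measurable_node [measurable]: "(\<lambda>w. x k (idx k w)) \<in> borel_measurable borel"
  by (rule measurable_compose[OF measurable_idx]) simp

lemma measurable_branch:
  "branch \<in> borel_measurable (restrict_space lborel {0..<1})"
proof (rule borel_measurable_LIMSEQ_metric)
  fix k show "(\<lambda>w. x k (idx k w)) \<in> borel_measurable (restrict_space lborel {0..<1})"
    by (intro measurable_restrict_space1) simp
qed (auto simp: space_restrict_space intro: LIMSEQ_branch)

lemma hausdorff_dim_limit_set_le:
  fixes s :: real
  assumes "0 \<le> s" and "\<And>m. \<exists>L\<ge>m. real (c L) \<le> real L * s"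
  shows "hausdorff_dim limit_set \<le> ereal s"
proof (rule hausdorff_dim_le_of_covers[OF assms(1), where C = 1 and R = 4])
  fix m :: nat
  obtain L where L: "L \<ge> m" "real (c L) \<le> real L * s" using assms(2) by blast
  show "\<exists>L\<ge>m. \<exists>J N. limit_set \<subseteq> (\<Union>i<N. J i) \<and> real N \<le> 1 * 2 powr (L * s) \<and>
      (\<forall>i<N. bounded (J i) \<and> diameter (J i) \<le> 4 * (1/2) ^ L)"
  proof (intro exI conjI allI impI)
    show "limit_set \<subseteq> (\<Union>i<2 ^ c L. cball (x L i) (2 * (1/2) ^ L))" by (rule limit_set_subset_cballs)
    have "real (2 ^ c L) = 2 powr c L" by (simp add: powr_realpow)
    also have "\<dots> \<le> 2 powr (L * s)" using L by (intro powr_mono) auto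
    finally show "real (2 ^ c L) \<le> 1 * 2 powr (L * s)" by simp
    fix i
    show "bounded (cball (x L i) (2 * (1/2) ^ L))" by simp
    show "diameter (cball (x L i) (2 * (1/2) ^ L)) \<le> 4 * (1/2) ^ L" by (simp add: diameter_cball)
  qed (rule L)
qed

text \<open>Lebesgue measure on \<open>[0,1)\<close> is the mass. The nodes of level
  \<open>n\<close> are distinct points of a grid of mesh \<open>2 ^ - n\<close>, so boundedly many
  of them lie near a set of diameter \<open>2 ^ - n\<close>, and each carries mass
  \<open>2 ^ - c n\<close>.\<close>

lemma hausdorff_dim_limit_set_ge:
  fixes s :: real
  assumes inj: "\<And>k. inj_on (x k) {..<2 ^ c k}"
    and grid: "\<And>k j. \<exists>a b :: int. x k j = vector [real_of_int a / 2 ^ k, real_of_int b / 2 ^ k]"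
    and gr: "\<And>b. 0 < b \<Longrightarrow> b < s \<Longrightarrow> \<exists>B. \<forall>k. b * real k \<le> real (c k) + B"
  shows "ereal s \<le> hausdorff_dim limit_set"
proof -
  have "hausdorff_measure b (branch ` {0..<1}) \<noteq> 0" if b: "0 < b" "b < s" for b
  proof -
    obtain B where B: "\<And>k. b * real k \<le> real (c k) + B" using gr[OF b] by blast
    show ?thesis
    proof (rule mass_distribution[where M = lborel and C = "64 * 2 powr B", OF _ _ b(1)])
      fix n and U :: "(real^2) set"
      assume U: "bounded U" "diameter U \<le> (1/2) ^ n"
      show "\<exists>W\<in>sets lborel. {0..<1} \<inter> branch -` U \<subseteq> W \<and>
          emeasure lborel W \<le> ennreal (64 * 2 powr B * 2 powr (- (n * b)))"
      proof (cases "U = {}")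
        case False
        then obtain u where u: "u \<in> U" by auto
        \<comment> \<open>A branch ending in \<open>U\<close> is within \<open>2 * (1/2) ^ n\<close>
          of its node and within \<open>(1/2) ^ n\<close> of \<open>u\<close>, hence the radius
          \<open>3\<close>. In units of the mesh each coordinate then leaves at most
          \<open>8\<close> integers, and \<open>64 = 8 * 8\<close>.\<close>
        define J where "J = {j. j < 2 ^ c n \<and> norm (x n j - u) \<le> 3 * (1/2) ^ n}"
        define G where "G = {\<lceil>2 ^ n * u $ 1 - 3\<rceil>..\<lfloor>2 ^ n * u $ 1 + 3\<rfloor>} \<times>
          {\<lceil>2 ^ n * u $ 2 - 3\<rceil>..\<lfloor>2 ^ n * u $ 2 + 3\<rfloor>}"
        define W where "W = (\<Union>j\<in>J. {real j / 2 ^ c n..<(real j + 1) / 2 ^ c n})"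
        have finJ: "finite J" by (simp add: J_def)
        have "x n ` J \<subseteq> (\<lambda>(a, b). vector [real_of_int a / 2 ^ n, real_of_int b / 2 ^ n]) ` G"
        proof
          fix p assume "p \<in> x n ` J"
          then obtain j where j: "p = x n j" "norm (x n j - u) \<le> 3 * (1/2) ^ n" by (auto simp: J_def)
          obtain a b :: int where ab: "x n j = vector [real_of_int a / 2 ^ n, real_of_int b / 2 ^ n]" using grid by blast
          have "\<bar>(x n j - u) $ i\<bar> \<le> 3 * (1/2) ^ n" for i
            using component_le_norm_cart[of "x n j - u" i] j by simp
          from this[of 1] this[of 2] have "\<bar>a / 2 ^ n - u $ 1\<bar> \<le> 3 / 2 ^ n" "\<bar>b / 2 ^ n - u $ 2\<bar> \<le> 3 / 2 ^ n"
            by (simp_all add: ab power_one_over)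
          moreover have "\<bar>real_of_int k - 2 ^ n * v\<bar> \<le> 3" if "\<bar>k / 2 ^ n - v\<bar> \<le> 3 / 2 ^ n" for k v
          proof -
            have "real_of_int k - 2 ^ n * v = 2 ^ n * (k / 2 ^ n - v)" by (simp add: right_diff_distrib)
            then have "\<bar>real_of_int k - 2 ^ n * v\<bar> = 2 ^ n * \<bar>k / 2 ^ n - v\<bar>" by (simp add: abs_mult)
            also have "\<dots> \<le> 2 ^ n * (3 / 2 ^ n)" using that by (intro mult_left_mono) auto
            finally show ?thesis by simp
          qed
          ultimately have "\<bar>a - 2 ^ n * u $ 1\<bar> \<le> 3" "\<bar>b - 2 ^ n * u $ 2\<bar> \<le> 3" by blast+
          then have "(a, b) \<in> G" unfolding G_def mem_Times_iff fst_conv snd_conv atLeastAtMost_iff by linarith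
          then show "p \<in> (\<lambda>(a, b). vector [real_of_int a / 2 ^ n, real_of_int b / 2 ^ n]) ` G"
            using ab j(1) by (intro image_eqI[where x = "(a, b)"]) simp_all
        qed
        then have "card (x n ` J) \<le> card G"
          by (intro surj_card_le) (auto simp: G_def)
        moreover have "card (x n ` J) = card J"
          using inj[of n] by (intro card_image inj_on_subset[OF inj]) (auto simp: J_def)
        moreover have "card G \<le> 8 * 8"
        proof -
          have "card {\<lceil>v - 3\<rceil>..\<lfloor>v + 3\<rfloor>} \<le> 8" for v :: real by (simp; linarith)
          then show ?thesis unfolding G_def card_cartesian_product by (intro mult_mono) auto
        qed
        ultimately have cardJ: "card J \<le> 64" by simp
        have "W \<in> sets lborel" using finJ by (auto simp: W_def)
        moreover have "{0..<1} \<inter> branch -` U \<subseteq> W"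
        proof
          fix w assume "w \<in> {0..<1} \<inter> branch -` U"
          then have w: "0 \<le> w" "w < 1" "branch w \<in> U" by auto
          have "dist (branch w) u \<le> (1/2) ^ n"
            using diameter_bounded_bound[OF U(1) w(3) u] U(2) by simp
          with dist_branch[OF w(1), of n] have "dist (x n (idx n w)) u \<le> 3 * (1/2) ^ n"
            using dist_triangle[of "x n (idx n w)" u "branch w"] by simp
          then have "idx n w \<in> J" using idx_less[OF w(1,2), of n] by (simp add: J_def dist_norm)
          moreover have "w \<in> {real (idx n w) / 2 ^ c n..<(real (idx n w) + 1) / 2 ^ c n}"
            using idx_eq_iff[OF w(1), of n "idx n w"] by simp
          ultimately show "w \<in> W" unfolding W_def by blast
        qed
        moreover have "emeasure lborel W \<le> ennreal (64 * 2 powr B * 2 powr (- (n * b)))"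
        proof -
          have "emeasure lborel W \<le> (\<Sum>j\<in>J. emeasure lborel {real j / 2 ^ c n..<(real j + 1) / 2 ^ c n})"
            unfolding W_def using finJ by (intro emeasure_subadditive_finite) auto
          also have "\<dots> = (\<Sum>j\<in>J. ennreal (1 / 2 ^ c n))"
            by (intro sum.cong refl) (simp add: divide_right_mono diff_divide_distrib[symmetric])
          also have "\<dots> = ennreal (card J * (1 / 2 ^ c n))"
            by (simp only: sum_constant) (simp add: ennreal_of_nat_eq_real_of_nat ennreal_mult[symmetric])
          also have "\<dots> \<le> ennreal (64 * (2 powr B * 2 powr (- (n * b))))"
          proof (intro ennreal_leI mult_mono)
            have "1 / 2 ^ c n = 2 powr (- real (c n))" by (simp add: powr_minus_divide powr_realpow)
            also have "\<dots> \<le> 2 powr (B - n * b)" using B[of n] by (intro powr_mono) (auto simp: algebra_simps)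
            also have "\<dots> = 2 powr B * 2 powr (- (n * b))" by (simp add: powr_add[symmetric])
            finally show "1 / 2 ^ c n \<le> 2 powr B * 2 powr (- (n * b))" .
          qed (use cardJ in auto)
          finally show ?thesis by (simp add: mult.assoc)
        qed
        ultimately show ?thesis by blast
      qed (auto intro!: bexI[of _ "{}"])
    qed auto
  qed
  then have "ereal s \<le> hausdorff_dim (branch ` {0..<1})" by (rule hausdorff_dim_geI)
  also have "\<dots> \<le> hausdorff_dim limit_set"
    by (intro hausdorff_dim_mono) (auto simp: limit_set_def closure_subset[THEN subsetD])
  finally show ?thesis .
qed

section \<open>The uniform measure on the limit set\<close>

definition branch_measure :: "(real^2) measure" where
  "branch_measure = distr (restrict_space lborel {0..<1}) borel branch"

lemma emeasure_unit: "emeasure (restrict_space lborel {0..<1::real}) {0..<1} = 1"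
  by (subst emeasure_restrict_space) auto

lemma prob_space_branch_measure: "prob_space branch_measure"
proof -
  have "prob_space (restrict_space lborel {0..<1::real})"
    by (rule prob_spaceI) (simp add: space_restrict_space emeasure_unit)
  then show ?thesis
    unfolding branch_measure_def by (intro prob_space.prob_space_distr measurable_branch)
qed

lemma emeasure_branch_measure_limit_set: "emeasure branch_measure limit_set = 1"
proof -
  have "emeasure branch_measure limit_set
      = emeasure (restrict_space lborel {0..<1}) (branch -` limit_set \<inter> space (restrict_space lborel {0..<1}))"
    unfolding branch_measure_def
    by (intro emeasure_distr measurable_branch borel_compact compact_limit_set)
  also have "branch -` limit_set \<inter> space (restrict_space lborel {0..<1}) = {0..<1}"
    using branch_in_limit_set by (auto simp: space_restrict_space)
  finally show ?thesis by (simp add: emeasure_unit)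
qed

lemma branch_measure_compactly_supported:
  "branch_measure \<in> compactly_supported_measures limit_set"
proof -
  interpret prob_space branch_measure by (rule prob_space_branch_measure)
  have closed: "closed (topological_support branch_measure)" by (rule closed_topological_support)
  have sub: "topological_support branch_measure \<subseteq> limit_set"
  proof
    fix p assume p: "p \<in> topological_support branch_measure"
    show "p \<in> limit_set"
    proof (rule ccontr)
      assume "p \<notin> limit_set"
      moreover have "open (- limit_set)" using compact_limit_set by (simp add: compact_imp_closed open_Compl)
      ultimately have "0 < emeasure branch_measure (- limit_set)"
        using p by (auto simp: topological_support_def)
      moreover have "emeasure branch_measure (- limit_set) = 0"
      proof -
        have sp: "space branch_measure = UNIV" "sets branch_measure = sets borel"
          by (auto simp: branch_measure_def)
        have "emeasure branch_measure (UNIV - limit_set) = emeasure branch_measure UNIV - emeasure branch_measure limit_set"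
          by (intro emeasure_Diff) (auto simp: sp emeasure_branch_measure_limit_set borel_compact compact_limit_set)
        also have "emeasure branch_measure UNIV = 1" using emeasure_space_1 by (simp add: sp)
        finally show ?thesis by (simp add: emeasure_branch_measure_limit_set Compl_eq_Diff_UNIV)
      qed
      ultimately show False by simp
    qed
  qed
  have "compact (topological_support branch_measure)"
    using compact_Int_closed[OF compact_limit_set closed] sub by (simp add: Int_absorb1)
  with sub show ?thesis
    by (simp add: compactly_supported_measures_def emeasure_branch_measure_limit_set)
       (simp add: branch_measure_def)
qed

lemma integral_step:
  fixes h :: "nat \<Rightarrow> complex"
  shows "(LINT w|restrict_space lborel {0..<1}. h (idx k w)) = (\<Sum>j<2 ^ c k. h j) / 2 ^ c k"
proof -
  define N :: nat where "N = 2 ^ c k"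
  have N: "real N > 0" "(2::real) ^ c k = N" "(2::complex) ^ c k = N" by (auto simp: N_def)
  have "(LINT w|restrict_space lborel {0..<1}. h (idx k w)) = (LINT w:{0..<1}|lborel. h (idx k w))"
    by (simp add: set_lebesgue_integral_def integral_restrict_space)
  also have "\<dots> = (LINT w|lborel. (\<Sum>j<N. indicator {real j / N..<(real j + 1) / N} w *\<^sub>R h j))"
    unfolding set_lebesgue_integral_def
  proof (intro Bochner_Integration.integral_cong refl)
    fix w :: real
    show "indicator {0..<1} w *\<^sub>R h (idx k w) = (\<Sum>j<N. indicator {real j / N..<(real j + 1) / N} w *\<^sub>R h j)"
    proof (cases "w \<in> {0..<1}")
      case True
      have "(\<Sum>j<N. indicator {real j / N..<(real j + 1) / N} w *\<^sub>R h j) =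
        (\<Sum>j<N. if idx k w = j then h j else 0)"
        using True idx_eq_iff[of w k] N by (intro sum.cong refl) (auto simp: indicator_def)
      also have "\<dots> = h (idx k w)" using idx_less[of w k] True by (simp add: N_def)
      finally show ?thesis using True by simp
    next
      case False
      have "w \<notin> {real j / N..<(real j + 1) / N}" if "j < N" for j
      proof
        assume "w \<in> {real j / N..<(real j + 1) / N}"
        moreover have "0 \<le> real j / N" "(real j + 1) / N \<le> 1" using that by auto
        ultimately show False using False unfolding atLeastLessThan_iff by linarith
      qed
      then show ?thesis using False by simp
    qed
  qed
  also have "\<dots> = (\<Sum>j<N. measure lborel {real j / N..<(real j + 1) / N} *\<^sub>R h j)"
  proof -
    have ii: "integrable lborel (indicator {real j / N..<(real j + 1) / N} :: real \<Rightarrow> real)" for j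
      using emeasure_lborel_Ico[of "real j / N" "(real j + 1) / N"] N
      by (intro integrable_real_indicator) (auto simp: divide_right_mono)
    show ?thesis
      by (subst Bochner_Integration.integral_sum) (simp_all add: integrable_scaleR_left[OF ii] ii)
  qed
  also have "\<dots> = (\<Sum>j<N. h j / N)"
    using N by (intro sum.cong refl)
      (simp add: measure_def divide_right_mono diff_divide_distrib[symmetric] scaleR_conv_of_real)
  finally show ?thesis by (simp add: N_def sum_divide_distrib)
qed

end

section \<open>Derandomised concentration\<close>

text \<open>Convexity bounds the exponential on \<open>[- l, l]\<close> by its chord, which is
  affine in \<open>v\<close>. Averaging over values \<open>v\<close> of mean zero then removes the
  second term.\<close>

lemma cosh_add_le:
  fixes a l v :: real
  assumes "\<bar>v\<bar> \<le> 1"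
  shows "cosh (a + l * v) \<le> cosh l * cosh a + v * (sinh l * sinh a)"
proof -
  have e: "exp (l * v) \<le> cosh l + v * sinh l" if "\<bar>v\<bar> \<le> 1" for v
  proof -
    have "exp ((1 - (1 + v) / 2) *\<^sub>R (- l) + ((1 + v) / 2) *\<^sub>R l)
      \<le> (1 - (1 + v) / 2) * exp (- l) + ((1 + v) / 2) * exp l"
      using that by (intro convex_onD[OF exp_convex]) auto
    also have "(1 - (1 + v) / 2) *\<^sub>R (- l) + ((1 + v) / 2) *\<^sub>R l = l * v"
      by (simp add: field_simps)
    also have "(1 - (1 + v) / 2) * exp (- l) + ((1 + v) / 2) * exp l = cosh l + v * sinh l"
      by (simp add: cosh_def sinh_def field_simps)
    finally show ?thesis .
  qed
  have "cosh (a + l * v) = (exp a * exp (l * v) + exp (- a) * exp (l * (- v))) / 2"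
    by (simp add: cosh_def exp_add[symmetric])
  also have "\<dots> \<le> (exp a * (cosh l + v * sinh l) + exp (- a) * (cosh l + (- v) * sinh l)) / 2"
    using e[of v] e[of "- v"] assms by (intro divide_right_mono add_mono mult_left_mono) auto
  also have "\<dots> = cosh l * cosh a + v * (sinh l * sinh a)"
    by (simp add: cosh_def[of a] sinh_def[of a] field_simps)
  finally show ?thesis .
qed

lemma cosh_le_one_plus_square:
  fixes l :: real
  assumes "0 \<le> l" "l \<le> 1"
  shows "cosh l \<le> 1 + l\<^sup>2"
proof -
  have "exp l \<le> 1 + l + l\<^sup>2" using assms by (rule exp_bound)
  moreover have "exp (- l) \<le> 1 - l + l\<^sup>2"
  proof -
    \<comment> \<open>A lower Taylor bound for \<open>exp l\<close> becomes an upper bound for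
      \<open>exp (- l)\<close> on division, once the product of the two polynomials is at least
      \<open>1\<close>.\<close>
    have "1 \<le> (1 - l + l\<^sup>2) * (1 + l + l\<^sup>2 / 2)"
    proof -
      have "(1 - l + l\<^sup>2) * (1 + l + l\<^sup>2 / 2) = 1 + l\<^sup>2 / 2 + l ^ 3 / 2 + l ^ 4 / 2"
        by (simp add: power2_eq_square power3_eq_cube power4_eq_xxxx field_simps)
      then show ?thesis using assms by simp
    qed
    also have "\<dots> \<le> (1 - l + l\<^sup>2) * exp l"
      using assms exp_lower_Taylor_quadratic[of l] by (intro mult_left_mono) auto
    finally show ?thesis by (simp add: exp_minus field_simps)
  qed
  ultimately show ?thesis by (simp add: cosh_def)
qed

text \<open>
  A derandomised Hoeffding bound: choosing each \<open>\<eta> j\<close> so as not to increase the normalised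
  potential \<open>\<Sum>z. cosh (l * S z)\<close> keeps all the sums \<open>S z\<close> small simultaneously.
\<close>

lemma greedy_cosh:
  fixes f :: "nat \<Rightarrow> 'z \<Rightarrow> 'y \<Rightarrow> real"
  assumes fin: "finite Z" "finite Y" "Y \<noteq> {}"
    and le: "\<And>j z y. z \<in> Z \<Longrightarrow> y \<in> Y \<Longrightarrow> \<bar>f j z y\<bar> \<le> 1"
    and mean: "\<And>j z. z \<in> Z \<Longrightarrow> (\<Sum>y\<in>Y. f j z y) = 0"
  shows "\<exists>\<eta>. (\<forall>j. \<eta> j \<in> Y) \<and> (\<Sum>z\<in>Z. cosh (l * (\<Sum>j<N. f j z (\<eta> j)))) \<le> card Z * cosh l ^ N"
proof (induction N)
  case 0
  obtain y where "y \<in> Y" using fin by blast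
  then show ?case by (intro exI[of _ "\<lambda>_. y"]) simp
next
  case (Suc N)
  then obtain \<eta> where \<eta>: "\<And>j. \<eta> j \<in> Y"
    "(\<Sum>z\<in>Z. cosh (l * (\<Sum>j<N. f j z (\<eta> j)))) \<le> card Z * cosh l ^ N" by blast
  define S where "S z = l * (\<Sum>j<N. f j z (\<eta> j))" for z
  define P where "P y = (\<Sum>z\<in>Z. cosh (S z + l * f N z y))" for y
  have "(\<Sum>y\<in>Y. P y) \<le> (\<Sum>y\<in>Y. \<Sum>z\<in>Z. cosh l * cosh (S z) + f N z y * (sinh l * sinh (S z)))"
    unfolding P_def by (intro sum_mono cosh_add_le le)
  also have "\<dots> = (\<Sum>z\<in>Z. \<Sum>y\<in>Y. cosh l * cosh (S z) + f N z y * (sinh l * sinh (S z)))"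
    by (rule sum.swap)
  also have "\<dots> = (\<Sum>z\<in>Z. card Y * (cosh l * cosh (S z)))"
    by (intro sum.cong refl) (simp add: sum.distrib sum_distrib_right[symmetric] mean)
  also have "\<dots> = card Y * (cosh l * (\<Sum>z\<in>Z. cosh (S z)))" by (simp add: sum_distrib_left)
  finally have 1: "(\<Sum>y\<in>Y. P y) \<le> card Y * (cosh l * (\<Sum>z\<in>Z. cosh (S z)))" .
  \<comment> \<open>The \<open>sinh\<close> terms have cancelled in the average over
    \<open>Y\<close>, and some \<open>y\<close> does no worse than the average.\<close>
  have "\<exists>y\<in>Y. P y \<le> cosh l * (\<Sum>z\<in>Z. cosh (S z))"
  proof (rule ccontr)
    assume "\<not> ?thesis"
    then have "(\<Sum>y\<in>Y. cosh l * (\<Sum>z\<in>Z. cosh (S z))) < (\<Sum>y\<in>Y. P y)"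
      using fin by (intro sum_strict_mono) auto
    with 1 show False by simp
  qed
  then obtain y where y: "y \<in> Y" "P y \<le> cosh l * (\<Sum>z\<in>Z. cosh (S z))" by blast
  have "(\<Sum>z\<in>Z. cosh (l * (\<Sum>j<Suc N. f j z ((\<eta>(N := y)) j)))) = P y"
    unfolding P_def S_def by (intro sum.cong refl) (simp add: distrib_left)
  also note y(2)
  also have "cosh l * (\<Sum>z\<in>Z. cosh (S z)) \<le> cosh l * (card Z * cosh l ^ N)"
    using \<eta>(2) cosh_real_pos[of l] unfolding S_def by (intro mult_left_mono) auto
  finally have "(\<Sum>z\<in>Z. cosh (l * (\<Sum>j<Suc N. f j z ((\<eta>(N := y)) j)))) \<le> card Z * cosh l ^ Suc N"
    by (simp add: mult_ac)
  then show ?case using \<eta>(1) y(1) by (intro exI[of _ "\<eta>(N := y)"]) auto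
qed

text \<open>With \<open>l = 1 / sqrt N\<close> the growth \<open>cosh l ^ N\<close> stays below
  \<open>exp 1\<close>. A single term is bounded by the whole potential, and taking logarithms gives
  \<open>ln (2 * card Z) + 1\<close>.\<close>

lemma greedy_real:
  fixes f :: "nat \<Rightarrow> 'z \<Rightarrow> 'y \<Rightarrow> real"
  assumes fin: "finite Z" "finite Y" "Y \<noteq> {}" and N: "0 < N"
    and le: "\<And>j z y. z \<in> Z \<Longrightarrow> y \<in> Y \<Longrightarrow> \<bar>f j z y\<bar> \<le> 1"
    and mean: "\<And>j z. z \<in> Z \<Longrightarrow> (\<Sum>y\<in>Y. f j z y) = 0"
  shows "\<exists>\<eta>. (\<forall>j. \<eta> j \<in> Y) \<and>
    (\<forall>z\<in>Z. \<bar>\<Sum>j<N. f j z (\<eta> j)\<bar> \<le> sqrt N * (ln (2 * card Z) + 1))"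
proof -
  define l where "l = 1 / sqrt N"
  have l: "0 < l" "l \<le> 1" "l\<^sup>2 = 1 / N" using N by (auto simp: l_def power_divide)
  obtain \<eta> where \<eta>: "\<And>j. \<eta> j \<in> Y"
    "(\<Sum>z\<in>Z. cosh (l * (\<Sum>j<N. f j z (\<eta> j)))) \<le> card Z * cosh l ^ N"
    using greedy_cosh[of Z Y f l N] assms by blast
  have "cosh l ^ N \<le> (1 + l\<^sup>2) ^ N"
    using l by (intro power_mono cosh_le_one_plus_square cosh_real_nonneg) auto
  also have "\<dots> \<le> exp (l\<^sup>2) ^ N" by (intro power_mono) auto
  also have "\<dots> = exp 1" using N l by (simp add: exp_of_nat_mult[symmetric])
  finally have c: "cosh l ^ N \<le> exp 1" .
  have "\<bar>\<Sum>j<N. f j z (\<eta> j)\<bar> \<le> sqrt N * (ln (2 * card Z) + 1)" if z: "z \<in> Z" for z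
  proof -
    define s where "s = (\<Sum>j<N. f j z (\<eta> j))"
    have cz: "card Z > 0" using z fin by (auto simp: card_gt_0_iff)
    have "exp (l * \<bar>s\<bar>) \<le> 2 * cosh (l * \<bar>s\<bar>)" by (simp add: cosh_def)
    also have "cosh (l * \<bar>s\<bar>) = cosh (l * s)" by (cases "s \<ge> 0") (auto simp: abs_if)
    also have "\<dots> \<le> (\<Sum>z\<in>Z. cosh (l * (\<Sum>j<N. f j z (\<eta> j))))"
      unfolding s_def using z fin by (intro member_le_sum[of z Z "\<lambda>z. cosh (l * (\<Sum>j<N. f j z (\<eta> j)))"]) auto
    also have "\<dots> \<le> card Z * exp 1" using \<eta>(2) c by (meson mult_left_mono of_nat_0_le_iff order_trans)
    finally have "exp (l * \<bar>s\<bar>) \<le> (2 * card Z) * exp 1" by simp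
    then have "ln (exp (l * \<bar>s\<bar>)) \<le> ln ((2 * card Z) * exp 1)"
      using cz by (subst ln_le_cancel_iff) auto
    also have "\<dots> = ln (2 * card Z) + 1" using cz by (subst ln_mult) auto
    finally have "l * \<bar>s\<bar> \<le> ln (2 * card Z) + 1" by simp
    then have "sqrt N * (l * \<bar>s\<bar>) \<le> sqrt N * (ln (2 * card Z) + 1)" by (intro mult_left_mono) auto
    moreover have "sqrt N * (l * \<bar>s\<bar>) = \<bar>s\<bar>" using N by (simp add: l_def)
    ultimately show ?thesis unfolding s_def by linarith
  qed
  with \<eta>(1) show ?thesis by blast
qed

text \<open>Real and imaginary parts become separate constraints, which doubles the index
  set.\<close>

lemma greedy_complex:
  fixes f :: "nat \<Rightarrow> 'z \<Rightarrow> 'y \<Rightarrow> complex"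
  assumes fin: "finite Z" "finite Y" "Y \<noteq> {}" and N: "0 < N"
    and le: "\<And>j z y. z \<in> Z \<Longrightarrow> y \<in> Y \<Longrightarrow> norm (f j z y) \<le> 1"
    and mean: "\<And>j z. z \<in> Z \<Longrightarrow> (\<Sum>y\<in>Y. f j z y) = 0"
  shows "\<exists>\<eta>. (\<forall>j. \<eta> j \<in> Y) \<and>
    (\<forall>z\<in>Z. norm (\<Sum>j<N. f j z (\<eta> j)) \<le> 2 * (sqrt N * (ln (4 * card Z) + 1)))"
proof -
  define g where "g j p y = (if snd p then Re (f j (fst p) y) else Im (f j (fst p) y))" for j p y
  have "\<exists>\<eta>. (\<forall>j. \<eta> j \<in> Y) \<and> (\<forall>p\<in>Z \<times> (UNIV :: bool set).
      \<bar>\<Sum>j<N. g j p (\<eta> j)\<bar> \<le> sqrt N * (ln (2 * card (Z \<times> (UNIV :: bool set))) + 1))"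
  proof (rule greedy_real)
    fix j p y assume "p \<in> Z \<times> (UNIV :: bool set)" "y \<in> Y"
    then show "\<bar>g j p y\<bar> \<le> 1"
      using le[of "fst p" y j] abs_Re_le_cmod[of "f j (fst p) y"] abs_Im_le_cmod[of "f j (fst p) y"]
      by (auto simp: g_def)
  next
    fix j p assume "p \<in> Z \<times> (UNIV :: bool set)"
    then show "(\<Sum>y\<in>Y. g j p y) = 0"
      using mean[of "fst p" j] by (cases "snd p") (auto simp: g_def simp flip: Re_sum Im_sum)
  qed (use fin N in auto)
  then obtain \<eta> where \<eta>: "\<And>j. \<eta> j \<in> Y" "\<And>p. p \<in> Z \<times> (UNIV :: bool set) \<Longrightarrow>
      \<bar>\<Sum>j<N. g j p (\<eta> j)\<bar> \<le> sqrt N * (ln (2 * card (Z \<times> (UNIV :: bool set))) + 1)" by blast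
  have "norm (\<Sum>j<N. f j z (\<eta> j)) \<le> 2 * (sqrt N * (ln (4 * card Z) + 1))" if z: "z \<in> Z" for z
  proof -
    have "norm (\<Sum>j<N. f j z (\<eta> j)) \<le> \<bar>Re (\<Sum>j<N. f j z (\<eta> j))\<bar> + \<bar>Im (\<Sum>j<N. f j z (\<eta> j))\<bar>"
      by (rule cmod_le)
    also have "\<dots> = \<bar>\<Sum>j<N. g j (z, True) (\<eta> j)\<bar> + \<bar>\<Sum>j<N. g j (z, False) (\<eta> j)\<bar>"
      by (simp add: g_def)
    also have "\<dots> \<le> 2 * (sqrt N * (ln (4 * card Z) + 1))"
      using \<eta>(2)[of "(z, True)"] \<eta>(2)[of "(z, False)"] z by (simp add: card_cartesian_product mult.commute)
    finally show ?thesis .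
  qed
  with \<eta>(1) show ?thesis by blast
qed

section \<open>Exponentials\<close>

definition ech :: "real^2 \<Rightarrow> real^2 \<Rightarrow> complex" where
  "ech z x = cis (- (2 * pi * (z \<bullet> x)))"

lemma norm_ech [simp]: "norm (ech z x) = 1"
  by (simp add: ech_def)

lemma ech_add: "ech z (x + y) = ech z x * ech z y"
  by (simp add: ech_def cis_mult inner_add_right algebra_simps)

lemma exp_eq_ech: "exp (- 2 * of_real pi * \<i> * of_real (z \<bullet> x)) = ech z x"
  by (simp add: ech_def cis_conv_exp mult_ac)

lemma norm_cis_minus_one_le: "norm (cis u - 1) \<le> \<bar>u\<bar>"
  using dist_exp_i_1[of u] abs_sin_x_le_abs_x[of "u / 2"] by (simp add: cis_conv_exp)

lemma norm_ech_diff_le: "norm (ech z x - ech w x) \<le> 2 * pi * (norm (z - w) * norm x)"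
proof -
  have "ech z x - ech w x = ech w x * (cis (- (2 * pi * ((z - w) \<bullet> x))) - 1)"
    by (simp add: ech_def right_diff_distrib cis_mult inner_diff_left algebra_simps)
  then have "norm (ech z x - ech w x) = norm (cis (- (2 * pi * ((z - w) \<bullet> x))) - 1)"
    by (simp add: norm_mult)
  also have "\<dots> \<le> \<bar>- (2 * pi * ((z - w) \<bullet> x))\<bar>" by (rule norm_cis_minus_one_le)
  also have "\<dots> = 2 * pi * \<bar>(z - w) \<bullet> x\<bar>" by (simp add: abs_mult)
  also have "\<dots> \<le> 2 * pi * (norm (z - w) * norm x)" by (intro mult_left_mono Cauchy_Schwarz_ineq2) auto
  finally show ?thesis .
qed

text \<open>The Fourier transform of the uniform distribution on \<open>[0,1]\<close>.\<close>

definition unit_ft :: "real \<Rightarrow> complex" where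
  "unit_ft u = (if u = 0 then 1 else (1 - cis (- (2 * pi * u))) / (2 * of_real pi * \<i> * of_real u))"

text \<open>The uniform measure on \<open>[0,1]\<close> is that on \<open>[0,1/2]\<close> convolved
  with a fair choice between \<open>0\<close> and \<open>1/2\<close>.\<close>

lemma unit_ft_half: "unit_ft u = unit_ft (u / 2) * ((1 + cis (- (pi * u))) / 2)"
proof (cases "u = 0")
  case False
  have "1 - cis (- (2 * pi * u)) = (1 - cis (- (pi * u))) * (1 + cis (- (pi * u)))"
    by (simp add: algebra_simps cis_mult)
  then show ?thesis using False by (simp add: unit_ft_def field_simps)
qed (simp add: unit_ft_def)

lemma norm_unit_ft_le_one: "norm (unit_ft u) \<le> 1"
proof (cases "u = 0")
  case False
  have "norm (1 - cis (- (2 * pi * u))) \<le> 2 * pi * \<bar>u\<bar>"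
    using norm_cis_minus_one_le[of "- (2 * pi * u)"] by (simp add: norm_minus_commute abs_mult)
  then show ?thesis using False by (simp add: unit_ft_def norm_divide norm_mult divide_le_eq)
qed (simp add: unit_ft_def)

lemma norm_unit_ft_le: "u \<noteq> 0 \<Longrightarrow> norm (unit_ft u) \<le> 1 / (pi * \<bar>u\<bar>)"
proof -
  assume u: "u \<noteq> 0"
  have "norm (1 - cis (- (2 * pi * u))) \<le> 2"
    using norm_triangle_ineq4[of 1 "cis (- (2 * pi * u))"] by simp
  then show ?thesis using u by (simp add: unit_ft_def norm_divide norm_mult divide_simps)
qed

lemma tendsto_unit_ft: "(\<lambda>k. unit_ft (u / 2 ^ k)) \<longlonglongrightarrow> 1"
proof (cases "u = 0")
  case False
  define w where "w k = - (2 * of_real pi * \<i> * of_real (u / 2 ^ k))" for k :: nat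
  have "(\<lambda>k. u * (1 / 2) ^ k) \<longlonglongrightarrow> u * 0"
    by (intro tendsto_intros LIMSEQ_realpow_zero) auto
  then have "(\<lambda>k. u / 2 ^ k) \<longlonglongrightarrow> 0" by (simp add: power_one_over)
  then have "w \<longlonglongrightarrow> - (2 * of_real pi * \<i> * of_real 0)"
    unfolding w_def by (intro tendsto_intros)
  moreover have "\<forall>\<^sub>F k in sequentially. w k \<noteq> 0" using False by (simp add: w_def)
  ultimately have "filterlim w (at 0) sequentially" by (simp add: filterlim_at)
  from filterlim_compose[OF lim_exp_minus_1 this]
  have "(\<lambda>k. (exp (w k) - 1) / w k) \<longlonglongrightarrow> 1" .
  moreover have "(exp (w k) - 1) / w k = unit_ft (u / 2 ^ k)" for k
  proof -
    have "exp (w k) = cis (- (2 * pi * (u / 2 ^ k)))"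
      unfolding cis_conv_exp w_def by (simp add: mult_ac)
    moreover have "w k = - (2 * of_real pi * \<i> * of_real (u / 2 ^ k))" by (simp only: w_def)
    ultimately show ?thesis
      using False unfolding unit_ft_def by (simp only: minus_divide_right[symmetric] minus_divide_left minus_diff_eq) simp
  qed
  ultimately show ?thesis by simp
qed (simp add: unit_ft_def)

text \<open>The transform of the uniform measure on the unit square.\<close>

definition square_ft :: "real^2 \<Rightarrow> complex" where
  "square_ft z = unit_ft (z $ 1) * unit_ft (z $ 2)"

lemma norm_square_ft_le_one: "norm (square_ft z) \<le> 1"
  unfolding square_ft_def norm_mult by (intro mult_le_one norm_unit_ft_le_one norm_ge_zero)

text \<open>Some coordinate has at least half the norm of \<open>z\<close> and its factor decays;
  the other factor is at most \<open>1\<close>, and \<open>2 \<le> pi\<close> absorbs the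
  half.\<close>

lemma norm_square_ft_le:
  assumes z: "z \<noteq> 0"
  shows "norm (square_ft z) \<le> 1 / norm z"
proof -
  have n: "norm z \<le> \<bar>z $ 1\<bar> + \<bar>z $ 2\<bar>" using norm_le_l1_cart[of z] by (simp add: sum_2)
  have "norm (square_ft z) \<le> 1 / norm z" if "norm z \<le> 2 * \<bar>v\<bar>" "norm (square_ft z) \<le> norm (unit_ft v)" for v
  proof -
    have v: "v \<noteq> 0" using that z by auto
    have "norm (unit_ft v) \<le> 1 / (pi * \<bar>v\<bar>)" using v by (rule norm_unit_ft_le)
    also have "\<dots> \<le> 1 / (2 * \<bar>v\<bar>)"
      using v pi_ge_two by (intro divide_left_mono mult_right_mono) auto
    also have "\<dots> \<le> 1 / norm z" using that z v by (intro divide_left_mono) auto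
    finally show ?thesis using that by simp
  qed
  moreover have "norm (square_ft z) \<le> norm (unit_ft (z $ 1))" "norm (square_ft z) \<le> norm (unit_ft (z $ 2))"
    unfolding square_ft_def norm_mult
    using norm_unit_ft_le_one by (auto intro: mult_left_le mult_left_le_one_le)
  moreover have "norm z \<le> 2 * \<bar>z $ 1\<bar> \<or> norm z \<le> 2 * \<bar>z $ 2\<bar>" using n by linarith
  ultimately show ?thesis by blast
qed

lemma scaleR_inverse_nth: "(z /\<^sub>R r) $ i = z $ i / r"
  by (simp add: divide_inverse_commute)

lemma tendsto_square_ft: "(\<lambda>k. square_ft (z /\<^sub>R 2 ^ k)) \<longlonglongrightarrow> 1"
proof -
  have "(\<lambda>k. unit_ft (z $ 1 / 2 ^ k) * unit_ft (z $ 2 / 2 ^ k)) \<longlonglongrightarrow> 1 * 1"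
    by (intro tendsto_mult tendsto_unit_ft)
  then show ?thesis unfolding square_ft_def scaleR_inverse_nth by simp
qed

definition unit_digits :: "(real^2) set" where
  "unit_digits = {vector [0, 0], vector [1, 0], vector [0, 1], vector [1, 1]}"

lemma finite_unit_digits: "finite unit_digits" "unit_digits \<noteq> {}"
  by (auto simp: unit_digits_def)

lemma distinct_digits:
  "(vector [a, b] :: real^2) = vector [c, d] \<longleftrightarrow> a = c \<and> b = d"
  by (auto simp: vec_eq_iff forall_2)

lemma card_unit_digits: "card unit_digits = 4"
  by (simp add: unit_digits_def distinct_digits)

lemma sum_unit_digits:
  "sum f unit_digits = f (vector [0, 0]) + f (vector [1, 0]) + f (vector [0, 1]) + f (vector [1, 1])"
  by (simp add: unit_digits_def distinct_digits add.assoc)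

lemma norm_unit_digits: "d \<in> unit_digits \<Longrightarrow> norm d \<le> 2"
  using norm_le_l1_cart[of d] by (auto simp: unit_digits_def sum_2)

text \<open>The transform of a uniform choice among the lower left corners of the four quarters of a
  square of side \<open>2 ^ - k\<close>.\<close>

definition digit_mean :: "nat \<Rightarrow> real^2 \<Rightarrow> complex" where
  "digit_mean k z = (\<Sum>d\<in>unit_digits. ech z (d /\<^sub>R 2 ^ Suc k)) / 4"

text \<open>The uniform measure on a square is that on its quarter convolved with a uniform choice
  of corner. This makes the smoothed measures of consecutive levels comparable.\<close>

lemma square_ft_scale: "square_ft (z /\<^sub>R 2 ^ k) = square_ft (z /\<^sub>R 2 ^ Suc k) * digit_mean k z"
proof -
  define a b where "a = cis (- (pi * (z $ 1 / 2 ^ k)))" and "b = cis (- (pi * (z $ 2 / 2 ^ k)))"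
  have e: "ech z (vector [p, q] /\<^sub>R 2 ^ Suc k) =
    cis (- (pi * (p * (z $ 1 / 2 ^ k))) + - (pi * (q * (z $ 2 / 2 ^ k))))" for p q
    unfolding ech_def inner_vec_def sum_2 scaleR_inverse_nth
    by (intro arg_cong[of _ _ cis]) (simp add: field_simps)
  have "(\<Sum>d\<in>unit_digits. ech z (d /\<^sub>R 2 ^ Suc k)) = 1 + a + b + a * b"
    unfolding sum_unit_digits e by (simp add: a_def b_def cis_mult)
  moreover have "(1 + a + b + a * b) / 4 = ((1 + a) / 2) * ((1 + b) / 2)" by (simp add: algebra_simps)
  ultimately have m: "digit_mean k z = ((1 + a) / 2) * ((1 + b) / 2)"
    unfolding digit_mean_def by simp
  have "square_ft (z /\<^sub>R 2 ^ k) = unit_ft (z $ 1 / 2 ^ k) * unit_ft (z $ 2 / 2 ^ k)"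
    unfolding square_ft_def scaleR_inverse_nth ..
  also have "unit_ft (z $ 1 / 2 ^ k) = unit_ft (z $ 1 / 2 ^ Suc k) * ((1 + a) / 2)"
    using unit_ft_half[of "z $ 1 / 2 ^ k"] by (simp add: a_def mult.commute)
  also have "unit_ft (z $ 2 / 2 ^ k) = unit_ft (z $ 2 / 2 ^ Suc k) * ((1 + b) / 2)"
    using unit_ft_half[of "z $ 2 / 2 ^ k"] by (simp add: b_def mult.commute)
  also have "unit_ft (z $ 1 / 2 ^ Suc k) * ((1 + a) / 2) * (unit_ft (z $ 2 / 2 ^ Suc k) * ((1 + b) / 2))
    = square_ft (z /\<^sub>R 2 ^ Suc k) * digit_mean k z"
    unfolding m square_ft_def scaleR_inverse_nth by (simp only: mult_ac)
  finally show ?thesis .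
qed

lemma norm_digit_mean_le: "norm (digit_mean k z) \<le> 1"
proof -
  have "norm (\<Sum>d\<in>unit_digits. ech z (d /\<^sub>R 2 ^ Suc k)) \<le> (\<Sum>d\<in>unit_digits. 1)"
    by (intro sum_norm_le) simp
  then show ?thesis by (simp add: digit_mean_def norm_divide card_unit_digits)
qed

lemma norm_digit_mean_diff_le: "norm (digit_mean k z - digit_mean k w) \<le> 4 * pi * norm (z - w)"
proof -
  have "norm (ech z (d /\<^sub>R 2 ^ Suc k) - ech w (d /\<^sub>R 2 ^ Suc k)) \<le> 4 * pi * norm (z - w)"
    if d: "d \<in> unit_digits" for d
  proof -
    have "norm (d /\<^sub>R 2 ^ Suc k) = \<bar>inverse (2 ^ Suc k)\<bar> * norm d" by (rule norm_scaleR)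
    also have "\<dots> \<le> 1 * 2"
      by (intro mult_mono norm_unit_digits[OF d]) (simp_all add: inverse_le_1_iff del: power_Suc)
    finally have "2 * pi * (norm (z - w) * norm (d /\<^sub>R 2 ^ Suc k)) \<le> 2 * pi * (norm (z - w) * 2)"
      by (intro mult_left_mono) auto
    with norm_ech_diff_le[of z "d /\<^sub>R 2 ^ Suc k" w] show ?thesis by linarith
  qed
  then have "norm (\<Sum>d\<in>unit_digits. ech z (d /\<^sub>R 2 ^ Suc k) - ech w (d /\<^sub>R 2 ^ Suc k))
      \<le> (\<Sum>d\<in>unit_digits. 4 * pi * norm (z - w))" by (intro sum_norm_le)
  then show ?thesis
    by (simp add: digit_mean_def diff_divide_distrib[symmetric] sum_subtractf norm_divide card_unit_digits)
qed

section \<open>Trees with small exponential sums\<close>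

text \<open>A net of mesh \<open>2 ^ - n\<close> for the ball of radius \<open>8 ^ n\<close> has
  numerators up to \<open>16 ^ n\<close>. The logarithm of its size is linear in \<open>n\<close>,
  so controlling all its points at once is cheap.\<close>

lemma frequency_net:
  fixes z :: "real^2"
  assumes z: "norm z \<le> 8 ^ n"
  obtains a b :: int where "a \<in> {- (16 ^ n)..16 ^ n}" "b \<in> {- (16 ^ n)..16 ^ n}"
    "norm (z - vector [real_of_int a / 2 ^ n, real_of_int b / 2 ^ n]) \<le> 2 / 2 ^ n"
proof
  have r: "\<lfloor>2 ^ n * v\<rfloor> \<in> {- (16 ^ n)..16 ^ n} \<and> \<bar>v - \<lfloor>2 ^ n * v\<rfloor> / 2 ^ n\<bar> \<le> 1 / 2 ^ n"
    if v: "\<bar>v\<bar> \<le> 8 ^ n" for v :: real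
  proof
    have "\<bar>2 ^ n * v\<bar> \<le> 2 ^ n * 8 ^ n" using v by (simp add: abs_mult)
    also have "(2::real) ^ n * 8 ^ n = 16 ^ n" by (simp flip: power_mult_distrib)
    finally have "\<bar>2 ^ n * v\<bar> \<le> 16 ^ n" .
    then have "real_of_int (- (16 ^ n)) \<le> 2 ^ n * v" "2 ^ n * v \<le> real_of_int (16 ^ n)" by auto
    then show "\<lfloor>2 ^ n * v\<rfloor> \<in> {- (16 ^ n)..16 ^ n}"
      unfolding atLeastAtMost_iff le_floor_iff floor_le_iff by linarith
    have "\<bar>2 ^ n * v - \<lfloor>2 ^ n * v\<rfloor>\<bar> \<le> 1" by linarith
    moreover have "v - \<lfloor>2 ^ n * v\<rfloor> / 2 ^ n = (2 ^ n * v - \<lfloor>2 ^ n * v\<rfloor>) / 2 ^ n"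
      by (simp add: diff_divide_distrib)
    ultimately show "\<bar>v - \<lfloor>2 ^ n * v\<rfloor> / 2 ^ n\<bar> \<le> 1 / 2 ^ n"
      by (simp add: abs_divide divide_right_mono)
  qed
  have c: "\<bar>z $ i\<bar> \<le> 8 ^ n" for i using component_le_norm_cart[of z i] z by linarith
  show "\<lfloor>2 ^ n * z $ 1\<rfloor> \<in> {- (16 ^ n)..16 ^ n}" "\<lfloor>2 ^ n * z $ 2\<rfloor> \<in> {- (16 ^ n)..16 ^ n}"
    using r[OF c] by blast+
  define w :: "real^2" where
    "w = z - vector [real_of_int \<lfloor>2 ^ n * z $ 1\<rfloor> / 2 ^ n, real_of_int \<lfloor>2 ^ n * z $ 2\<rfloor> / 2 ^ n]"
  have "norm w \<le> \<bar>w $ 1\<bar> + \<bar>w $ 2\<bar>" using norm_le_l1_cart[of w] by (simp add: sum_2)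
  also have "\<dots> \<le> 1 / 2 ^ n + 1 / 2 ^ n"
    using r[OF c[of 1]] r[OF c[of 2]] by (intro add_mono) (simp_all add: w_def)
  finally show "norm (z - vector [real_of_int \<lfloor>2 ^ n * z $ 1\<rfloor> / 2 ^ n, real_of_int \<lfloor>2 ^ n * z $ 2\<rfloor> / 2 ^ n]) \<le> 2 / 2 ^ n"
    by (simp add: w_def)
qed

text \<open>Carries estimates from the net to all frequencies. The constant is
  \<open>12 * pi\<close>, rounded up by \<open>pi < 4\<close>.\<close>

lemma norm_ech_minus_digit_mean_diff_le:
  assumes "norm x \<le> 2" "norm y \<le> 2"
  shows "norm ((ech z x - digit_mean k z * ech z y) - (ech w x - digit_mean k w * ech w y))
    \<le> 48 * norm (z - w)"
proof -
  have l: "norm (ech z p - ech w p) \<le> 4 * pi * norm (z - w)" if "norm p \<le> 2" for p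
  proof -
    have "norm (ech z p - ech w p) \<le> 2 * pi * (norm (z - w) * norm p)" by (rule norm_ech_diff_le)
    also have "\<dots> \<le> 2 * pi * (norm (z - w) * 2)" using that by (intro mult_left_mono) auto
    finally show ?thesis by simp
  qed
  have "(ech z x - digit_mean k z * ech z y) - (ech w x - digit_mean k w * ech w y)
    = (ech z x - ech w x) - (digit_mean k z * (ech z y - ech w y) + (digit_mean k z - digit_mean k w) * ech w y)"
    by (simp add: algebra_simps)
  also have "norm \<dots> \<le> norm (ech z x - ech w x) + (norm (digit_mean k z * (ech z y - ech w y)) +
      norm ((digit_mean k z - digit_mean k w) * ech w y))"
    by (rule order_trans[OF norm_triangle_ineq4 add_left_mono[OF norm_triangle_ineq]])
  also have "\<dots> \<le> 4 * pi * norm (z - w) + (1 * (4 * pi * norm (z - w)) + 4 * pi * norm (z - w) * 1)"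
    unfolding norm_mult
    by (intro add_mono mult_mono l assms norm_digit_mean_le norm_digit_mean_diff_le) auto
  also have "\<dots> = 12 * pi * norm (z - w)" by simp
  also have "\<dots> \<le> 12 * 4 * norm (z - w)" using pi_less_4 by (intro mult_right_mono) auto
  finally show ?thesis by simp
qed

text \<open>Each new point is its parent plus a corner of the next dyadic level, selected greedily
  against all frequencies of the net. By \<open>m \<le> Suc k\<close> the number of points is at
  most the reciprocal mesh of the net, so passing from the net to all frequencies costs a bounded
  amount.\<close>

lemma exists_next_level:
  fixes p :: "nat \<Rightarrow> real^2"
  assumes p: "\<And>j. norm (p j) \<le> 2 * (1 - (1/2) ^ k)" and m: "m \<le> Suc k"
  shows "\<exists>q. (\<forall>j. norm (q j) \<le> 2 * (1 - (1/2) ^ Suc k)) \<and> (\<forall>j. norm (q j - p j) \<le> (1/2) ^ k) \<and>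
    (\<forall>z. norm z \<le> 8 ^ Suc k \<longrightarrow> norm (\<Sum>j<2 ^ m. ech z (q j) - digit_mean k z * ech z (p j))
        \<le> 200 * Suc k * sqrt (2 ^ m))"
proof -
  define n where "n = Suc k"
  define N :: nat where "N = 2 ^ m"
  define Z :: "(real^2) set" where "Z = (\<lambda>(a, b). vector [real_of_int a / 2 ^ n, real_of_int b / 2 ^ n]) `
    ({- (16 ^ n)..16 ^ n :: int} \<times> {- (16 ^ n)..16 ^ n :: int})"
  have Z: "finite Z" "Z \<noteq> {}" "card Z \<le> (3 * 16 ^ n) * (3 * 16 ^ n)"
  proof -
    show "finite Z" unfolding Z_def by simp
    have "(- (16 ^ n) :: int, - (16 ^ n) :: int) \<in> {- (16 ^ n)..16 ^ n :: int} \<times> {- (16 ^ n)..16 ^ n :: int}" by simp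
    then show "Z \<noteq> {}" unfolding Z_def by blast
    have "card Z \<le> card ({- (16 ^ n)..16 ^ n :: int} \<times> {- (16 ^ n)..16 ^ n :: int})"
      unfolding Z_def by (intro card_image_le) simp
    also have "\<dots> = nat (2 * 16 ^ n + 1) * nat (2 * 16 ^ n + 1)" by simp
    also have "\<dots> \<le> (3 * 16 ^ n) * (3 * 16 ^ n)"
    proof -
      have "2 * 16 ^ n + 1 \<le> (3 * 16 ^ n :: int)" by simp
      then have "nat (2 * 16 ^ n + 1) \<le> nat (3 * 16 ^ n)" by (rule nat_mono)
      also have "nat (3 * 16 ^ n) = 3 * 16 ^ n" by (simp add: nat_mult_distrib nat_power_eq)
      finally show ?thesis by (intro mult_mono) auto
    qed
    finally show "card Z \<le> (3 * 16 ^ n) * (3 * 16 ^ n)" .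
  qed
  \<comment> \<open>Subtracting the mean makes the average over the corners vanish; halving brings
    the modulus to at most \<open>1\<close>.\<close>
  define f where "f j z d = ech z (p j) * (ech z (d /\<^sub>R 2 ^ Suc k) - digit_mean k z) / 2" for j z d
  have "\<exists>\<eta>. (\<forall>j. \<eta> j \<in> unit_digits) \<and>
    (\<forall>z\<in>Z. norm (\<Sum>j<N. f j z (\<eta> j)) \<le> 2 * (sqrt N * (ln (4 * card Z) + 1)))"
  proof (rule greedy_complex)
    fix j z d
    have "norm (ech z (d /\<^sub>R 2 ^ Suc k) - digit_mean k z) \<le> 1 + 1"
      using norm_triangle_ineq4[of "ech z (d /\<^sub>R 2 ^ Suc k)" "digit_mean k z"] norm_digit_mean_le[of k z]
      by simp
    then show "norm (f j z d) \<le> 1" unfolding f_def norm_mult norm_divide norm_ech by simp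
    have "(\<Sum>d\<in>unit_digits. ech z (d /\<^sub>R 2 ^ Suc k) - digit_mean k z) = 0"
      by (simp add: sum_subtractf card_unit_digits digit_mean_def)
    then show "(\<Sum>d\<in>unit_digits. f j z d) = 0"
      unfolding f_def sum_divide_distrib[symmetric] sum_distrib_left[symmetric] by simp
  qed (use Z finite_unit_digits in \<open>auto simp: N_def\<close>)
  then obtain \<eta> where \<eta>: "\<And>j. \<eta> j \<in> unit_digits"
    "\<And>z. z \<in> Z \<Longrightarrow> norm (\<Sum>j<N. f j z (\<eta> j)) \<le> 2 * (sqrt N * (ln (4 * card Z) + 1))" by blast
  define q where "q j = p j + \<eta> j /\<^sub>R 2 ^ Suc k" for j
  have qp: "norm (q j - p j) \<le> (1/2) ^ k" for j
  proof -
    have "norm (q j - p j) = \<bar>inverse (2 ^ Suc k)\<bar> * norm (\<eta> j)" unfolding q_def by simp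
    also have "\<dots> \<le> \<bar>inverse (2 ^ Suc k)\<bar> * 2" by (intro mult_left_mono norm_unit_digits \<eta>) simp
    also have "\<dots> = (1/2) ^ k" by (simp add: power_one_over inverse_eq_divide)
    finally show ?thesis .
  qed
  have qn: "norm (q j) \<le> 2 * (1 - (1/2) ^ Suc k)" for j
    using norm_triangle_sub[of "q j" "p j"] qp[of j] p[of j] by simp
  have n2: "norm (p j) \<le> 2" "norm (q j) \<le> 2" for j
    using p[of j] qn[of j] by (smt (verit) zero_le_power zero_le_divide_1_iff)+
  have lnZ: "ln (4 * card Z) \<le> 6 + 8 * n"
  proof -
    have "ln (4 * card Z) \<le> ln (2 ^ (6 + 8 * n) :: real)"
    proof (subst ln_le_cancel_iff)
      have "4 * card Z \<le> 36 * (16 ^ n * 16 ^ n)" using Z(3) by simp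
      also have "(16::nat) ^ n * 16 ^ n = 2 ^ (8 * n)"
        by (simp add: power_mult power_mult_distrib[symmetric])
      also have "36 * 2 ^ (8 * n) \<le> (64 * 2 ^ (8 * n) :: nat)" by simp
      also have "\<dots> = 2 ^ (6 + 8 * n)" by (simp add: power_add)
      finally show "real (4 * card Z) \<le> 2 ^ (6 + 8 * n)"
        by (metis of_nat_le_iff of_nat_power of_nat_numeral)
    qed (use Z in \<open>auto simp: card_gt_0_iff\<close>)
    also have "\<dots> = (6 + 8 * n) * ln 2" by (simp add: ln_realpow)
    also have "\<dots> \<le> real (6 + 8 * n) * 1" using ln_2_less_1 by (intro mult_left_mono) auto
    finally show ?thesis by simp
  qed
  have "norm (\<Sum>j<2 ^ m. ech z (q j) - digit_mean k z * ech z (p j)) \<le> 200 * Suc k * sqrt (2 ^ m)"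
    if z: "norm z \<le> 8 ^ Suc k" for z
  proof -
    obtain a b :: int where ab: "a \<in> {- (16 ^ n)..16 ^ n}" "b \<in> {- (16 ^ n)..16 ^ n}"
      "norm (z - vector [real_of_int a / 2 ^ n, real_of_int b / 2 ^ n]) \<le> 2 / 2 ^ n"
      using frequency_net[of z n] z unfolding n_def by blast
    define w :: "real^2" where "w = vector [real_of_int a / 2 ^ n, real_of_int b / 2 ^ n]"
    have w: "w \<in> Z" "norm (z - w) \<le> 2 / 2 ^ n" using ab by (auto simp: w_def Z_def)
    define S where "S z = (\<Sum>j<N. ech z (q j) - digit_mean k z * ech z (p j))" for z
    have "S w = 2 * (\<Sum>j<N. f j w (\<eta> j))"
      unfolding S_def sum_distrib_left
      by (intro sum.cong refl) (simp add: f_def q_def ech_add algebra_simps)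
    then have "norm (S w) = 2 * norm (\<Sum>j<N. f j w (\<eta> j))" by (simp add: norm_mult)
    also have "\<dots> \<le> 2 * (2 * (sqrt N * (ln (4 * card Z) + 1)))" using \<eta>(2)[OF w(1)] by simp
    also have "\<dots> \<le> 2 * (2 * (sqrt N * ((6 + 8 * n) + 1)))" using lnZ by (intro mult_left_mono) auto
    also have "\<dots> = sqrt N * (28 + 32 * n)" by (simp add: algebra_simps)
    also have "\<dots> \<le> sqrt N * (60 * n)" by (intro mult_left_mono) (auto simp: n_def)
    finally have Sw: "norm (S w) \<le> sqrt N * (60 * n)" .
    have "S z - S w = (\<Sum>j<N. (ech z (q j) - digit_mean k z * ech z (p j)) - (ech w (q j) - digit_mean k w * ech w (p j)))"
      unfolding S_def by (rule sum_subtractf[symmetric])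
    also have "norm \<dots> \<le> (\<Sum>j<N. 48 * norm (z - w))"
      by (intro sum_norm_le norm_ech_minus_digit_mean_diff_le n2)
    also have "\<dots> \<le> (\<Sum>j<N. 48 * (2 / 2 ^ n))" using w(2) by (intro sum_mono mult_left_mono) auto
    also have "\<dots> = 96 * (N / 2 ^ n)" by simp
    also have "\<dots> \<le> 96 * (sqrt N * n)"
    proof (intro mult_left_mono)
      have "(2::real) ^ m \<le> 2 ^ n" using m unfolding n_def by (intro power_increasing) auto
      then have "real N / 2 ^ n \<le> 1" by (simp add: N_def)
      also have "1 \<le> sqrt N" by (simp add: N_def)
      also have "sqrt N = sqrt N * 1" by simp
      also have "\<dots> \<le> sqrt N * n" by (intro mult_left_mono) (auto simp: n_def)
      finally show "real N / 2 ^ n \<le> sqrt N * n" .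
    qed simp
    finally have "norm (S z - S w) \<le> 96 * (sqrt N * n)" .
    \<comment> \<open>The greedy bound contributes \<open>60\<close>, the passage from
      \<open>w\<close> to \<open>z\<close> at most \<open>96\<close>; \<open>200\<close> is a round
      bound for their sum.\<close>
    with Sw norm_triangle_sub[of "S z" "S w"] have "norm (S z) \<le> sqrt N * (60 * n) + 96 * (sqrt N * n)"
      by linarith
    also have "\<dots> = 156 * (sqrt N * n)" by simp
    also have "\<dots> \<le> 200 * (sqrt N * n)" by (intro mult_right_mono) auto
    also have "\<dots> = 200 * Suc k * sqrt (2 ^ m)" by (simp add: N_def n_def mult_ac)
    finally show ?thesis by (simp add: S_def N_def)
  qed
  with qp qn show ?thesis by blast
qed

text \<open>Points of different nodes may coincide. No separation is arranged, since Fourier decay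
  alone will show that the limit set is large.\<close>

lemma exists_salem_tree:
  assumes c: "\<And>k. c k \<le> c (Suc k)" "\<And>k. c k \<le> k"
  obtains x where "dyadic_tree c x" "\<And>k z. norm z \<le> 8 ^ Suc k \<Longrightarrow>
    norm (\<Sum>j<2 ^ c (Suc k). ech z (x (Suc k) j) - digit_mean k z * ech z (x k (j div 2 ^ (c (Suc k) - c k))))
      \<le> 200 * Suc k * sqrt (2 ^ c (Suc k))"
proof -
  define P where "P k p \<longleftrightarrow> (\<forall>j. norm (p j) \<le> 2 * (1 - (1/2) ^ k))" for k and p :: "nat \<Rightarrow> real^2"
  define Q where "Q k p q \<longleftrightarrow> (\<forall>j. norm (q j - p (j div 2 ^ (c (Suc k) - c k))) \<le> (1/2) ^ k) \<and>
    (\<forall>z. norm z \<le> 8 ^ Suc k \<longrightarrow>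
      norm (\<Sum>j<2 ^ c (Suc k). ech z (q j) - digit_mean k z * ech z (p (j div 2 ^ (c (Suc k) - c k))))
        \<le> 200 * Suc k * sqrt (2 ^ c (Suc k)))" for k and p q :: "nat \<Rightarrow> real^2"
  have "\<exists>x. \<forall>k. P k (x k) \<and> Q k (x k) (x (Suc k))"
  proof (rule dependent_nat_choice)
    show "\<exists>x. P 0 x" unfolding P_def by (intro exI[of _ "\<lambda>_. 0"]) simp
    fix p k assume "P k p"
    then show "\<exists>q. P (Suc k) q \<and> Q k p q"
      using exists_next_level[of "\<lambda>j. p (j div 2 ^ (c (Suc k) - c k))" k "c (Suc k)"] c(2)[of "Suc k"]
      unfolding P_def Q_def by blast
  qed
  then obtain x where x: "\<And>k. Q k (x k) (x (Suc k))" by blast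
  show thesis
  proof (rule that)
    show "dyadic_tree c x" using x c(1) by unfold_locales (auto simp: Q_def)
  qed (use x in \<open>auto simp: Q_def\<close>)
qed

lemma sum_div_group:
  fixes g :: "nat \<Rightarrow> 'a::real_algebra_1"
  shows "(\<Sum>j<n * q. g (j div q)) = of_nat q * (\<Sum>j<n. g j)"
proof -
  have "(\<Sum>j<n * q. g (j div q)) = (\<Sum>m<n. \<Sum>j=m * q..<m * q + q. g (j div q))"
    by (rule sum.nat_group[symmetric])
  also have "\<dots> = (\<Sum>m<n. of_nat q * g m)"
  proof (intro sum.cong refl)
    fix m
    have "(\<Sum>j=m * q..<m * q + q. g (j div q)) = (\<Sum>j=m * q..<m * q + q. g m)"
    proof (intro sum.cong refl arg_cong[of _ _ g])
      fix j assume "j \<in> {m * q..<m * q + q}"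
      then show "j div q = m" by (intro div_nat_eqI) (auto simp: mult.commute)
    qed
    then show "(\<Sum>j=m * q..<m * q + q. g (j div q)) = of_nat q * g m" by simp
  qed
  finally show ?thesis by (simp add: sum_distrib_left)
qed

text \<open>Interpolates between the two bounds for \<open>square_ft\<close>, so that exactly the
  desired power of the frequency appears.\<close>

lemma min_one_le_powr:
  fixes q a :: real
  assumes "0 < q" "0 \<le> a" "a \<le> 1"
  shows "min 1 q \<le> q powr a"
proof (cases "q \<le> 1")
  case True
  then have "q powr 1 \<le> q powr a" using assms by (intro powr_mono') auto
  with assms True show ?thesis by simp
next
  case False
  then have "1 \<le> q powr a" using assms by (intro ge_one_powr_ge_zero) auto
  with False show ?thesis by simp
qed

section \<open>Fourier decay of the measure on the limit set\<close>

context dyadic_tree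
begin

definition node_ft :: "nat \<Rightarrow> real^2 \<Rightarrow> complex" where
  "node_ft k z = (\<Sum>j<2 ^ c k. ech z (x k j)) / 2 ^ c k"

lemma norm_node_ft_le: "norm (node_ft k z) \<le> 1"
proof -
  have "norm (\<Sum>j<2 ^ c k. ech z (x k j)) \<le> (\<Sum>j<(2::nat) ^ c k. 1)" by (intro sum_norm_le) simp
  then show ?thesis by (simp add: node_ft_def norm_divide norm_power)
qed

lemma node_ft_refine:
  "node_ft k z = (\<Sum>j<2 ^ c (Suc k). ech z (x k (j div 2 ^ (c (Suc k) - c k)))) / 2 ^ c (Suc k)"
proof -
  define d where "d = c (Suc k) - c k"
  have cS: "c (Suc k) = c k + d" using c_Suc[of k] by (simp add: d_def)
  have "(\<Sum>j<2 ^ c (Suc k). ech z (x k (j div 2 ^ d))) = of_nat (2 ^ d) * (\<Sum>j<2 ^ c k. ech z (x k j))"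
    unfolding cS power_add by (rule sum_div_group)
  then show ?thesis unfolding d_def[symmetric] node_ft_def by (simp add: cS power_add)
qed

lemma tendsto_node_ft: "(\<lambda>k. node_ft k z) \<longlonglongrightarrow> fourier_transform branch_measure z"
proof -
  let ?M = "restrict_space lborel {0..<1::real}"
  have cont: "continuous_on UNIV (ech z)" unfolding ech_def[abs_def] by (intro continuous_intros)
  then have meas: "ech z \<in> borel_measurable borel" by (rule borel_measurable_continuous_onI)
  have ft: "fourier_transform branch_measure z = (LINT w|?M. ech z (branch w))"
    unfolding fourier_transform_def exp_eq_ech branch_measure_def
    by (intro integral_distr measurable_branch meas)
  have node: "node_ft k z = (LINT w|?M. ech z (x k (idx k w)))" for k
    unfolding node_ft_def by (rule integral_step[symmetric])
  show ?thesis unfolding ft node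
  proof (rule integral_dominated_convergence[where w = "\<lambda>_. 1"])
    show "(\<lambda>w. ech z (branch w)) \<in> borel_measurable ?M"
      by (rule measurable_compose[OF measurable_branch meas])
    show "(\<lambda>w. ech z (x k (idx k w))) \<in> borel_measurable ?M" for k
      by (intro measurable_restrict_space1) (simp add: measurable_compose[OF measurable_node meas])
    have "finite_measure ?M"
      by (intro finite_measureI) (simp add: space_restrict_space emeasure_unit)
    then show "integrable ?M (\<lambda>_. 1 :: real)" by (rule finite_measure.integrable_const)
    show "AE w in ?M. (\<lambda>k. ech z (x k (idx k w))) \<longlonglongrightarrow> ech z (branch w)"
    proof (rule AE_I2)
      fix w assume "w \<in> space ?M"
      then have "0 \<le> w" by (simp add: space_restrict_space)
      then show "(\<lambda>k. ech z (x k (idx k w))) \<longlonglongrightarrow> ech z (branch w)"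
        using cont by (intro isCont_tendsto_compose[OF _ LIMSEQ_branch])
          (simp_all add: continuous_on_eq_continuous_at)
    qed
  qed simp
qed

text \<open>
  Smearing the node masses over squares of side \<open>2 ^ - k\<close> turns the level-\<open>k\<close> transforms into
  \<open>smooth_ft k\<close>, whose increments carry the decaying factor \<open>square_ft\<close>.
\<close>

definition smooth_ft :: "nat \<Rightarrow> real^2 \<Rightarrow> complex" where
  "smooth_ft k z = node_ft k z * square_ft (z /\<^sub>R 2 ^ k)"

lemma tendsto_smooth_ft: "(\<lambda>k. smooth_ft k z) \<longlonglongrightarrow> fourier_transform branch_measure z"
  using tendsto_mult[OF tendsto_node_ft[of z] tendsto_square_ft[of z]] by (simp add: smooth_ft_def)

text \<open>\<open>square_ft_scale\<close> and \<open>node_ft_refine\<close> write both levels as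
  sums over the same children with a common factor, leaving exactly the sum that the greedy choice
  controls.\<close>

lemma smooth_ft_increment:
  "smooth_ft (Suc k) z - smooth_ft k z = square_ft (z /\<^sub>R 2 ^ Suc k) *
    ((\<Sum>j<2 ^ c (Suc k). ech z (x (Suc k) j) - digit_mean k z * ech z (x k (j div 2 ^ (c (Suc k) - c k))))
      / 2 ^ c (Suc k))"
  unfolding smooth_ft_def square_ft_scale[where k = k] node_ft_refine[where k = k]
  by (simp add: node_ft_def sum_subtractf sum_distrib_left[symmetric] diff_divide_distrib right_diff_distrib
      mult_ac del: power_Suc)

text \<open>Up to \<open>8 ^ Suc k\<close> the greedy bound supplies the decay in \<open>k\<close>
  and interpolation of \<open>square_ft\<close> the decay in \<open>z\<close>. Beyond that range the
  sum is bounded trivially and \<open>square_ft\<close> supplies both.\<close>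

lemma smooth_ft_increment_le:
  fixes t a :: real
  assumes salem: "\<And>k z. norm z \<le> 8 ^ Suc k \<Longrightarrow>
    norm (\<Sum>j<2 ^ c (Suc k). ech z (x (Suc k) j) - digit_mean k z * ech z (x k (j div 2 ^ (c (Suc k) - c k))))
      \<le> 200 * Suc k * sqrt (2 ^ c (Suc k))"
    and ct: "\<And>k. t * real k - 1 \<le> real (c k)" and a: "0 \<le> a" "a < t" "t \<le> 1" and z: "z \<noteq> 0"
  shows "norm (smooth_ft (Suc k) z - smooth_ft k z)
    \<le> 400 * (Suc k * (2 powr (- ((t - a) / 2))) ^ k) * norm z powr (- a / 2)"
proof -
  define n where "n = Suc k"
  define r where "r = 2 powr (- ((t - a) / 2))"
  have r: "0 < r" "r \<le> 1" using a powr_mono[of "- ((t - a) / 2)" 0 2] by (auto simp: r_def)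
  define S where "S = (\<Sum>j<2 ^ c n. ech z (x n j) - digit_mean k z * ech z (x k (j div 2 ^ (c n - c k))))"
  have nz: "norm z > 0" using z by simp
  have sq: "norm (square_ft (z /\<^sub>R 2 ^ n)) \<le> min 1 (2 ^ n / norm z)"
    using norm_square_ft_le_one[of "z /\<^sub>R 2 ^ n"] norm_square_ft_le[of "z /\<^sub>R 2 ^ n"] z
    by (simp add: field_simps)
  have "norm (smooth_ft n z - smooth_ft k z) = norm (square_ft (z /\<^sub>R 2 ^ n)) * (norm S / 2 ^ c n)"
    unfolding S_def n_def smooth_ft_increment by (simp add: norm_mult norm_divide norm_power del: power_Suc)
  also have "\<dots> \<le> 400 * (n * r ^ n) * norm z powr (- a / 2)"
  proof (cases "norm z \<le> 8 ^ n")
    case True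
    have "norm S \<le> 200 * n * sqrt (2 ^ c n)" using salem[of z k] True by (simp add: S_def n_def)
    then have "norm S / 2 ^ c n \<le> 200 * n * sqrt (2 ^ c n) / 2 ^ c n" by (intro divide_right_mono) auto
    also have "\<dots> = 200 * n * 2 powr (- (c n / 2))"
    proof -
      have "sqrt (2 ^ c n) = 2 powr (c n / 2)"
        by (simp add: powr_half_sqrt[symmetric] powr_realpow[symmetric] powr_powr)
      moreover have "(2::real) ^ c n = 2 powr (c n / 2) * 2 powr (c n / 2)"
        by (simp add: powr_add[symmetric] powr_realpow)
      ultimately show ?thesis by (simp add: powr_minus_divide)
    qed
    \<comment> \<open>The slack of one unit in \<open>ct\<close> costs a factor
      \<open>sqrt 2\<close>, rounded up to \<open>2\<close>; hence
      \<open>400 = 2 * 200\<close>.\<close>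
    also have "\<dots> \<le> 200 * n * 2 powr (1 - t * n / 2)"
      using ct[of n] by (intro mult_left_mono powr_mono) auto
    finally have S: "norm S / 2 ^ c n \<le> 200 * n * 2 powr (1 - t * n / 2)" .
    have "norm (square_ft (z /\<^sub>R 2 ^ n)) \<le> (2 ^ n / norm z) powr (a / 2)"
      by (rule order_trans[OF sq min_one_le_powr]) (use a nz in auto)
    also have "\<dots> = 2 powr (n * a / 2) * norm z powr (- a / 2)"
      using nz by (simp add: powr_divide powr_realpow[symmetric] powr_powr powr_minus_divide)
    finally have "norm (square_ft (z /\<^sub>R 2 ^ n)) * (norm S / 2 ^ c n)
      \<le> (2 powr (n * a / 2) * norm z powr (- a / 2)) * (200 * n * 2 powr (1 - t * n / 2))"
      using S by (intro mult_mono) auto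
    also have "\<dots> = 200 * n * (2 powr (n * a / 2) * 2 powr (1 - t * n / 2)) * norm z powr (- a / 2)"
      by simp
    also have "2 powr (n * a / 2) * 2 powr (1 - t * n / 2) = 2 * r ^ n"
      unfolding r_def by (simp add: powr_realpow[symmetric] powr_powr powr_add[symmetric] powr_mult_base
          algebra_simps add_divide_distrib diff_divide_distrib)
    finally show ?thesis by simp
  next
    case False
    have "norm (digit_mean k z * ech z p) \<le> 1" for p using norm_digit_mean_le by (simp add: norm_mult)
    then have "norm (ech z q - digit_mean k z * ech z p) \<le> 2" for p q
      using norm_triangle_ineq4[of "ech z q" "digit_mean k z * ech z p"] by (smt (verit) norm_ech)
    then have "norm S \<le> (\<Sum>j<(2::nat) ^ c n. 2)" unfolding S_def by (intro sum_norm_le) auto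
    then have "norm S / 2 ^ c n \<le> 2" by (simp add: divide_le_eq)
    then have "norm (square_ft (z /\<^sub>R 2 ^ n)) * (norm S / 2 ^ c n) \<le> 2 ^ n / norm z * 2"
      using sq nz by (intro mult_mono) auto
    also have "1 / norm z = norm z powr (- 1/2) * norm z powr (- 1/2)"
      using nz by (simp add: powr_add[symmetric] powr_minus_divide)
    then have "2 ^ n / norm z * 2 = 2 * (2 ^ n * norm z powr (- 1/2)) * norm z powr (- 1/2)"
      by (metis (no_types, lifting) mult.assoc mult.commute mult.right_neutral times_divide_eq_right)
    \<comment> \<open>One half power of \<open>norm z\<close>, which exceeds \<open>8 ^ n\<close>,
      turns \<open>2 ^ n\<close> into \<open>2 powr (- n / 2)\<close>. The other is kept for the
      decay in \<open>z\<close>; as \<open>1 \<le> norm z\<close>, its exponent may be weakened to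
      \<open>- a / 2\<close>.\<close>
    also have "\<dots> \<le> 2 * r ^ n * norm z powr (- a / 2)"
    proof (intro mult_mono)
      have "norm z powr (- 1/2) \<le> (8 ^ n) powr (- 1/2)"
        using False by (intro powr_mono2') auto
      also have "(8::real) ^ n = 2 powr (3 * n)" by (simp add: powr_realpow[symmetric] powr_powr[symmetric])
      also have "(2 powr (3 * n)) powr (- 1/2) = 2 powr (- 3 * real n / 2)" by (simp add: powr_powr)
      finally have "2 ^ n * norm z powr (- 1/2) \<le> 2 powr n * 2 powr (- 3 * real n / 2)"
        by (simp add: powr_realpow)
      also have "\<dots> = 2 powr (- real n / 2)" by (simp add: powr_add[symmetric])
      also have "\<dots> \<le> 2 powr (- ((t - a) / 2) * real n)"
      proof -
        have "(t - a) * real n \<le> 1 * real n" using a by (intro mult_right_mono) auto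
        then show ?thesis by simp
      qed
      also have "\<dots> = r ^ n" by (simp add: r_def powr_realpow[symmetric] powr_powr)
      finally show "2 ^ n * norm z powr (- 1/2) \<le> r ^ n" .
      have "1 \<le> (8::real) ^ n" by simp
      also have "\<dots> \<le> norm z" using False by simp
      finally have "1 \<le> norm z" .
      then show "norm z powr (- 1/2) \<le> norm z powr (- a / 2)" using a by (intro powr_mono) auto
    qed (use r in auto)
    also have "\<dots> \<le> 400 * (n * r ^ n) * norm z powr (- a / 2)"
    proof (intro mult_right_mono)
      have "1 * r ^ n \<le> n * r ^ n" using r by (intro mult_right_mono) (auto simp: n_def)
      moreover have "0 \<le> r ^ n" using r by simp
      ultimately show "2 * r ^ n \<le> 400 * (n * r ^ n)" by linarith
    qed simp
    finally show ?thesis .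
  qed
  also have "\<dots> \<le> 400 * (n * r ^ k) * norm z powr (- a / 2)"
  proof -
    have "r ^ n \<le> r ^ k" using r unfolding n_def by (intro power_decreasing) auto
    then show ?thesis by (intro mult_left_mono mult_right_mono) auto
  qed
  finally show ?thesis unfolding n_def r_def .
qed

text \<open>The increments telescope from level \<open>0\<close>, which decays through
  \<open>square_ft\<close> alone. The factor \<open>Suc k\<close> is harmless against the geometric
  decay; \<open>B\<close> is the differentiated geometric series.\<close>

lemma fourier_decay:
  fixes t a :: real
  assumes salem: "\<And>k z. norm z \<le> 8 ^ Suc k \<Longrightarrow>
    norm (\<Sum>j<2 ^ c (Suc k). ech z (x (Suc k) j) - digit_mean k z * ech z (x k (j div 2 ^ (c (Suc k) - c k))))
      \<le> 200 * Suc k * sqrt (2 ^ c (Suc k))"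
    and ct: "\<And>k. t * real k - 1 \<le> real (c k)" and a: "0 \<le> a" "a < t" "t \<le> 1"
  shows "\<exists>C>0. \<forall>z. z \<noteq> 0 \<longrightarrow> norm (fourier_transform branch_measure z) \<le> C * norm z powr (- a / 2)"
proof -
  define r where "r = 2 powr (- ((t - a) / 2))"
  have r: "0 < r" "r < 1" using a powr_less_mono[of "- ((t - a) / 2)" 0 2] by (auto simp: r_def)
  define B where "B = 1 / (1 - r)\<^sup>2"
  have sums: "(\<lambda>k. real (Suc k) * r ^ k) sums B"
    unfolding B_def using geometric_deriv_sums[of r] r by simp
  have B: "0 \<le> B" by (simp add: B_def)
  have "norm (fourier_transform branch_measure z) \<le> (1 + 400 * B) * norm z powr (- a / 2)" if z: "z \<noteq> 0" for z
  proof (rule LIMSEQ_le_const2[OF tendsto_norm[OF tendsto_smooth_ft]], intro exI allI impI)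
    fix m
    have "smooth_ft m z - smooth_ft 0 z = (\<Sum>k<m. smooth_ft (Suc k) z - smooth_ft k z)"
      by (rule sum_lessThan_telescope[symmetric])
    also have "norm \<dots> \<le> (\<Sum>k<m. 400 * (Suc k * r ^ k) * norm z powr (- a / 2))"
      unfolding r_def
      by (intro sum_norm_le smooth_ft_increment_le salem ct a z)
    also have "\<dots> = 400 * (\<Sum>k<m. Suc k * r ^ k) * norm z powr (- a / 2)"
      by (simp add: sum_distrib_left sum_distrib_right)
    also have "\<dots> \<le> 400 * B * norm z powr (- a / 2)"
    proof (intro mult_right_mono mult_left_mono)
      show "(\<Sum>k<m. real (Suc k) * r ^ k) \<le> B"
        using sums_unique[OF sums] r sum_le_suminf[OF sums_summable[OF sums], of "{..<m}"] by simp
    qed auto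
    finally have 1: "norm (smooth_ft m z - smooth_ft 0 z) \<le> 400 * B * norm z powr (- a / 2)" .
    have "norm (smooth_ft 0 z) \<le> 1 * norm (square_ft z)"
      unfolding smooth_ft_def norm_mult by (intro mult_mono norm_node_ft_le) auto
    also have "\<dots> \<le> min 1 (1 / norm z)"
      using norm_square_ft_le_one[of z] norm_square_ft_le[OF z] by simp
    also have "\<dots> \<le> (1 / norm z) powr (a / 2)" using z a by (intro min_one_le_powr) auto
    also have "\<dots> = norm z powr (- a / 2)" using z by (simp add: powr_divide powr_minus_divide)
    finally show "norm (smooth_ft m z) \<le> (1 + 400 * B) * norm z powr (- a / 2)"
      using 1 norm_triangle_sub[of "smooth_ft m z" "smooth_ft 0 z"] by (simp add: distrib_right)
  qed
  then show ?thesis using B by (intro exI[of _ "1 + 400 * B"]) auto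
qed

end

lemma exists_salem_set:
  fixes t :: real
  assumes t: "0 < t" "t \<le> 1"
  obtains A :: "(real^2) set" where "compact A" "hausdorff_dim A \<le> ereal t"
    "ereal t \<le> fourier_dim A" 
proof -
  \<comment> \<open>Rounding down keeps the number of nodes within \<open>2 powr (t * k)\<close>, as
    the covers require, and loses less than one digit in the decay.\<close>
  define c where "c k = nat \<lfloor>t * real k\<rfloor>" for k
  have c1: "c k \<le> c (Suc k)" for k
    unfolding c_def using t by (intro nat_mono floor_mono mult_left_mono) auto
  have c2: "c k \<le> k" for k
  proof -
    have "t * real k \<le> 1 * real k" using t by (intro mult_right_mono) auto
    then have "\<lfloor>t * real k\<rfloor> \<le> int k" by linarith
    then show ?thesis unfolding c_def by linarith
  qed
  have nn: "0 \<le> \<lfloor>t * real k\<rfloor>" for k using t by simp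
  have c3: "t * real k - 1 \<le> real (c k)" and c4: "real (c k) \<le> t * real k" for k
    using nn[of k] unfolding c_def by linarith+
  from exists_salem_tree[of c, OF c1 c2] obtain x where "dyadic_tree c x" and salem: "\<And>k z. norm z \<le> 8 ^ Suc k \<Longrightarrow>
    norm (\<Sum>j<2 ^ c (Suc k). ech z (x (Suc k) j) - digit_mean k z * ech z (x k (j div 2 ^ (c (Suc k) - c k))))
      \<le> 200 * Suc k * sqrt (2 ^ c (Suc k))" by blast
  then interpret dyadic_tree c x by simp
  show thesis
  proof (rule that)
    show "compact limit_set" by (rule compact_limit_set)
    show "hausdorff_dim limit_set \<le> ereal t"
      using t c4 by (intro hausdorff_dim_limit_set_le) (auto simp: mult.commute intro!: exI)
    have "ereal t \<le> fourier_dim_measure branch_measure"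
      unfolding fourier_dim_measure_def
    proof (rule le_Sup_iff[THEN iffD2, rule_format])
      fix y assume y: "y < ereal t"
      obtain a where a: "0 \<le> a" "a < t" "y < ereal a"
      proof -
        obtain b where "max y 0 < b" "b < ereal t" using dense[of "max y 0" "ereal t"] y t by auto
        then show thesis using that[of "real_of_ereal b"] by (cases b) auto
      qed
      then show "\<exists>u\<in>ereal ` {s. 0 \<le> s \<and> (\<exists>C>0. \<forall>z. z \<noteq> 0 \<longrightarrow>
          cmod (fourier_transform branch_measure z) \<le> C * norm z powr (- s / 2))}. y < u"
        using fourier_decay[OF salem c3 a(1,2) t(2)] by blast
    qed
    moreover have "ereal t \<le> ereal (real DIM(real^2))" using t by simp
    ultimately have "ereal t \<le> min (fourier_dim_measure branch_measure) (ereal (real DIM(real^2)))" by simp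
    also have "\<dots> \<le> fourier_dim limit_set"
      unfolding fourier_dim_def using branch_measure_compactly_supported by (intro Sup_upper) auto
    finally show "ereal t \<le> fourier_dim limit_set" .
  qed
qed

section \<open>Fourier decay and the dimension of projections\<close>

text \<open>The condition \<open>a < 1\<close> makes the singularity at \<open>0\<close> integrable.
  Near \<open>0\<close> the density is at most \<open>1\<close>; away from it the power is.\<close>

lemma nn_integral_abs_powr_std_normal:
  assumes "0 < a" "a < 1"
  shows "(\<integral>\<^sup>+ u. ennreal (\<bar>u\<bar> powr (- a)) \<partial>std_normal_distribution) < \<infinity>"
proof -
  interpret N: real_distribution std_normal_distribution by (rule real_dist_normal_dist)
  have I: "((\<lambda>u. u powr (- a)) has_integral (1 powr (- a + 1) / (- a + 1))) {0..1}"
    using assms by (intro has_integral_powr_from_0) auto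
  have I': "((\<lambda>u. (- u) powr (- a)) has_integral (1 powr (- a + 1) / (- a + 1))) {- 1..0}"
    using has_integral_reflect_lemma_real[OF I] by simp
  have J: "(\<integral>\<^sup>+u. indicator {0..1} u * ennreal (u powr (- a)) \<partial>lborel) = ennreal (1 powr (- a + 1) / (- a + 1))"
    using nn_integral_has_integral_lebesgue'[OF _ I] by (simp add: mult.commute)
  have J': "(\<integral>\<^sup>+u. indicator {- 1..0} u * ennreal ((- u) powr (- a)) \<partial>lborel) = ennreal (1 powr (- a + 1) / (- a + 1))"
    using nn_integral_has_integral_lebesgue'[OF _ I'] by (simp add: mult.commute)
  have dens: "std_normal_density u \<le> 1" for u
  proof -
    have "1 / sqrt (2 * pi) \<le> 1" using pi_ge_two by (simp add: divide_le_eq)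
    then have "1 / sqrt (2 * pi) * exp (- u\<^sup>2 / 2) \<le> 1 * 1" by (intro mult_mono) auto
    then show ?thesis by (simp add: std_normal_density_def)
  qed
  have "(\<integral>\<^sup>+ u. ennreal (\<bar>u\<bar> powr (- a)) \<partial>std_normal_distribution)
      = (\<integral>\<^sup>+ u. ennreal (std_normal_density u) * ennreal (\<bar>u\<bar> powr (- a)) \<partial>lborel)"
    by (rule nn_integral_density) auto
  also have "\<dots> \<le> (\<integral>\<^sup>+ u. (indicator {0..1} u * ennreal (u powr (- a)) +
      indicator {- 1..0} u * ennreal ((- u) powr (- a))) + ennreal (std_normal_density u) \<partial>lborel)"
  proof (rule nn_integral_mono)
    fix u :: real
    consider "0 \<le> u" "u \<le> 1" | "- 1 \<le> u" "u < 0" | "1 \<le> \<bar>u\<bar>" by linarith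
    then show "ennreal (std_normal_density u) * ennreal (\<bar>u\<bar> powr (- a)) \<le>
      (indicator {0..1} u * ennreal (u powr (- a)) +
      indicator {- 1..0} u * ennreal ((- u) powr (- a))) + ennreal (std_normal_density u)"
    proof cases
      case 1
      have "ennreal (std_normal_density u) * ennreal (\<bar>u\<bar> powr (- a)) \<le> 1 * ennreal (\<bar>u\<bar> powr (- a))"
        using dens[of u] by (intro mult_right_mono) auto
      with 1 show ?thesis by (auto intro: order_trans add_increasing2)
    next
      case 2
      have "ennreal (std_normal_density u) * ennreal (\<bar>u\<bar> powr (- a)) \<le> 1 * ennreal (\<bar>u\<bar> powr (- a))"
        using dens[of u] by (intro mult_right_mono) auto
      with 2 show ?thesis by (auto intro: order_trans add_increasing2)
    next
      case 3
      have "\<bar>u\<bar> powr (- a) \<le> 1 powr (- a)" using 3 assms by (intro powr_mono2') auto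
      then have "ennreal (std_normal_density u) * ennreal (\<bar>u\<bar> powr (- a)) \<le> ennreal (std_normal_density u) * 1"
        by (intro mult_left_mono) auto
      then show ?thesis by (auto intro: order_trans add_increasing)
    qed
  qed
  also have "\<dots> = (\<integral>\<^sup>+u. indicator {0..1} u * ennreal (u powr (- a)) \<partial>lborel) +
      (\<integral>\<^sup>+u. indicator {- 1..0} u * ennreal ((- u) powr (- a)) \<partial>lborel) +
      (\<integral>\<^sup>+u. ennreal (std_normal_density u) \<partial>lborel)"
    by (subst nn_integral_add; (subst nn_integral_add)?) auto
  also have "\<dots> < \<infinity>"
  proof -
    have "(\<integral>\<^sup>+u. ennreal (std_normal_density u) \<partial>lborel) = emeasure std_normal_distribution UNIV"
      by (subst emeasure_density) auto
    then show ?thesis using N.emeasure_space_1 unfolding J J' by simp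
  qed
  finally show ?thesis .
qed

lemma (in finite_measure) integrable_iexp:
  assumes "f \<in> borel_measurable M"
  shows "integrable M (\<lambda>x. iexp (f x))"
  by (rule integrable_const_bound[where B = 1]) (use assms in auto)

text \<open>
  The Gaussian \<open>exp (- u\<^sup>2 / 2)\<close> is the characteristic function of the normal distribution, so
  the left-hand side equals \<open>\<integral> \<bar>char \<nu> (\<tau> / r)\<bar>\<^sup>2\<close> averaged over a normal variable \<open>\<tau>\<close>.
\<close>

lemma gaussian_energy_le:
  fixes \<nu> :: "real measure"
  assumes fin: "finite_measure \<nu>" and sets: "sets \<nu> = sets borel" and C: "0 < C"
    and decay: "\<And>u. u \<noteq> 0 \<Longrightarrow> norm (char \<nu> u) \<le> C * \<bar>u\<bar> powr (- a / 2)" and r: "0 < r"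
  shows "(\<integral>\<^sup>+x. \<integral>\<^sup>+y. ennreal (exp (- ((x - y) / r)\<^sup>2 / 2)) \<partial>\<nu> \<partial>\<nu>)
    \<le> ennreal (C\<^sup>2 * r powr a) * (\<integral>\<^sup>+ u. ennreal (\<bar>u\<bar> powr (- a)) \<partial>std_normal_distribution)"
proof -
  interpret fin: finite_measure \<nu> by (rule fin)
  interpret N: real_distribution std_normal_distribution by (rule real_dist_normal_dist)
  interpret P: pair_sigma_finite \<nu> \<nu> ..
  interpret PP: finite_measure "\<nu> \<Otimes>\<^sub>M \<nu>" by (rule finite_measure_pair_measure) (rule fin)+
  interpret Q: pair_sigma_finite "\<nu> \<Otimes>\<^sub>M \<nu>" std_normal_distribution ..
  interpret QQ: finite_measure "(\<nu> \<Otimes>\<^sub>M \<nu>) \<Otimes>\<^sub>M std_normal_distribution"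
    by (rule finite_measure_pair_measure) (unfold_locales)
  note [measurable_cong] = sets
  let ?k = "\<lambda>p. exp (- ((fst p - snd p) / r)\<^sup>2 / 2)"
  have kint: "integrable (\<nu> \<Otimes>\<^sub>M \<nu>) ?k"
    by (rule PP.integrable_const_bound[where B = 1]) auto
  have "complex_of_real (LINT p|(\<nu> \<Otimes>\<^sub>M \<nu>). ?k p) = (LINT p|(\<nu> \<Otimes>\<^sub>M \<nu>). complex_of_real (?k p))"
    by simp
  also have "\<dots> = (LINT p|(\<nu> \<Otimes>\<^sub>M \<nu>). (LINT u|std_normal_distribution. iexp ((fst p - snd p) / r * u)))"
  proof (intro Bochner_Integration.integral_cong refl)
    fix p :: "real \<times> real"
    show "complex_of_real (?k p) = (LINT u|std_normal_distribution. iexp ((fst p - snd p) / r * u))"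
      using fun_cong[OF char_std_normal_distribution, of "(fst p - snd p) / r"] unfolding char_def by (rule sym)
  qed
  also have "\<dots> = (LINT u|std_normal_distribution. (LINT p|(\<nu> \<Otimes>\<^sub>M \<nu>). iexp ((fst p - snd p) / r * u)))"
  proof (rule Q.Fubini_integral[symmetric])
    have "integrable ((\<nu> \<Otimes>\<^sub>M \<nu>) \<Otimes>\<^sub>M std_normal_distribution)
        (\<lambda>w. iexp ((fst (fst w) - snd (fst w)) / r * snd w))"
      by (rule QQ.integrable_iexp) measurable
    then show "integrable ((\<nu> \<Otimes>\<^sub>M \<nu>) \<Otimes>\<^sub>M std_normal_distribution)
        (\<lambda>(p, u). iexp ((fst p - snd p) / r * u))"
      by (simp only: case_prod_beta')
  qed
  also have "\<dots> = (LINT u|std_normal_distribution. char \<nu> (u / r) * char \<nu> (- (u / r)))"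
  proof (intro Bochner_Integration.integral_cong refl)
    fix u
    have "(LINT p|(\<nu> \<Otimes>\<^sub>M \<nu>). iexp ((fst p - snd p) / r * u))
      = (LINT p|(\<nu> \<Otimes>\<^sub>M \<nu>). iexp (u / r * fst p) * iexp (- (u / r) * snd p))"
      by (intro Bochner_Integration.integral_cong refl) (simp add: exp_add[symmetric] field_simps diff_divide_distrib)
    also have "\<dots> = (LINT x|\<nu>. (LINT y|\<nu>. iexp (u / r * x) * iexp (- (u / r) * y)))"
    proof -
      have "integrable (\<nu> \<Otimes>\<^sub>M \<nu>) (\<lambda>p. iexp (u / r * fst p) * iexp (- (u / r) * snd p))"
        by (rule PP.integrable_const_bound[where B = 1]) (auto simp: norm_mult)
      from P.integral_fst'[OF this] show ?thesis by simp
    qed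
    also have "\<dots> = char \<nu> (u / r) * char \<nu> (- (u / r))" by (simp add: char_def)
    finally show "(LINT p|(\<nu> \<Otimes>\<^sub>M \<nu>). iexp ((fst p - snd p) / r * u)) = char \<nu> (u / r) * char \<nu> (- (u / r))" .
  qed
  finally have eq: "complex_of_real (LINT p|(\<nu> \<Otimes>\<^sub>M \<nu>). ?k p)
    = (LINT u|std_normal_distribution. char \<nu> (u / r) * char \<nu> (- (u / r)))" .
  have "(\<integral>\<^sup>+x. \<integral>\<^sup>+y. ennreal (exp (- ((x - y) / r)\<^sup>2 / 2)) \<partial>\<nu> \<partial>\<nu>) = (\<integral>\<^sup>+p. ennreal (?k p) \<partial>(\<nu> \<Otimes>\<^sub>M \<nu>))"
    by (subst fin.nn_integral_fst[symmetric]) auto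
  also have "\<dots> = ennreal (LINT p|(\<nu> \<Otimes>\<^sub>M \<nu>). ?k p)"
    by (rule nn_integral_eq_integral[OF kint]) simp
  also have "(LINT p|(\<nu> \<Otimes>\<^sub>M \<nu>). ?k p) = norm (complex_of_real (LINT p|(\<nu> \<Otimes>\<^sub>M \<nu>). ?k p))"
    by (simp add: integral_nonneg_AE)
  also have "\<dots> = norm (LINT u|std_normal_distribution. char \<nu> (u / r) * char \<nu> (- (u / r)))"
    unfolding eq ..
  \<comment> \<open>The Bochner integral of a non-integrable function is \<open>0\<close>, so the
    bound holds in that case too.\<close>
  also have "ennreal \<dots> \<le> (\<integral>\<^sup>+u. norm (char \<nu> (u / r) * char \<nu> (- (u / r))) \<partial>std_normal_distribution)"
    by (cases "integrable std_normal_distribution (\<lambda>u. char \<nu> (u / r) * char \<nu> (- (u / r)))")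
      (simp_all add: integral_norm_bound_ennreal not_integrable_integral_eq)
  also have "\<dots> \<le> (\<integral>\<^sup>+u. ennreal (C\<^sup>2 * r powr a) * ennreal (\<bar>u\<bar> powr (- a)) \<partial>std_normal_distribution)"
  proof (rule nn_integral_mono_AE)
    \<comment> \<open>\<open>decay\<close> says nothing at \<open>u = 0\<close>, which is a null set
      here.\<close>
    have "AE u in std_normal_distribution. u \<noteq> 0"
      by (subst AE_density) (auto intro: AE_mp[OF AE_lborel_singleton[of 0]])
    then show "AE u in std_normal_distribution. ennreal (norm (char \<nu> (u / r) * char \<nu> (- (u / r))))
      \<le> ennreal (C\<^sup>2 * r powr a) * ennreal (\<bar>u\<bar> powr (- a))"
    proof eventually_elim
      fix u :: real assume u: "u \<noteq> 0"
      have "norm (char \<nu> (u / r) * char \<nu> (- (u / r)))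
        \<le> (C * \<bar>u / r\<bar> powr (- a / 2)) * (C * \<bar>- (u / r)\<bar> powr (- a / 2))"
        unfolding norm_mult using u r C by (intro mult_mono decay) auto
      also have "\<dots> = C\<^sup>2 * (\<bar>u / r\<bar> powr (- a / 2) * \<bar>u / r\<bar> powr (- a / 2))"
        by (simp add: power2_eq_square)
      also have "\<bar>u / r\<bar> powr (- a / 2) * \<bar>u / r\<bar> powr (- a / 2) = r powr a * \<bar>u\<bar> powr (- a)"
        using r u by (simp add: powr_add[symmetric] powr_divide abs_divide powr_minus_divide)
      finally show "ennreal (norm (char \<nu> (u / r) * char \<nu> (- (u / r))))
        \<le> ennreal (C\<^sup>2 * r powr a) * ennreal (\<bar>u\<bar> powr (- a))"
        by (simp add: ennreal_mult[symmetric] mult.assoc ennreal_leI)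
    qed
  qed
  also have "\<dots> = ennreal (C\<^sup>2 * r powr a) * (\<integral>\<^sup>+ u. ennreal (\<bar>u\<bar> powr (- a)) \<partial>std_normal_distribution)"
    by (rule nn_integral_cmult) auto
  finally show ?thesis .
qed

text \<open>At scale \<open>2 ^ - n\<close> the Gaussian energy is of order
  \<open>2 powr (- n * a)\<close>, so for \<open>b < a\<close> the weighted sum \<open>H\<close> has
  finite integral. Where \<open>H\<close> is bounded, balls have mass of order
  \<open>2 powr (- n * b)\<close>, and the mass distribution principle applies.\<close>

lemma hausdorff_dim_ge_of_char_decay:
  fixes \<nu> :: "real measure"
  assumes fin: "finite_measure \<nu>" and sets: "sets \<nu> = sets borel" and C: "0 < C"
    and decay: "\<And>u. u \<noteq> 0 \<Longrightarrow> norm (char \<nu> u) \<le> C * \<bar>u\<bar> powr (- a / 2)" and a: "0 < a" "a < 1"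
    and E: "E \<in> sets borel" "emeasure \<nu> E \<noteq> 0"
  shows "ereal a \<le> hausdorff_dim E"
proof (rule hausdorff_dim_geI)
  fix b assume b: "0 < b" "b < a"
  interpret fin: finite_measure \<nu> by (rule fin)
  note [measurable_cong] = sets
  note [measurable] = E(1)
  define I where "I = (\<integral>\<^sup>+ u. ennreal (\<bar>u\<bar> powr (- a)) \<partial>std_normal_distribution)"
  have I: "I < \<infinity>" unfolding I_def using nn_integral_abs_powr_std_normal[OF a] .
  define k where "k n x y = ennreal (exp (- ((x - y) / (1/2) ^ n)\<^sup>2 / 2))" for n :: nat and x y :: real
  have [measurable]: "case_prod (k n) \<in> borel_measurable (\<nu> \<Otimes>\<^sub>M \<nu>)" for n
    unfolding k_def by measurable
  define q where "q n x = (\<integral>\<^sup>+y. k n x y \<partial>\<nu>)" for n x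
  have [measurable]: "q n \<in> borel_measurable \<nu>" for n
    unfolding q_def[abs_def] by (rule fin.borel_measurable_nn_integral) measurable
  define H where "H x = (\<Sum>n. ennreal (2 powr (n * b)) * q n x)" for x
  have [measurable]: "H \<in> borel_measurable \<nu>" unfolding H_def[abs_def] by measurable
  have "(\<integral>\<^sup>+x. H x \<partial>\<nu>) = (\<Sum>n. ennreal (2 powr (n * b)) * (\<integral>\<^sup>+x. q n x \<partial>\<nu>))"
    unfolding H_def by (simp add: nn_integral_suminf nn_integral_cmult)
  also have "\<dots> \<le> (\<Sum>n. ennreal (C\<^sup>2 * (2 powr (b - a)) ^ n) * I)"
  proof (intro suminf_le)
    fix n
    have "ennreal (2 powr (n * b)) * (\<integral>\<^sup>+x. q n x \<partial>\<nu>)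
        \<le> ennreal (2 powr (n * b)) * (ennreal (C\<^sup>2 * ((1/2) ^ n) powr a) * I)"
      unfolding q_def k_def I_def
      by (intro mult_left_mono gaussian_energy_le[OF fin sets C decay]) auto
    also have "\<dots> = ennreal (2 powr (n * b) * (C\<^sup>2 * ((1/2) ^ n) powr a)) * I"
      by (simp add: ennreal_mult mult.assoc)
    also have "2 powr (n * b) * (C\<^sup>2 * ((1/2) ^ n) powr a) = C\<^sup>2 * (2 powr (n * b) * 2 powr (- (n * a)))"
      unfolding half_power_powr by simp
    also have "2 powr (n * b) * 2 powr (- (n * a)) = (2 powr (b - a)) ^ n"
      by (simp add: powr_add[symmetric] powr_realpow[symmetric] powr_powr algebra_simps)
    finally show "ennreal (2 powr (n * b)) * (\<integral>\<^sup>+x. q n x \<partial>\<nu>) \<le> ennreal (C\<^sup>2 * (2 powr (b - a)) ^ n) * I" .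
  qed auto
  also have "\<dots> = (\<Sum>n. ennreal (C\<^sup>2 * (2 powr (b - a)) ^ n)) * I" by simp
  also have "\<dots> < \<infinity>"
  proof -
    have "summable (\<lambda>n. C\<^sup>2 * (2 powr (b - a)) ^ n)"
      using b by (intro summable_mult summable_geometric) (auto simp: powr_less_one)
    then have "(\<Sum>n. ennreal (C\<^sup>2 * (2 powr (b - a)) ^ n)) \<noteq> \<top>"
      by (intro ennreal_suminf_neq_top) auto
    then show ?thesis using I by (simp add: ennreal_mult_less_top less_top)
  qed
  finally have "(\<integral>\<^sup>+x. H x \<partial>\<nu>) \<noteq> \<infinity>" by simp
  then have AE: "AE x in \<nu>. H x \<noteq> \<infinity>" by (intro nn_integral_noteq_infinite) auto
  define G where "G m = {x \<in> E. H x \<le> of_nat m}" for m :: nat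
  have Gm: "G m \<in> sets \<nu>" for m
  proof -
    have "{x \<in> space \<nu>. x \<in> E \<and> H x \<le> of_nat m} \<in> sets \<nu>" by measurable
    then show ?thesis unfolding G_def using sets_eq_imp_space_eq[OF sets] by simp
  qed
  have "\<exists>m. emeasure \<nu> (G m) \<noteq> 0"
  proof (rule ccontr)
    assume "\<not> ?thesis"
    then have "(\<Union>m. G m) \<in> null_sets \<nu>" using Gm by (intro null_sets_UN) (auto simp: null_sets_def)
    then have "AE x in \<nu>. x \<notin> (\<Union>m. G m)" by (rule AE_not_in)
    with AE have "AE x in \<nu>. x \<notin> E"
    proof eventually_elim
      fix x assume "H x \<noteq> \<infinity>" "x \<notin> (\<Union>m. G m)"
      moreover from this(1) obtain m :: nat where "H x \<le> of_nat m"
        by (metis ennreal_Ex_less_of_nat infinity_ennreal_def less_imp_le less_top)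
      ultimately show "x \<notin> E" by (auto simp: G_def)
    qed
    then have "E \<in> null_sets \<nu>" using E(1) sets by (subst AE_iff_null_sets) auto
    with E(2) show False by auto
  qed
  then obtain m where m: "emeasure \<nu> (G m) \<noteq> 0" by blast
  have "hausdorff_measure b ((\<lambda>x. x) ` G m) \<noteq> 0"
  proof (rule mass_distribution[where C = "2 * m", OF Gm m b(1)])
    fix n and U :: "real set" assume U: "bounded U" "diameter U \<le> (1/2) ^ n"
    show "\<exists>W\<in>sets \<nu>. G m \<inter> (\<lambda>x. x) -` U \<subseteq> W \<and> emeasure \<nu> W \<le> ennreal (2 * m * 2 powr (- (n * b)))"
    proof (cases "G m \<inter> U = {}")
      case False
      then obtain u where u: "u \<in> G m" "u \<in> U" by blast
      \<comment> \<open>The ball is centred in \<open>G m\<close>, where the potential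
        \<open>H\<close> is under control.\<close>
      define W where "W = cball u ((1/2) ^ n)"
      have "U \<subseteq> W" using diameter_bounded_bound[OF U(1) u(2)] U(2) by (force simp: W_def)
      moreover have W: "W \<in> sets \<nu>" by (simp add: sets W_def)
      moreover have "emeasure \<nu> W \<le> ennreal (2 * m * 2 powr (- (n * b)))"
      proof -
        have "emeasure \<nu> W = (\<integral>\<^sup>+y. indicator W y \<partial>\<nu>)" using W by simp
        \<comment> \<open>On \<open>W\<close> the kernel is at least \<open>exp (- 1/2)\<close>,
          which is at least \<open>1/2\<close>.\<close>
        also have "\<dots> \<le> (\<integral>\<^sup>+y. 2 * k n u y \<partial>\<nu>)"
        proof (rule nn_integral_mono)
          fix y
          show "indicator W y \<le> 2 * k n u y"
          proof (cases "y \<in> W")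
            case True
            then have "\<bar>(u - y) / (1/2) ^ n\<bar> \<le> 1" by (simp add: W_def dist_real_def abs_divide)
            then have "((u - y) / (1/2) ^ n)\<^sup>2 \<le> 1" by (simp add: abs_square_le_1)
            then have "1 + (- 1 / 2) \<le> exp (- ((u - y) / (1/2) ^ n)\<^sup>2 / 2)"
              by (intro order_trans[OF _ exp_ge_add_one_self]) simp
            then have "1 \<le> 2 * exp (- ((u - y) / (1/2) ^ n)\<^sup>2 / 2)" by simp
            then have "ennreal 1 \<le> ennreal (2 * exp (- ((u - y) / (1/2) ^ n)\<^sup>2 / 2))" by (rule ennreal_leI)
            with True show ?thesis by (simp add: k_def ennreal_mult)
          qed simp
        qed
        also have "\<dots> = 2 * q n u"
          unfolding q_def by (intro nn_integral_cmult) (simp add: k_def)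
        also have "q n u = ennreal (2 powr (- (n * b))) * (ennreal (2 powr (n * b)) * q n u)"
          by (simp add: mult.assoc[symmetric] ennreal_mult[symmetric] powr_add[symmetric])
        also have "ennreal (2 powr (n * b)) * q n u \<le> H u"
          unfolding H_def using sum_le_suminf[of "\<lambda>n. ennreal (2 powr (n * b)) * q n u" "{n}"] by simp
        also have "H u \<le> of_nat m" using u(1) by (simp add: G_def)
        also have "2 * (ennreal (2 powr (- (n * b))) * of_nat m) = ennreal (2 * m * 2 powr (- (n * b)))"
          by (simp add: ennreal_mult ennreal_of_nat_eq_real_of_nat mult_ac)
        finally show ?thesis by (simp add: mult_left_mono)
      qed
      ultimately show ?thesis by blast
    qed (auto intro!: bexI[of _ "{}"])
  qed
  then show "hausdorff_measure b E \<noteq> 0"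
    using hausdorff_measure_mono[of "G m" E b] by (auto simp: G_def)
qed

text \<open>The complement is a union of open null sets, which Lindelof's theorem reduces to a
  countable one.\<close>

lemma null_Compl_topological_support:
  fixes \<mu> :: "'a::euclidean_space measure"
  assumes sets: "sets \<mu> = sets borel"
  shows "emeasure \<mu> (- topological_support \<mu>) = 0"
proof -
  obtain F where F: "F \<subseteq> {U. open U \<and> emeasure \<mu> U = 0}" "countable F"
    "\<Union>F = \<Union>{U. open U \<and> emeasure \<mu> U = 0}"
    using Lindelof[of "{U. open U \<and> emeasure \<mu> U = 0}"] by blast
  have "(\<Union>U\<in>F. U) \<in> null_sets \<mu>"
    using F by (intro null_sets_UN') (auto simp: null_sets_def sets)
  moreover have "(\<Union>U\<in>F. U) = - topological_support \<mu>"
    using F(3) by (auto simp: topological_support_def)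
  ultimately show ?thesis by auto
qed

lemma finite_measure_compactly_supported:
  assumes \<mu>: "\<mu> \<in> compactly_supported_measures X"
  shows "finite_measure \<mu>"
proof -
  from \<mu> have sets: "sets \<mu> = sets borel" and S: "compact (topological_support \<mu>)"
    "topological_support \<mu> \<subseteq> X" "emeasure \<mu> X \<noteq> 0" "emeasure \<mu> X < \<infinity>"
    by (auto simp: compactly_supported_measures_def)
  have X: "X \<in> sets \<mu>" using S(3) emeasure_notin_sets by blast
  have Ssets: "topological_support \<mu> \<in> sets \<mu>" "- topological_support \<mu> \<in> sets \<mu>"
    using borel_compact[OF S(1)] by (simp_all add: sets borel_comp)
  have "emeasure \<mu> UNIV = emeasure \<mu> (topological_support \<mu> \<union> - topological_support \<mu>)" by simp
  also have "\<dots> \<le> emeasure \<mu> (topological_support \<mu>) + emeasure \<mu> (- topological_support \<mu>)"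
    using Ssets by (intro emeasure_subadditive)
  also have "\<dots> \<le> emeasure \<mu> X + 0"
    using emeasure_mono[OF S(2) X] null_Compl_topological_support[OF sets] by simp
  also have "\<dots> < \<infinity>" using S by simp
  finally show ?thesis
    using sets_eq_imp_space_eq[OF sets] by (intro finite_measureI) auto
qed

lemma line_direction:
  obtains v where "norm v = 1" "subspace_of V = span {v}" "\<And>x. proj V x = (x \<bullet> v) *\<^sub>R v"
proof -
  have V: "subspace (subspace_of V)" "dim (subspace_of V) = 1" using subspace_of[of V] by auto
  obtain B where B: "B \<subseteq> subspace_of V" "pairwise orthogonal B" "\<forall>x\<in>B. norm x = 1"
     "independent B" "card B = dim (subspace_of V)" "span B = subspace_of V"
    by (rule orthonormal_basis_subspace[OF V(1)]) blast
  then obtain v where v: "B = {v}" using V(2) by (auto simp: card_1_singleton_iff)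
  have sp: "subspace_of V = span {v}" using B(6) unfolding v by (rule sym)
  have nv: "norm v = 1" using B(3) unfolding v by simp
  have "proj V x = (x \<bullet> v) *\<^sub>R v" for x
  proof (rule orth_proj_unique[OF V(1)])
    show "(x \<bullet> v) *\<^sub>R v \<in> subspace_of V" unfolding sp by (intro span_mul span_base) simp
    fix w assume "w \<in> subspace_of V"
    then obtain c where "w = c *\<^sub>R v" unfolding sp span_singleton by blast
    moreover have "v \<bullet> v = 1" using nv by (simp add: dot_square_norm)
    ultimately show "orthogonal (x - (x \<bullet> v) *\<^sub>R v) w"
      by (simp add: orthogonal_def inner_diff_left)
  qed
  with sp nv show thesis by (intro that[of v])
qed

text \<open>The characteristic function of the projected measure is the transform of \<mu> along the
  line. The exponent in \<open>char\<close> lacks the factor \<open>- 2 * pi\<close>; hence the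
  rescaled frequency and the constant \<open>(2 * pi) powr (a / 2)\<close>.\<close>

lemma hausdorff_dim_proj_ge:
  fixes X :: "(real^2) set"
  assumes X: "compact X" and \<mu>: "\<mu> \<in> compactly_supported_measures X" and a: "0 < a" "a < 1"
    and C: "0 < C" and decay: "\<And>z. z \<noteq> 0 \<Longrightarrow> cmod (fourier_transform \<mu> z) \<le> C * norm z powr (- a / 2)"
  shows "ereal a \<le> hausdorff_dim (proj V ` X)"
proof -
  obtain v where v: "norm v = 1" "\<And>x. proj V x = (x \<bullet> v) *\<^sub>R v" using line_direction[of V] by metis
  interpret finite_measure \<mu> using \<mu> by (rule finite_measure_compactly_supported)
  have sets: "sets \<mu> = sets borel" and pos: "emeasure \<mu> X \<noteq> 0"
    using \<mu> by (auto simp: compactly_supported_measures_def)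
  note [measurable_cong] = sets
  define f where "f x = x \<bullet> v" for x :: "real^2"
  have f[measurable]: "f \<in> borel_measurable \<mu>" unfolding f_def by measurable
  define \<nu> where "\<nu> = distr \<mu> borel f"
  have fX: "compact (f ` X)" unfolding f_def by (intro compact_continuous_image X continuous_intros)
  have "ereal a \<le> hausdorff_dim (f ` X)"
  proof (rule hausdorff_dim_ge_of_char_decay)
    show "finite_measure \<nu>" unfolding \<nu>_def by (rule finite_measure_distr) (rule f)
    show "sets \<nu> = sets borel" by (simp add: \<nu>_def)
    show "0 < C * (2 * pi) powr (a / 2)" using C by simp
    show "f ` X \<in> sets borel" using fX by (rule borel_compact)
    have "emeasure \<nu> (f ` X) = emeasure \<mu> (f -` (f ` X) \<inter> space \<mu>)"
      unfolding \<nu>_def using fX by (intro emeasure_distr f) (simp add: borel_compact)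
    moreover have "emeasure \<mu> X \<le> emeasure \<mu> (f -` (f ` X) \<inter> space \<mu>)"
      using fX sets_eq_imp_space_eq[OF sets]
      by (intro emeasure_mono measurable_sets[OF f]) (auto simp: borel_compact)
    ultimately show "emeasure \<nu> (f ` X) \<noteq> 0" using pos by auto
    fix u :: real assume u: "u \<noteq> 0"
    have "char \<nu> u = (LINT x|\<mu>. iexp (u * f x))"
      unfolding char_def \<nu>_def by (intro integral_distr f) measurable
    also have "\<dots> = fourier_transform \<mu> ((- u / (2 * pi)) *\<^sub>R v)"
      unfolding fourier_transform_def
      by (intro Bochner_Integration.integral_cong refl) (simp add: f_def inner_commute)
    also have "cmod \<dots> \<le> C * norm ((- u / (2 * pi)) *\<^sub>R v) powr (- a / 2)"
      using u v by (intro decay) auto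
    also have "norm ((- u / (2 * pi)) *\<^sub>R v) = \<bar>u\<bar> / (2 * pi)" using v by simp
    also have "(\<bar>u\<bar> / (2 * pi)) powr (- a / 2) = (2 * pi) powr (a / 2) * \<bar>u\<bar> powr (- a / 2)"
      using u by (simp add: powr_divide powr_minus_divide)
    finally show "cmod (char \<nu> u) \<le> C * (2 * pi) powr (a / 2) * \<bar>u\<bar> powr (- a / 2)" by simp
  qed (rule a)+
  \<comment> \<open>The linear form factors through the projection and is Lipschitz, so the bound
    passes to the projected set.\<close>
  also have "f ` X = f ` (proj V ` X)"
  proof -
    have "f (proj V x) = f x" for x using v by (simp add: f_def dot_square_norm)
    then show ?thesis by (simp add: image_image)
  qed
  also have "hausdorff_dim (f ` (proj V ` X)) \<le> hausdorff_dim (proj V ` X)"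
  proof (rule hausdorff_dim_Lipschitz_image[where C = 1])
    fix x y
    have "\<bar>(x - y) \<bullet> v\<bar> \<le> norm (x - y) * norm v" by (rule Cauchy_Schwarz_ineq2)
    then show "dist (f x) (f y) \<le> 1 * dist x y"
      by (simp add: f_def dist_norm inner_diff_left v)
  qed
  finally show ?thesis .
qed

text \<open>
  A decay exponent beyond \<open>1\<close> is first lowered below \<open>1\<close>, where the energy integral converges.
\<close>

lemma fourier_dim_le_hausdorff_dim_proj:
  fixes X :: "(real^2) set"
  assumes X: "compact X" and a: "0 < a" "a < 1" "ereal a < fourier_dim X"
  shows "ereal a \<le> hausdorff_dim (proj V ` X)"
proof -
  from a(3) obtain \<mu> where \<mu>: "\<mu> \<in> compactly_supported_measures X" "ereal a < fourier_dim_measure \<mu>"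
    unfolding fourier_dim_def less_Sup_iff using a(1) by fastforce
  from \<mu>(2) obtain s C where s: "a < s" "0 < C"
    "\<And>z. z \<noteq> 0 \<Longrightarrow> cmod (fourier_transform \<mu> z) \<le> C * norm z powr (- s / 2)"
    unfolding fourier_dim_measure_def less_Sup_iff by auto
  interpret finite_measure \<mu> using \<mu>(1) by (rule finite_measure_compactly_supported)
  \<comment> \<open>For \<open>norm z < 1\<close> the larger exponent \<open>s\<close> gives the
    weaker bound, so the total mass is used there instead.\<close>
  define D where "D = max C (measure \<mu> (space \<mu>))"
  have D: "0 < D" "C \<le> D" "measure \<mu> (space \<mu>) \<le> D" using s by (auto simp: D_def)
  have "cmod (fourier_transform \<mu> z) \<le> D * norm z powr (- a / 2)" if z: "z \<noteq> 0" for z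
  proof (cases "1 \<le> norm z")
    case True
    have "cmod (fourier_transform \<mu> z) \<le> C * norm z powr (- s / 2)" by (rule s(3)[OF z])
    also have "\<dots> \<le> D * norm z powr (- a / 2)"
      using True D s by (intro mult_mono powr_mono) auto
    finally show ?thesis .
  next
    case False
    have "cmod (fourier_transform \<mu> z)
        \<le> (LINT x|\<mu>. norm (exp (- 2 * of_real pi * \<i> * of_real (z \<bullet> x))))"
      unfolding fourier_transform_def by (rule integral_norm_bound)
    also have "\<dots> = measure \<mu> (space \<mu>)" by (simp add: norm_exp_eq_Re)
    also have "\<dots> \<le> D * 1" using D by simp
    also have "\<dots> \<le> D * norm z powr (- a / 2)"
    proof (intro mult_left_mono)
      have "norm z powr 0 \<le> norm z powr (- a / 2)" using False a by (intro powr_mono') auto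
      then show "1 \<le> norm z powr (- a / 2)" using z by simp
    qed (use D in simp)
    finally show ?thesis .
  qed
  then show ?thesis by (rule hausdorff_dim_proj_ge[OF X \<mu>(1) a(1,2) D(1)])
qed

section \<open>Digit sets\<close>

text \<open>
  Points of the unit square whose first (second) coordinate has arbitrary binary digits at the
  positions in \<open>S\<close> (in \<open>T\<close>), position \<open>k\<close> having weight \<open>2 ^ - Suc k\<close>, and zeros elsewhere.
\<close>

locale digit_tree =
  fixes S T :: "nat set"
begin

definition count :: "nat \<Rightarrow> nat" where
  "count k = card (S \<inter> {..<k}) + card (T \<inter> {..<k})"

primrec node1 :: "nat \<Rightarrow> nat \<Rightarrow> nat" where
  "node1 0 j = 0"
| "node1 (Suc k) j = 2 * node1 k (j div 2 ^ (count (Suc k) - count k)) + (if k \<in> S then j mod 2 else 0)"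

text \<open>When both coordinates receive a digit at level \<open>k\<close>, the lowest bit of
  \<open>j\<close> goes to the first and the next bit to the second; hence the extra
  \<open>div 2\<close>.\<close>

primrec node2 :: "nat \<Rightarrow> nat \<Rightarrow> nat" where
  "node2 0 j = 0"
| "node2 (Suc k) j = 2 * node2 k (j div 2 ^ (count (Suc k) - count k)) +
    (if k \<in> T then (if k \<in> S then j div 2 else j) mod 2 else 0)"

definition node :: "nat \<Rightarrow> nat \<Rightarrow> real^2" where
  "node k j = vector [node1 k j / 2 ^ k, node2 k j / 2 ^ k]"

lemma card_Int_Suc: "card (A \<inter> {..<Suc k}) = card (A \<inter> {..<k}) + (if k \<in> A then 1 else 0)"
  by (simp add: lessThan_Suc)

lemma count_Suc: "count (Suc k) = count k + ((if k \<in> S then 1 else 0) + (if k \<in> T then 1 else 0))"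
  by (simp add: count_def card_Int_Suc)

sublocale dyadic_tree count node
proof
  fix k j
  show "count k \<le> count (Suc k)" by (simp add: count_Suc)
  let ?w = "node (Suc k) j - node k (j div 2 ^ (count (Suc k) - count k))"
  have b: "\<bar>real (2 * m + e) / 2 ^ Suc k - real m / 2 ^ k\<bar> \<le> 1 / 2 ^ Suc k" if "e \<le> 1" for m e :: nat
  proof -
    have "real (2 * m + e) / 2 ^ Suc k - real m / 2 ^ k = real e / 2 ^ Suc k" by (simp add: field_simps)
    then show ?thesis using that by (simp add: divide_right_mono)
  qed
  have "norm ?w \<le> \<bar>?w $ 1\<bar> + \<bar>?w $ 2\<bar>" using norm_le_l1_cart[of ?w] by (simp add: sum_2)
  also have "\<dots> \<le> 1 / 2 ^ Suc k + 1 / 2 ^ Suc k"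
    unfolding node_def vector_minus_component vector_2 node1.simps node2.simps
    by (intro add_mono b) auto
  also have "\<dots> = (1/2) ^ k" by (simp add: power_one_over)
  finally show "norm ?w \<le> (1/2) ^ k" .
qed

text \<open>A numerator determines its last digit and the numerator of its parent. The parents agree
  by induction, and so do the freshly appended bits.\<close>

lemma inj_on_node_pair: "inj_on (\<lambda>j. (node1 k j, node2 k j)) {..<2 ^ count k}"
proof (induction k)
  case 0
  then show ?case by (simp add: count_def inj_on_def)
next
  case (Suc k)
  define d where "d = count (Suc k) - count k"
  have cS: "count (Suc k) = count k + d" using c_Suc[of k] by (simp add: d_def)
  have d: "d = (if k \<in> S then 1 else 0) + (if k \<in> T then 1 else 0)" by (simp add: d_def count_Suc)
  show ?case
  proof (rule inj_onI)
    fix i j assume ij: "i \<in> {..<2 ^ count (Suc k)}" "j \<in> {..<2 ^ count (Suc k)}"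
      and eq: "(node1 (Suc k) i, node2 (Suc k) i) = (node1 (Suc k) j, node2 (Suc k) j)"
    have split: "a = a' \<and> e = e'" if "2 * a + e = 2 * a' + e'" "e \<le> 1" "e' \<le> 1" for a e a' e' :: nat
      using that by presburger
    have m2: "m mod 2 \<le> Suc 0" for m :: nat by presburger
    have n1: "node1 k (i div 2 ^ d) = node1 k (j div 2 ^ d) \<and> (if k \<in> S then i mod 2 else 0) = (if k \<in> S then j mod 2 else 0)"
      using eq unfolding prod.inject node1.simps d_def[symmetric] by (intro split) (auto simp: m2)
    have n2: "node2 k (i div 2 ^ d) = node2 k (j div 2 ^ d) \<and>
        (if k \<in> T then (if k \<in> S then i div 2 else i) mod 2 else 0) = (if k \<in> T then (if k \<in> S then j div 2 else j) mod 2 else 0)"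
      using eq unfolding prod.inject node2.simps d_def[symmetric] by (intro split) (auto simp: m2)
    have "i div 2 ^ d < 2 ^ count k" "j div 2 ^ d < 2 ^ count k"
      using ij unfolding cS power_add lessThan_iff by (simp_all only: less_mult_imp_div_less)
    then have p: "i div 2 ^ d = j div 2 ^ d"
      using inj_onD[OF Suc.IH, of "i div 2 ^ d" "j div 2 ^ d"] n1 n2 by blast
    have "i mod 2 ^ d = j mod 2 ^ d"
    proof -
      have m4: "m mod 4 = 2 * (m div 2 mod 2) + m mod 2" for m :: nat
        using mod_mult2_eq[of m 2 2] by simp
      have "(if k \<in> S then i mod 2 else 0) = (if k \<in> S then j mod 2 else 0)"
        "(if k \<in> T then (if k \<in> S then i div 2 else i) mod 2 else 0) = (if k \<in> T then (if k \<in> S then j div 2 else j) mod 2 else 0)"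
        using n1 n2 by blast+
      then show ?thesis unfolding d by (cases "k \<in> S"; cases "k \<in> T") (simp_all add: m4)
    qed
    with p show "i = j" by (metis div_mult_mod_eq)
  qed
qed

lemma inj_on_node: "inj_on (node k) {..<2 ^ count k}"
proof (rule inj_onI)
  fix i j assume ij: "i \<in> {..<2 ^ count k}" "j \<in> {..<2 ^ count k}" "node k i = node k j"
  then have "node k i $ 1 = node k j $ 1" "node k i $ 2 = node k j $ 2" by auto
  then have "(node1 k i, node2 k i) = (node1 k j, node2 k j)" by (simp add: node_def)
  with ij show "i = j" using inj_onD[OF inj_on_node_pair] by blast
qed

lemma hausdorff_dim_digits_ge:
  fixes s :: real
  assumes "\<And>b. 0 < b \<Longrightarrow> b < s \<Longrightarrow> \<exists>B. \<forall>k. b * real k \<le> real (count k) + B"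
  shows "ereal s \<le> hausdorff_dim limit_set"
proof (rule hausdorff_dim_limit_set_ge[OF inj_on_node _ assms])
  fix k j
  have "node k j = vector [real_of_int (int (node1 k j)) / 2 ^ k, real_of_int (int (node2 k j)) / 2 ^ k]"
    by (simp add: node_def)
  then show "\<exists>a b :: int. node k j = vector [real_of_int a / 2 ^ k, real_of_int b / 2 ^ k]" by blast
qed

section \<open>Gaps in the digit positions and coarse grids\<close>

lemma node1_less: "node1 k j < 2 ^ k"
proof (induction k arbitrary: j)
  case (Suc k)
  have "node1 k (j div 2 ^ (count (Suc k) - count k)) < 2 ^ k" by (rule Suc)
  moreover have "(if k \<in> S then j mod 2 else 0) \<le> 1" by auto
  ultimately show ?case unfolding node1.simps power_Suc by linarith
qed simp

lemma node2_less: "node2 k j < 2 ^ k"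
proof (induction k arbitrary: j)
  case (Suc k)
  have "node2 k (j div 2 ^ (count (Suc k) - count k)) < 2 ^ k" by (rule Suc)
  moreover have "(if k \<in> T then (if k \<in> S then j div 2 else j) mod 2 else 0) \<le> 1" by auto
  ultimately show ?case unfolding node2.simps power_Suc by linarith
qed simp

text \<open>Positions without digits append binary zeros, that is, factors of
  \<open>2\<close>.\<close>

lemma node1_dvd: "S \<inter> {p..<p + m} = {} \<Longrightarrow> 2 ^ m dvd node1 (p + m) j"
proof (induction m arbitrary: j)
  case (Suc m)
  have "S \<inter> {p..<p + m} = {}" "p + m \<notin> S" using Suc.prems by auto
  with Suc.IH show ?case by simp
qed simp

lemma node2_dvd: "T \<inter> {p..<p + m} = {} \<Longrightarrow> 2 ^ m dvd node2 (p + m) j"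
proof (induction m arbitrary: j)
  case (Suc m)
  have "T \<inter> {p..<p + m} = {}" "p + m \<notin> T" using Suc.prems by auto
  with Suc.IH show ?case by simp
qed simp

lemma grid_point:
  assumes "2 ^ m dvd n" "n < 2 ^ (p + m)"
  obtains i where "real n / 2 ^ (p + m) = real i / 2 ^ p" "i < 2 ^ p"
proof -
  obtain i where i: "n = 2 ^ m * i" using assms(1) by (rule dvdE)
  have "real n / 2 ^ (p + m) = real i / 2 ^ p" by (simp add: i power_add)
  moreover have "i < 2 ^ p" using assms(2) by (simp add: i power_add mult.commute)
  ultimately show thesis by (rule that)
qed

lemma limit_set_node:
  assumes "q \<in> limit_set"
  obtains j where "\<bar>q $ 1 - node1 k j / 2 ^ k\<bar> \<le> 2 * (1/2) ^ k" "\<bar>q $ 2 - node2 k j / 2 ^ k\<bar> \<le> 2 * (1/2) ^ k"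
proof -
  obtain j where "dist (node k j) q \<le> 2 * (1/2) ^ k" using assms limit_set_subset_cballs[of k] by auto
  then have "norm (q - node k j) \<le> 2 * (1/2) ^ k" by (simp add: dist_norm norm_minus_commute)
  then have "\<bar>(q - node k j) $ i\<bar> \<le> 2 * (1/2) ^ k" for i
    using component_le_norm_cart[of "q - node k j" i] by linarith
  from this[of 1] this[of 2] show thesis by (intro that[of j]) (simp_all add: node_def)
qed

text \<open>A gap from \<open>p\<close> to \<open>L\<close> puts the coordinate near a grid of mesh
  only \<open>2 ^ - p\<close>, with the much smaller error of level \<open>L\<close>.\<close>

lemma limit_set_near_grid1:
  assumes "q \<in> limit_set" "S \<inter> {p..<L} = {}" "p \<le> L"
  obtains i where "i < 2 ^ p" "\<bar>q $ 1 - real i / 2 ^ p\<bar> \<le> 2 * (1/2) ^ L"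
proof -
  obtain m where L: "L = p + m" using assms(3) le_Suc_ex by blast
  obtain j where j: "\<bar>q $ 1 - node1 L j / 2 ^ L\<bar> \<le> 2 * (1/2) ^ L" using limit_set_node[OF assms(1)] by blast
  obtain i where "real (node1 L j) / 2 ^ L = real i / 2 ^ p" "i < 2 ^ p"
    unfolding L using grid_point[OF node1_dvd node1_less] assms(2) unfolding L by blast
  with j show thesis by (intro that[of i]) auto
qed

lemma limit_set_near_grid2:
  assumes "q \<in> limit_set" "T \<inter> {p..<L} = {}" "p \<le> L"
  obtains i where "i < 2 ^ p" "\<bar>q $ 2 - real i / 2 ^ p\<bar> \<le> 2 * (1/2) ^ L"
proof -
  obtain m where L: "L = p + m" using assms(3) le_Suc_ex by blast
  obtain j where j: "\<bar>q $ 2 - node2 L j / 2 ^ L\<bar> \<le> 2 * (1/2) ^ L" using limit_set_node[OF assms(1)] by blast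
  obtain i where "real (node2 L j) / 2 ^ L = real i / 2 ^ p" "i < 2 ^ p"
    unfolding L using grid_point[OF node2_dvd node2_less] assms(2) unfolding L by blast
  with j show thesis by (intro that[of i]) auto
qed

lemma limit_set_second_zero:
  assumes "T = {}" "q \<in> limit_set"
  shows "q $ 2 = 0"
proof (rule ccontr)
  assume "q $ 2 \<noteq> 0"
  then have "0 < \<bar>q $ 2\<bar> / 2" by simp
  then obtain L where L: "(1/2) ^ L < \<bar>q $ 2\<bar> / 2" using real_arch_pow_inv[of "\<bar>q $ 2\<bar> / 2" "1/2"] by auto
  \<comment> \<open>Without any positions the gap starts at \<open>0\<close>, where the grid is the
    single point \<open>0\<close>.\<close>
  obtain i :: nat where "i < 2 ^ 0" "\<bar>q $ 2 - real i / 2 ^ 0\<bar> \<le> 2 * (1/2) ^ L"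
    by (rule limit_set_near_grid2[OF assms(2), of 0 L]) (use assms in auto)
  with L show False by simp
qed

lemma limit_set_bounded: "q \<in> limit_set \<Longrightarrow> \<bar>q $ 1\<bar> \<le> 2"
  using limit_set_node[of q 0] by auto

end

section \<open>Sparse digit positions\<close>

text \<open>
  In each block \<open>{fact k..<fact (Suc k)}\<close> the positions below \<open>p (Suc k)\<close> are free. As the blocks
  grow superexponentially, a cut-off \<open>p k\<close> near \<open>a * fact k\<close> leaves lower density \<open>a\<close>.
\<close>

definition free_digits :: "(nat \<Rightarrow> nat) \<Rightarrow> nat set" where
  "free_digits p = {n. \<exists>k. fact k \<le> n \<and> n < p (Suc k)}"

text \<open>Earlier free stretches end by \<open>fact k\<close> and later ones start at or after
  \<open>fact (Suc k)\<close>, so only that of block \<open>k\<close> matters.\<close>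

lemma free_digits_gap:
  assumes le: "\<And>k. p k \<le> fact k" and k: "fact k \<le> p (Suc k)"
  shows "free_digits p \<inter> {p (Suc k)..<fact (Suc k)} = {}"
proof -
  have False if n: "n \<in> free_digits p" "p (Suc k) \<le> n" "n < fact (Suc k)" for n
  proof -
    from n(1) obtain i where i: "fact i \<le> n" "n < p (Suc i)" by (auto simp: free_digits_def)
    consider "i < k" | "i = k" | "Suc k \<le> i" by linarith
    then show False
    proof cases
      case 1
      then have "p (Suc i) \<le> (fact k :: nat)" by (intro order_trans[OF le fact_mono]) simp
      with i k n show False by linarith
    next
      case 3
      then have "(fact (Suc k) :: nat) \<le> fact i" by (rule fact_mono)
      with i n show False by linarith
    qed (use i n in auto)
  qed
  then show ?thesis by auto
qed

lemma free_digits_count_le: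
  assumes le: "\<And>k. p k \<le> fact k" and k: "fact k \<le> p (Suc k)"
  shows "card (free_digits p \<inter> {..<fact (Suc k)}) \<le> p (Suc k)"
proof -
  have "free_digits p \<inter> {..<fact (Suc k)} \<subseteq> {..<p (Suc k)}"
    using free_digits_gap[OF assms] by force
  from card_mono[OF _ this] show ?thesis by simp
qed

lemma eventually_fact_le_cutoff:
  fixes a :: real
  assumes a: "0 < a" and p: "\<And>k. a * fact k - 2 \<le> real (p k)"
  shows "\<forall>\<^sub>F k in sequentially. fact k \<le> p (Suc k)"
proof -
  \<comment> \<open>Once \<open>a * (k + 1)\<close> reaches \<open>3\<close>, the cut-off is at
    least \<open>3 * fact k - 2\<close>, hence at least \<open>fact k\<close>.\<close>
  obtain K :: nat where K: "3 / a \<le> K" using real_arch_simple by blast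
  have "fact k \<le> p (Suc k)" if k: "k \<ge> K" for k
  proof -
    have "3 \<le> a * real K" using K a by (simp add: field_simps)
    also have "\<dots> \<le> a * real (Suc k)" using k a by (intro mult_left_mono) auto
    finally have "3 \<le> a * real (Suc k)" .
    then have "3 * fact k \<le> a * real (Suc k) * fact k" by (intro mult_right_mono) auto
    moreover have "a * real (Suc k) * fact k = a * fact (Suc k)" by simp
    ultimately have "3 * fact k - 2 \<le> real (p (Suc k))" using p[of "Suc k"] by linarith
    moreover have "(1::real) \<le> fact k" by (rule fact_ge_1)
    ultimately have "real (fact k) \<le> real (p (Suc k))" unfolding of_nat_fact by linarith
    then show ?thesis by (simp only: of_nat_le_iff)
  qed
  then show ?thesis by (auto simp: eventually_sequentially)
qed

text \<open>The proportion is worst at the ends of the gaps, where it is near \<open>a\<close>; in a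
  free stretch digits accrue at rate \<open>1\<close>. Discarding what precedes a block costs a
  fraction of order \<open>1 / k\<close> of the next factorial, which \<open>a - b\<close>
  absorbs.\<close>

lemma free_digits_density:
  fixes a b :: real
  assumes a: "0 < a" "a < 1" and p: "\<And>k. a * fact k - 2 \<le> real (p k)" "\<And>k. p k \<le> fact k" and b: "b < a"
  shows "\<exists>B. \<forall>n. b * real n \<le> real (card (free_digits p \<inter> {..<n})) + B"
proof -
  obtain K1 where K1: "\<And>k. k \<ge> K1 \<Longrightarrow> fact k \<le> p (Suc k)"
    using eventually_fact_le_cutoff[OF a(1) p(1)] by (auto simp: eventually_sequentially)
  \<comment> \<open>Once \<open>k + 1\<close> reaches \<open>K2\<close>, \<open>fact k\<close> is at
    most \<open>a * (a - b) * fact (Suc k)\<close>.\<close>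
  obtain K2 :: nat where K2: "1 / (a * (a - b)) \<le> K2" using real_arch_simple by blast
  define K where "K = Suc (K1 + K2)"
  have main: "b * real n \<le> real (card (free_digits p \<inter> {..<n})) + 4" if n: "fact K \<le> n" for n
  proof -
    define j where "j = (LEAST j. n < fact j)"
    have "n < fact (Suc n)" using fact_ge_self[of "Suc n"] by linarith
    then have j1: "n < fact j" unfolding j_def by (rule LeastI)
    have j2: "\<not> n < fact i" if "i < j" for i using that unfolding j_def by (rule not_less_Least)
    have "K < j" using n j1 fact_mono[of j K] by (metis leD leI order_trans)
    then obtain k where k: "j = Suc (Suc k)" "K \<le> Suc k" by (metis K_def Suc_le_D Suc_lessE less_Suc_eq_le)
    define M :: nat where "M = fact (Suc k)"
    have nM: "M \<le> n" "n < fact (Suc (Suc k))" using j1 j2[of "Suc k"] k by (auto simp: M_def simp del: fact_Suc)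
    have Kk: "1 / (a * (a - b)) \<le> real (Suc k)" using K2 k by (simp add: K_def)
    have K1k: "k \<ge> K1" using k by (simp add: K_def)
    have ab: "0 < a * (a - b)" using a b by simp
    have Kk': "1 \<le> (a * (a - b)) * real (Suc k)" using Kk ab by (simp add: field_simps)
    have fk: "real (Suc k) * fact k = M" unfolding M_def by (simp add: algebra_simps)
    have pk: "a * M - 2 \<le> real (p (Suc k))" using p(1)[of "Suc k"] unfolding M_def of_nat_fact .
    show ?thesis
    \<comment> \<open>Up to the cut-off, the free stretch of the previous block and all positions
      since \<open>M\<close> are counted; beyond it, the free stretch of the current block
      suffices.\<close>
    proof (cases "n \<le> p (Suc (Suc k))")
      case True
      have "{fact k..<p (Suc k)} \<union> {M..<n} \<subseteq> free_digits p \<inter> {..<n}"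
        using True nM p(2)[of "Suc k"] unfolding free_digits_def M_def by (auto simp del: fact_Suc)
      then have "card ({fact k..<p (Suc k)} \<union> {M..<n}) \<le> card (free_digits p \<inter> {..<n})"
        by (intro card_mono) auto
      moreover have "card ({fact k..<p (Suc k)} \<union> {M..<n}) = (p (Suc k) - fact k) + (n - M)"
        using p(2)[of "Suc k"] unfolding M_def by (subst card_Un_disjoint) (auto simp del: fact_Suc)
      ultimately have "real ((p (Suc k) - fact k) + (n - M)) \<le> real (card (free_digits p \<inter> {..<n}))"
        by (simp only: of_nat_le_iff)
      then have c: "real (p (Suc k)) - fact k + (real n - real M) \<le> real (card (free_digits p \<inter> {..<n}))"
        unfolding of_nat_add of_nat_diff[OF K1[OF K1k]] of_nat_diff[OF nM(1)] of_nat_fact .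
      have "fact k \<le> (a - b) * real n"
      proof -
        have "1 * fact k \<le> (a * (a - b)) * real (Suc k) * fact k" using Kk' by (intro mult_right_mono) auto
        also have "\<dots> = (a * (a - b)) * M" using fk by (simp add: mult.assoc)
        also have "\<dots> \<le> (1 * (a - b)) * n" using a b nM by (intro mult_mono mult_right_mono) auto
        finally show ?thesis by simp
      qed
      moreover have "(1 - a) * M \<le> (1 - a) * n" using a nM by (intro mult_left_mono) auto
      ultimately show ?thesis using c pk nM by (simp add: algebra_simps of_nat_diff)
    next
      case False
      have "{M..<p (Suc (Suc k))} \<subseteq> free_digits p \<inter> {..<n}"
        using False unfolding free_digits_def M_def by (auto simp del: fact_Suc)
      then have "card {M..<p (Suc (Suc k))} \<le> card (free_digits p \<inter> {..<n})"
        by (intro card_mono) auto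
      then have c: "real (p (Suc (Suc k))) - M \<le> card (free_digits p \<inter> {..<n})" by simp
      define M' :: real where "M' = fact (Suc (Suc k))"
      have M': "real n \<le> M'" "M' = real (Suc (Suc k)) * M"
        using nM unfolding M'_def M_def by (metis less_imp_le of_nat_fact of_nat_le_iff) (simp add: algebra_simps)
      have pk': "a * M' - 2 \<le> real (p (Suc (Suc k)))" using p(1) unfolding M'_def .
      have "M \<le> (a - b) * (real n + 2)"
      proof -
        have "1 \<le> (a * (a - b)) * real (Suc (Suc k))"
          using Kk' ab by (simp add: algebra_simps)
        then have "1 * real M \<le> (a * (a - b)) * real (Suc (Suc k)) * M" by (intro mult_right_mono) auto
        also have "\<dots> = (a - b) * (a * M')" by (simp add: M')
        also have "\<dots> \<le> (a - b) * (real n + 2)" using pk' False b by (intro mult_left_mono) auto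
        finally show ?thesis by simp
      qed
      moreover have "a * n \<le> a * M'" using a M' by (intro mult_left_mono) auto
      ultimately show ?thesis
      proof (cases "b < 0")
        case True
        then show ?thesis by (smt (verit) mult_nonpos_nonneg of_nat_0_le_iff)
      next
        case False
        with a have "(a - b) * 2 \<le> 2" by simp
        with \<open>M \<le> (a - b) * (real n + 2)\<close> \<open>a * n \<le> a * M'\<close> c pk' show ?thesis by (simp add: algebra_simps)
      qed
    qed
  qed
  show ?thesis
  proof (intro exI allI)
    fix n
    show "b * real n \<le> real (card (free_digits p \<inter> {..<n})) + (fact K + 4)"
    proof (cases "fact K \<le> n")
      case True
      then show ?thesis using main[OF True] by (smt (verit) fact_ge_zero)
    next
      case False
      have "b * real n \<le> 1 * real n" using a b by (intro mult_right_mono) auto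
      also have "real n \<le> fact K" using False by (metis leI less_imp_le of_nat_fact of_nat_le_iff)
      finally show ?thesis by simp
    qed
  qed
qed

section \<open>Lines through the origin\<close>

text \<open>Only the vertical line has no slope, and a lower bound for the exceptional set can do
  without it.\<close>

definition line_of :: "real \<Rightarrow> grassmannian_2_1" where
  "line_of \<theta> = Abs_grassmannian_2_1 (span {vector [1, \<theta>]})"

lemma subspace_of_line_of: "subspace_of (line_of \<theta>) = span {vector [1, \<theta>]}"
proof -
  have "(vector [1, \<theta>] :: real^2) \<noteq> 0" by (metis one_neq_zero vector_2(1) zero_index)
  then have "dim (span {vector [1, \<theta>] :: real^2}) = 1" by (simp add: dim_span dim_singleton)
  then show ?thesis unfolding line_of_def by (intro Abs_grassmannian_2_1_inverse) simp
qed

lemma proj_line_of: "proj (line_of \<theta>) p = ((p $ 1 + \<theta> * p $ 2) / (1 + \<theta>\<^sup>2)) *\<^sub>R vector [1, \<theta>]"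
proof (rule orth_proj_unique[OF subspace_subspace_of])
  let ?c = "(p $ 1 + \<theta> * p $ 2) / (1 + \<theta>\<^sup>2)"
  show "?c *\<^sub>R vector [1, \<theta>] \<in> subspace_of (line_of \<theta>)"
    unfolding subspace_of_line_of by (intro span_mul span_base) simp
  fix w assume "w \<in> subspace_of (line_of \<theta>)"
  then obtain d where w: "w = d *\<^sub>R vector [1, \<theta>]"
    unfolding subspace_of_line_of span_singleton by blast
  have "1 + \<theta>\<^sup>2 \<noteq> 0" by (smt (verit) zero_le_power2)
  then have c: "?c * (1 + \<theta>\<^sup>2) = p $ 1 + \<theta> * p $ 2" by simp
  have "(p - a *\<^sub>R vector [1, \<theta>]) \<bullet> vector [1, \<theta>] = (p $ 1 + \<theta> * p $ 2) - a * (1 + \<theta>\<^sup>2)" for a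
    by (simp add: inner_vec_def sum_2 algebra_simps power2_eq_square)
  then have "(p - ?c *\<^sub>R vector [1, \<theta>]) \<bullet> vector [1, \<theta>] = 0" by (simp only: c)
  then show "orthogonal (p - ?c *\<^sub>R vector [1, \<theta>]) w"
    unfolding orthogonal_def w inner_scaleR_right by (simp only: mult_zero_right)
qed

lemma hausdorff_dim_proj_le: "hausdorff_dim (proj V ` X) \<le> hausdorff_dim X"
proof -
  obtain v where v: "norm v = 1" "\<And>x. proj V x = (x \<bullet> v) *\<^sub>R v" using line_direction[of V] by metis
  show ?thesis
  proof (rule hausdorff_dim_Lipschitz_image[where C = 1])
    fix x y
    have "dist (proj V x) (proj V y) = \<bar>(x - y) \<bullet> v\<bar>"
      using v(1) by (simp add: v(2) dist_norm scaleR_left_diff_distrib[symmetric] inner_diff_left)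
    also have "\<dots> \<le> norm (x - y) * norm v" by (rule Cauchy_Schwarz_ineq2)
    finally show "dist (proj V x) (proj V y) \<le> 1 * dist x y" by (simp add: v(1) dist_norm)
  qed
qed

lemma hausdorff_dim_proj_line_of_le:
  "hausdorff_dim (proj (line_of \<theta>) ` Y) \<le> hausdorff_dim ((\<lambda>p. p $ 1 + \<theta> * p $ 2) ` Y)"
proof -
  have "proj (line_of \<theta>) ` Y = (\<lambda>u. (u / (1 + \<theta>\<^sup>2)) *\<^sub>R vector [1, \<theta>]) ` ((\<lambda>p. p $ 1 + \<theta> * p $ 2) ` Y)"
    unfolding image_image proj_line_of ..
  also have "hausdorff_dim \<dots> \<le> hausdorff_dim ((\<lambda>p. p $ 1 + \<theta> * p $ 2) ` Y)"
  proof (rule hausdorff_dim_Lipschitz_image[where C = "norm (vector [1, \<theta>] :: real^2) / (1 + \<theta>\<^sup>2)"])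
    fix u u' :: real
    have p: "0 < 1 + \<theta>\<^sup>2" by (smt (verit) zero_le_power2)
    have "dist ((u / (1 + \<theta>\<^sup>2)) *\<^sub>R vector [1, \<theta>] :: real^2) ((u' / (1 + \<theta>\<^sup>2)) *\<^sub>R vector [1, \<theta>])
      = \<bar>u / (1 + \<theta>\<^sup>2) - u' / (1 + \<theta>\<^sup>2)\<bar> * norm (vector [1, \<theta>] :: real^2)"
      unfolding dist_norm scaleR_left_diff_distrib[symmetric] norm_scaleR ..
    also have "\<bar>u / (1 + \<theta>\<^sup>2) - u' / (1 + \<theta>\<^sup>2)\<bar> = \<bar>u - u'\<bar> / (1 + \<theta>\<^sup>2)"
      using p by (simp add: diff_divide_distrib[symmetric] abs_divide)
    finally show "dist ((u / (1 + \<theta>\<^sup>2)) *\<^sub>R vector [1, \<theta>] :: real^2) ((u' / (1 + \<theta>\<^sup>2)) *\<^sub>R vector [1, \<theta>])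
      \<le> norm (vector [1, \<theta>] :: real^2) / (1 + \<theta>\<^sup>2) * dist u u'"
      by (simp add: dist_real_def mult.commute)
  qed
  finally show ?thesis .
qed

text \<open>The projection of \<open>(1, 0)\<close> has coordinates \<open>a\<close> and
  \<open>a * \<theta>\<close> with \<open>a = 1 / (1 + \<theta>\<^sup>2)\<close>; the difference of
  the slopes is linear in the difference of two such projections. The constant is
  \<open>15 = 5 * (1 + 2)\<close>.\<close>

lemma slope_diff_le:
  fixes \<theta> \<theta>' :: real
  assumes "\<bar>\<theta>\<bar> \<le> 2" "\<bar>\<theta>'\<bar> \<le> 2"
  shows "\<bar>\<theta> - \<theta>'\<bar> \<le> 15 * dist (line_of \<theta>) (line_of \<theta>')"
proof -
  define e :: "real^2" where "e = vector [1, 0]"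
  define D where "D = dist (line_of \<theta>) (line_of \<theta>')"
  define w where "w = proj (line_of \<theta>) e - proj (line_of \<theta>') e"
  have "norm e = 1" unfolding e_def norm_eq_1 by (simp add: inner_vec_def sum_2)
  moreover have "norm w \<le> D * norm e"
    unfolding w_def D_def dist_grassmannian_2_1_def
    using bounded_linear_sub[OF bounded_linear_orth_proj[OF subspace_subspace_of] bounded_linear_orth_proj[OF subspace_subspace_of]]
    by (rule onorm)
  ultimately have w: "\<bar>w $ i\<bar> \<le> D" for i using component_le_norm_cart[of w i] by simp
  define a a' where "a = 1 / (1 + \<theta>\<^sup>2)" and "a' = 1 / (1 + \<theta>'\<^sup>2)"
  have w1: "w $ 1 = a - a'" and w2: "w $ 2 = a * \<theta> - a' * \<theta>'"
    unfolding w_def proj_line_of e_def a_def a'_def by simp_all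
  have p: "0 < 1 + \<theta>\<^sup>2" by (smt (verit) zero_le_power2)
  have "\<theta>\<^sup>2 \<le> 2\<^sup>2" using power_mono[OF assms(1), of 2] by simp
  then have p5: "1 + \<theta>\<^sup>2 \<le> 5" by simp
  have "a * (1 + \<theta>\<^sup>2) = 1" using p by (simp add: a_def)
  moreover have "(1 + \<theta>\<^sup>2) * (w $ 2 - \<theta>' * w $ 1) = (a * (1 + \<theta>\<^sup>2)) * (\<theta> - \<theta>')"
    unfolding w1 w2 by (simp add: algebra_simps)
  ultimately have "\<theta> - \<theta>' = (1 + \<theta>\<^sup>2) * (w $ 2 - \<theta>' * w $ 1)" by simp
  then have "\<bar>\<theta> - \<theta>'\<bar> = (1 + \<theta>\<^sup>2) * \<bar>w $ 2 - \<theta>' * w $ 1\<bar>" using p by (simp add: abs_mult)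
  also have "\<dots> \<le> 5 * (D + 2 * D)"
  proof (intro mult_mono p5)
    have "\<bar>\<theta>' * w $ 1\<bar> \<le> 2 * D" unfolding abs_mult by (intro mult_mono assms w) auto
    with w[of 2] show "\<bar>w $ 2 - \<theta>' * w $ 1\<bar> \<le> D + 2 * D" by linarith
  qed auto
  finally show ?thesis by (simp add: D_def)
qed

text \<open>Slopes depend on their lines in a Lipschitz way, so the inverse map transfers the
  dimension. They are first coordinates of planar points because digit trees produce planar
  sets.\<close>

lemma hausdorff_dim_le_lines:
  fixes \<Theta> :: "(real^2) set"
  assumes \<Theta>: "\<And>z. z \<in> \<Theta> \<Longrightarrow> \<bar>z $ 1\<bar> \<le> 2" "\<And>z. z \<in> \<Theta> \<Longrightarrow> z $ 2 = 0"
  shows "hausdorff_dim \<Theta> \<le> hausdorff_dim ((\<lambda>z. line_of (z $ 1)) ` \<Theta>)"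
proof -
  let ?l = "\<lambda>z :: real^2. line_of (z $ 1)"
  have d: "dist z z' \<le> 15 * dist (?l z) (?l z')" if "z \<in> \<Theta>" "z' \<in> \<Theta>" for z z'
  proof -
    have "dist z z' \<le> \<bar>(z - z') $ 1\<bar> + \<bar>(z - z') $ 2\<bar>"
      unfolding dist_norm using norm_le_l1_cart[of "z - z'"] by (simp add: sum_2)
    also have "\<dots> = \<bar>z $ 1 - z' $ 1\<bar>" using \<Theta>(2) that by simp
    also have "\<dots> \<le> 15 * dist (?l z) (?l z')" using \<Theta>(1) that by (intro slope_diff_le)
    finally show ?thesis .
  qed
  then have "inj_on ?l \<Theta>" by (intro inj_onI) force
  then have "\<Theta> = the_inv_into \<Theta> ?l ` (?l ` \<Theta>)" by (simp add: the_inv_into_onto)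
  also have "hausdorff_dim \<dots> \<le> hausdorff_dim (?l ` \<Theta>)"
  proof (rule hausdorff_dim_Lipschitz_image[where C = 15])
    fix V W assume "V \<in> ?l ` \<Theta>" "W \<in> ?l ` \<Theta>"
    then obtain z z' where "z \<in> \<Theta>" "V = ?l z" "z' \<in> \<Theta>" "W = ?l z'" by blast
    with d[of z z'] the_inv_into_f_f[OF \<open>inj_on ?l \<Theta>\<close>]
    show "dist (the_inv_into \<Theta> ?l V) (the_inv_into \<Theta> ?l W) \<le> 15 * dist V W" by simp
  qed
  finally show ?thesis .
qed

section \<open>The sharp example for exceptional projections\<close>

text \<open>
  Near the scale \<open>e\<close>, grid points \<open>(i / 2 ^ (q + m), j / 2 ^ q)\<close> projected along slopes \<open>h / 2 ^ m\<close>
  fall into the grid of mesh \<open>2 ^ - (q + m)\<close>, which is no finer than that of the first coordinate.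
\<close>

lemma grid_projection:
  fixes x y \<theta> e :: real and i j h m q :: nat
  assumes e: "0 \<le> e" "e \<le> 1" and x: "\<bar>x - i / 2 ^ (q + m)\<bar> \<le> 2 * e" and y: "\<bar>y - j / 2 ^ q\<bar> \<le> 2 * e"
    and \<theta>: "\<bar>\<theta> - h / 2 ^ m\<bar> \<le> 2 * e" "\<bar>\<theta>\<bar> \<le> 2" and lt: "i < 2 ^ (q + m)" "j < 2 ^ q" "h < 2 ^ m"
  shows "i + h * j < 2 * 2 ^ (q + m)" "\<bar>x + \<theta> * y - real (i + h * j) / 2 ^ (q + m)\<bar> \<le> 8 * e"
proof -
  have "h * j < 2 ^ m * 2 ^ q" using lt by (intro mult_strict_mono) auto
  with lt(1) show "i + h * j < 2 * 2 ^ (q + m)" by (simp add: power_add mult.commute)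
  have j1: "\<bar>real j / 2 ^ q\<bar> \<le> 1"
  proof -
    have "real j \<le> 2 ^ q" using lt(2) by (metis less_imp_le of_nat_le_iff of_nat_numeral of_nat_power)
    then show ?thesis by simp
  qed
  \<comment> \<open>Expands about the grid value \<open>h * j / 2 ^ (q + m)\<close>; the three
    errors are at most \<open>2 * e\<close>, \<open>4 * e\<close> and \<open>2 * e\<close>.\<close>
  have "x + \<theta> * y - real (i + h * j) / 2 ^ (q + m)
    = (x - i / 2 ^ (q + m)) + \<theta> * (y - j / 2 ^ q) + (\<theta> - h / 2 ^ m) * (j / 2 ^ q)"
    by (simp add: power_add field_simps)
  also have "\<bar>\<dots>\<bar> \<le> \<bar>x - i / 2 ^ (q + m)\<bar> + \<bar>\<theta> * (y - j / 2 ^ q)\<bar> + \<bar>(\<theta> - h / 2 ^ m) * (j / 2 ^ q)\<bar>"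
    by linarith
  also have "\<dots> \<le> 2 * e + 2 * (2 * e) + (2 * e) * 1"
    unfolding abs_mult using x y \<theta> j1 e by (intro add_mono mult_mono) auto
  finally show "\<bar>x + \<theta> * y - real (i + h * j) / 2 ^ (q + m)\<bar> \<le> 8 * e" by simp
qed

text \<open>At scale \<open>2 ^ - L\<close>, \<open>L\<close> a factorial, \<open>Y\<close> needs
  about \<open>2 powr (s * L)\<close> sets but its projection along a slope from \<Theta> only about
  \<open>2 powr (t * L)\<close>. The lower bounds for the dimensions of \<open>Y\<close> and
  \<Theta> use the digit density at all scales.\<close>

lemma exists_exceptional_set:
  fixes s t :: real
  assumes s: "0 < s" "s \<le> 1" and t: "s / 2 < t" "t < s"
  obtains Y :: "(real^2) set" where "compact Y" "hausdorff_dim Y = ereal s"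
    "ereal (2 * t - s) \<le> hausdorff_dim {V. hausdorff_dim (proj V ` Y) \<le> ereal t}"
proof -
  \<comment> \<open>\<open>pA\<close> is the exact sum of the other two, rather than a rounding of
    \<open>t * fact k\<close>, so that the meshes in \<open>grid_projection\<close> match. Two
    rounding errors add up, hence the \<open>2\<close> in
    \<open>free_digits_density\<close>.\<close>
  define pB pM pA where "pB k = nat \<lfloor>(s - t) * fact k\<rfloor>" and "pM k = nat \<lfloor>(2 * t - s) * fact k\<rfloor>"
    and "pA k = pB k + pM k" for k :: nat
  have r: "(s - t) * fact k - 1 \<le> real (pB k)" "real (pB k) \<le> (s - t) * fact k"
    "(2 * t - s) * fact k - 1 \<le> real (pM k)" "real (pM k) \<le> (2 * t - s) * fact k" for k
  proof -
    have "0 \<le> (s - t) * fact k" "0 \<le> (2 * t - s) * fact k" using t by auto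
    then show "(s - t) * fact k - 1 \<le> real (pB k)" "real (pB k) \<le> (s - t) * fact k"
      "(2 * t - s) * fact k - 1 \<le> real (pM k)" "real (pM k) \<le> (2 * t - s) * fact k"
      unfolding pB_def pM_def by linarith+
  qed
  have rA: "t * fact k - 2 \<le> real (pA k)" "real (pA k) \<le> t * fact k" for k
    using r[of k] unfolding pA_def by (simp_all add: algebra_simps)
  have le1: "p k \<le> fact k" if "real (p k) \<le> a * fact k" "a \<le> 1" for p :: "nat \<Rightarrow> nat" and a k
  proof -
    have "a * fact k \<le> 1 * fact k" using that(2) by (intro mult_right_mono) auto
    with that(1) have "real (p k) \<le> real (fact k)" unfolding of_nat_fact by linarith
    then show ?thesis by (simp only: of_nat_le_iff)
  qed
  have le: "pA k \<le> fact k" "pB k \<le> fact k" "pM k \<le> fact k" for k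
    using s t by (auto intro!: le1 rA r)
  have lo: "(s - t) * fact k - 2 \<le> real (pB k)" "(2 * t - s) * fact k - 2 \<le> real (pM k)" for k
    using r[of k] by auto
  interpret Y: digit_tree "free_digits pA" "free_digits pB" .
  interpret \<Theta>: digit_tree "free_digits pM" "{}" .
  obtain K where K: "\<And>k. k \<ge> K \<Longrightarrow> fact k \<le> pA (Suc k)" "\<And>k. k \<ge> K \<Longrightarrow> fact k \<le> pB (Suc k)"
    "\<And>k. k \<ge> K \<Longrightarrow> fact k \<le> pM (Suc k)"
  proof -
    have "\<forall>\<^sub>F k in sequentially. fact k \<le> pA (Suc k) \<and> fact k \<le> pB (Suc k) \<and> fact k \<le> pM (Suc k)"
      using s t by (intro eventually_conj eventually_fact_le_cutoff[OF _ rA(1)]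
          eventually_fact_le_cutoff[OF _ lo(1)] eventually_fact_le_cutoff[OF _ lo(2)]) auto
    then show thesis using that by (auto simp: eventually_sequentially)
  qed
  have dimY: "hausdorff_dim Y.limit_set = ereal s"
  proof (rule antisym)
    show "hausdorff_dim Y.limit_set \<le> ereal s"
    proof (rule Y.hausdorff_dim_limit_set_le)
      fix m
      define k where "k = max K m"
      have "m \<le> fact (Suc k)" using fact_ge_self[of "Suc k"] by (simp add: k_def del: fact_Suc)
      moreover have "real (Y.count (fact (Suc k))) \<le> real (fact (Suc k)) * s"
      proof -
        have "Y.count (fact (Suc k)) \<le> pA (Suc k) + pB (Suc k)"
          unfolding Y.count_def using K by (intro add_mono free_digits_count_le le) (auto simp: k_def)
        then have "real (Y.count (fact (Suc k))) \<le> real (pA (Suc k)) + real (pB (Suc k))" by linarith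
        also have "\<dots> \<le> t * fact (Suc k) + (s - t) * fact (Suc k)" by (intro add_mono rA r)
        finally show ?thesis unfolding of_nat_fact by (simp add: algebra_simps del: fact_Suc)
      qed
      ultimately show "\<exists>L\<ge>m. real (Y.count L) \<le> real L * s" by blast
    qed (use s in simp)
    show "ereal s \<le> hausdorff_dim Y.limit_set"
    proof (rule Y.hausdorff_dim_digits_ge)
      fix b assume b: "0 < b" "b < s"
      \<comment> \<open>The deficit \<open>s - b\<close> is shared equally between the two
        coordinates.\<close>
      define d where "d = (s - b) / 2"
      have d: "0 < d" "b = (t - d) + ((s - t) - d)" using b by (auto simp: d_def field_simps)
      obtain B1 where B1: "\<And>n. (t - d) * real n \<le> real (card (free_digits pA \<inter> {..<n})) + B1"
        using free_digits_density[of t pA "t - d"] rA(1) le(1) s t d by auto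
      obtain B2 where B2: "\<And>n. ((s - t) - d) * real n \<le> real (card (free_digits pB \<inter> {..<n})) + B2"
        using free_digits_density[of "s - t" pB "(s - t) - d"] lo(1) le(2) s t d by auto
      have "b * real n \<le> real (Y.count n) + (B1 + B2)" for n
      proof -
        have "b * real n = (t - d) * real n + ((s - t) - d) * real n"
          unfolding d(2) by (simp only: distrib_right)
        then show ?thesis using B1[of n] B2[of n] unfolding Y.count_def of_nat_add by linarith
      qed
      then show "\<exists>B. \<forall>k. b * real k \<le> real (Y.count k) + B" by blast
    qed
  qed
  have dim\<Theta>: "ereal (2 * t - s) \<le> hausdorff_dim \<Theta>.limit_set"
  proof (rule \<Theta>.hausdorff_dim_digits_ge)
    fix b assume "0 < b" "b < 2 * t - s"
    then show "\<exists>B. \<forall>k. b * real k \<le> real (\<Theta>.count k) + B"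
      using free_digits_density[of "2 * t - s" pM b] lo(2) le(3) s t by (simp add: \<Theta>.count_def)
  qed
  have proj: "hausdorff_dim (proj (line_of (z $ 1)) ` Y.limit_set) \<le> ereal t" if z: "z \<in> \<Theta>.limit_set" for z
  proof (rule order_trans[OF hausdorff_dim_proj_line_of_le],
      rule hausdorff_dim_le_of_covers[where C = 2 and R = 16])
    fix m :: nat
    define k where "k = max K m"
    define L :: nat where "L = fact (Suc k)"
    define q where "q = pA (Suc k)"
    define J where "J l = cball (real l / 2 ^ q) (8 * (1/2) ^ L)" for l :: nat
    have kK: "k \<ge> K" by (simp add: k_def)
    note leL = le[of "Suc k", folded L_def]
    note gap = free_digits_gap[OF le(1) K(1)[OF kK], folded L_def] free_digits_gap[OF le(2) K(2)[OF kK], folded L_def]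
      free_digits_gap[OF le(3) K(3)[OF kK], folded L_def]
    have "m \<le> L" using fact_ge_self[of "Suc k"] by (simp add: L_def k_def del: fact_Suc)
    moreover have "(\<lambda>p. p $ 1 + z $ 1 * p $ 2) ` Y.limit_set \<subseteq> (\<Union>l<2 * 2 ^ q. J l)"
    proof
      fix u assume "u \<in> (\<lambda>p. p $ 1 + z $ 1 * p $ 2) ` Y.limit_set"
      then obtain p where p: "p \<in> Y.limit_set" "u = p $ 1 + z $ 1 * p $ 2" by blast
      obtain i where i: "i < 2 ^ pA (Suc k)" "\<bar>p $ 1 - real i / 2 ^ pA (Suc k)\<bar> \<le> 2 * (1/2) ^ L"
        using Y.limit_set_near_grid1[OF p(1) gap(1) leL(1)] by blast
      obtain j where j: "j < 2 ^ pB (Suc k)" "\<bar>p $ 2 - real j / 2 ^ pB (Suc k)\<bar> \<le> 2 * (1/2) ^ L"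
        using Y.limit_set_near_grid2[OF p(1) gap(2) leL(2)] by blast
      obtain h where h: "h < 2 ^ pM (Suc k)" "\<bar>z $ 1 - real h / 2 ^ pM (Suc k)\<bar> \<le> 2 * (1/2) ^ L"
        using \<Theta>.limit_set_near_grid1[OF z gap(3) leL(3)] by blast
      have e: "0 \<le> (1/2::real) ^ L" "(1/2::real) ^ L \<le> 1" by (auto simp: power_le_one)
      note g = grid_projection[OF e i(2)[unfolded pA_def] j(2) h(2) \<Theta>.limit_set_bounded[OF z]
          i(1)[unfolded pA_def] j(1) h(1), folded pA_def q_def p(2)]
      from g(2) have "u \<in> J (i + h * j)" by (simp add: J_def dist_real_def abs_minus_commute)
      with g(1) show "u \<in> (\<Union>l<2 * 2 ^ q. J l)" by blast
    qed
    moreover have "real (2 * 2 ^ q) \<le> 2 * 2 powr (real L * t)"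
    proof -
      have "real (2 * 2 ^ q) = 2 * 2 powr real q" by (simp add: powr_realpow)
      also have "\<dots> \<le> 2 * 2 powr (real L * t)"
        using rA(2)[of "Suc k"] unfolding q_def L_def of_nat_fact
        by (intro mult_left_mono powr_mono) (simp_all add: mult.commute del: fact_Suc)
      finally show ?thesis .
    qed
    moreover have "\<forall>l<2 * 2 ^ q. bounded (J l) \<and> diameter (J l) \<le> 16 * (1/2) ^ L"
      unfolding J_def by simp
    ultimately show "\<exists>L\<ge>m. \<exists>J N. (\<lambda>p. p $ 1 + z $ 1 * p $ 2) ` Y.limit_set \<subseteq> (\<Union>i<N. J i) \<and>
      real N \<le> 2 * 2 powr (real L * t) \<and> (\<forall>i<N. bounded (J i) \<and> diameter (J i) \<le> 16 * (1/2) ^ L)"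
      by blast
  qed (use s t in simp)
  have "ereal (2 * t - s) \<le> hausdorff_dim ((\<lambda>z. line_of (z $ 1)) ` \<Theta>.limit_set)"
    using dim\<Theta> hausdorff_dim_le_lines[of \<Theta>.limit_set] \<Theta>.limit_set_bounded \<Theta>.limit_set_second_zero
    by (meson order_trans)
  also have "\<dots> \<le> hausdorff_dim {V. hausdorff_dim (proj V ` Y.limit_set) \<le> ereal t}"
    using proj by (intro hausdorff_dim_mono) blast
  finally show thesis using Y.compact_limit_set dimY by (intro that)
qed

section \<open>Conclusion\<close>

text \<open>Compactness makes \<open>X\<close> measurable, so a measure with positive mass on
  \<open>A\<close> also has positive mass on \<open>X\<close>.\<close>

lemma fourier_dim_mono:
  fixes A X :: "'a::euclidean_space set"
  assumes "A \<subseteq> X" "compact X"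
  shows "fourier_dim A \<le> fourier_dim X"
proof -
  have "compactly_supported_measures A \<subseteq> compactly_supported_measures X"
  proof
    fix \<mu> assume \<mu>: "\<mu> \<in> compactly_supported_measures A"
    then interpret finite_measure \<mu> by (rule finite_measure_compactly_supported)
    from \<mu> have "0 < emeasure \<mu> A" "sets \<mu> = sets borel" by (auto simp: compactly_supported_measures_def)
    with assms have "0 < emeasure \<mu> X" using emeasure_mono[of A X \<mu>] borel_compact[of X] by (simp add: less_le_trans)
    moreover have "emeasure \<mu> X < \<infinity>" using emeasure_finite[of X] by (simp add: less_top[symmetric])
    ultimately show "\<mu> \<in> compactly_supported_measures X"
      using \<mu> assms by (auto simp: compactly_supported_measures_def)
  qed
  then show ?thesis unfolding fourier_dim_def by (intro Sup_subset_mono) auto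
qed

theorem proposition3p2:
  fixes s t :: real
  assumes "0 < s" and "s \<le> 1" and "s / 2 < t" and "t < s"
  shows "\<exists>X :: (real^2) set.
           compact X \<and> hausdorff_dim X = ereal s \<and> fourier_dim X = ereal t \<and>
           (\<forall>u::real. u < t \<longrightarrow>
              hausdorff_dim {V :: grassmannian_2_1. hausdorff_dim (proj V ` X) \<le> ereal u} = 0) \<and>
           (\<forall>u::real. u \<ge> t \<longrightarrow>
              hausdorff_dim {V :: grassmannian_2_1. hausdorff_dim (proj V ` X) \<le> ereal u}
                \<ge> ereal (2 * t - s))"
proof -
  have t: "0 < t" "t < 1" using assms by auto
  obtain A :: "(real^2) set" where A: "compact A" "hausdorff_dim A \<le> ereal t" "ereal t \<le> fourier_dim A"
    using exists_salem_set[of t] t by (metis less_imp_le)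
  obtain Y :: "(real^2) set" where Y: "compact Y" "hausdorff_dim Y = ereal s"
    "ereal (2 * t - s) \<le> hausdorff_dim {V. hausdorff_dim (proj V ` Y) \<le> ereal t}"
    using exists_exceptional_set[OF assms] by blast
  define X where "X = A \<union> Y"
  have X: "compact X" unfolding X_def using A Y by (intro compact_Un)
  have exc: "hausdorff_dim (proj V ` X) \<le> ereal t" if "hausdorff_dim (proj V ` Y) \<le> ereal t" for V
    unfolding X_def image_Un
    using that A(2) hausdorff_dim_proj_le[of V A] by (intro hausdorff_dim_Un_leI) auto
  have dimX: "hausdorff_dim X = ereal s"
  proof (rule antisym)
    have "hausdorff_dim A \<le> ereal s" using A(2) assms by (simp add: order_trans[of _ "ereal t"])
    then show "hausdorff_dim X \<le> ereal s" unfolding X_def using Y(2) by (intro hausdorff_dim_Un_leI) auto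
    show "ereal s \<le> hausdorff_dim X" using hausdorff_dim_mono[of Y X] Y(2) by (simp add: X_def)
  qed
  have ge: "ereal t \<le> fourier_dim X"
    using A(3) fourier_dim_mono[of A X] X by (simp add: X_def)
  \<comment> \<open>The empty set has dimension \<open>0\<close>, whereas \<open>s / 2 < t\<close>
    makes \<open>2 * t - s\<close> positive.\<close>
  have "{V. hausdorff_dim (proj V ` Y) \<le> ereal t} \<noteq> {}"
  proof
    assume "{V. hausdorff_dim (proj V ` Y) \<le> ereal t} = {}"
    with Y(3) have "ereal (2 * t - s) \<le> 0" by (simp only: hausdorff_dim_empty)
    with assms show False by simp
  qed
  then obtain W where W: "hausdorff_dim (proj W ` X) \<le> ereal t" using exc by blast
  have "fourier_dim X = ereal t"
  proof (rule antisym[OF _ ge], rule ccontr)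
    assume "\<not> fourier_dim X \<le> ereal t"
    \<comment> \<open>Since \<open>t < 1\<close>, the cap \<open>1\<close> still leaves room for an
      exponent \<open>a\<close> above \<open>t\<close>, and the energy estimate requires
      \<open>a < 1\<close>.\<close>
    then have "ereal t < min (fourier_dim X) 1" using t by simp
    then obtain a where a: "ereal t < ereal a" "ereal a < min (fourier_dim X) 1"
      using ereal_dense2 by blast
    then have "ereal a \<le> hausdorff_dim (proj W ` X)"
      using t by (intro fourier_dim_le_hausdorff_dim_proj X) auto
    with W a(1) show False by (meson leD order_trans)
  qed
  moreover have "hausdorff_dim {V. hausdorff_dim (proj V ` X) \<le> ereal u} = 0" if u: "u < t" for u
  proof -
    have False if "hausdorff_dim (proj V ` X) \<le> ereal u" for V
    proof -
      obtain a where a: "max u 0 < a" "a < t" using dense[of "max u 0" t] u t by auto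
      then have "ereal a < fourier_dim X" using ge by (metis ereal_less_eq(3) leD leI order_trans)
      then have "ereal a \<le> hausdorff_dim (proj V ` X)"
        using a t by (intro fourier_dim_le_hausdorff_dim_proj X) auto
      with that a show False using order_trans[of "ereal a" _ "ereal u"] by auto
    qed
    then have "{V. hausdorff_dim (proj V ` X) \<le> ereal u} = {}" by blast
    then show ?thesis by (simp only: hausdorff_dim_empty)
  qed
  moreover have "ereal (2 * t - s) \<le> hausdorff_dim {V. hausdorff_dim (proj V ` X) \<le> ereal u}" if u: "t \<le> u" for u
  proof (rule order_trans[OF Y(3) hausdorff_dim_mono])
    show "{V. hausdorff_dim (proj V ` Y) \<le> ereal t} \<subseteq> {V. hausdorff_dim (proj V ` X) \<le> ereal u}"
      using exc u by (auto intro: order_trans[of _ "ereal t"])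
  qed
  ultimately show ?thesis using X dimX by blast
qed

end
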